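(* Let $s>1$, $\nu>0$, and $r\in[\frac12,1]$. Let $\mathbf u^0\in V\cap H^{r+s}$ and, for each $\alpha>0$, $\mathbf u^0_{\alpha,r}\in V\cap H^{r+s}$. Let $T_{\max}$ be the maximal time for which a strong solution of the Navier--Stokes equations $$\partial_t\mathbf u+B(\mathbf u,\mathbf u)+\nu A\mathbf u=\mathbf 0,\qquad\mathbf u(0)=\mathbf u^0,$$ exists and is unique, and let $0<T<T_{\max}$. Let $\mathbf u,\mathbf u_{\alpha,r}\in C([0,T],H^{r+s})\cap L^2((0,T),H^{r+s+1})$ be, respectively, the solution on $[0,T]$ of these Navier--Stokes equations and the solution on $[0,T]$ of the fractional Navier--Stokes--Voigt equations $$(I+\alpha^{2r}A^r)\frac{d}{dt}\mathbf u_{\alpha,r}+B(\mathbf u_{\alpha,r},\mathbf u_{\alpha,r})+\nu A\mathbf u_{\alpha,r}=\mathbf 0,\qquad\mathbf u_{\alpha,r}(0)=\mathbf u_{\alpha,r}^0 .$$ Then: (i) There exists $C>0$, independent of $\alpha$ and $t$, such that for all $t\in[0,T]$, with $C_T=\frac CT$, $$\|(\mathbf u-\mathbf u_{\alpha,r})(t)\|_{L^2}^2+\alpha^{2r}\|A^{r/2}(\mathbf u-\mathbf u_{\alpha,r})(t)\|_{L^2}^2\le\left(\|\mathbf u^0-\mathbf u^0_{\alpha,r}\|_{L^2}^2+\alpha^{2r}\|A^{r/2}(\mathbf u^0-\mathbf u^0_{\alpha,r})\|_{L^2}^2\right)e^{C_Tt}+CT\alpha^{2r}\|A^{r/2}\partial_t\mathbf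 u\|_{L^2(0,t;L^2)}^2e^{C_Tt}.$$ (ii) Consequently, if $\|\mathbf u^0-\mathbf u^0_{\alpha,r}\|_{L^2}^2+\alpha^{2r}\|A^{r/2}(\mathbf u^0-\mathbf u^0_{\alpha,r})\|_{L^2}^2\to0$ as $\alpha\to0$ (in particular, when $\mathbf u^0_{\alpha,r}=\mathbf u^0$), then $\mathbf u_{\alpha,r}\to\mathbf u$ in $L^2((0,T),H^1)$ as $\alpha\to0$.
   Context: All functions are $\mathbb R^3$-valued on the three-dimensional torus $\mathbb T^3=\mathbb R^3/\mathbb Z^3$. $H$ (resp. $V$) is the closure in $L^2$ (resp. $H^1$) of the smooth divergence-free mean-free fields on $\mathbb T^3$; all solutions are divergence-free and mean-free. $P_\sigma:L^2\to H$ is the Leray--Helmholtz projection, $B(\mathbf u,\mathbf v)=P_\sigma((\mathbf u\cdot\nabla)\mathbf v)$, and $A=-P_\sigma\triangle$ is the Stokes operator with domain $\mathcal D(A)=H^2(\mathbb T^3)\cap H$. $A$ is positive self-adjoint on $H$ with orthonormal eigenbasis $A\boldsymbol\varphi_k=\lambda_k\boldsymbol\varphi_k$, and $A^s\sum_ku_k\boldsymbol\varphi_k=\sum_k\lambda_k^su_k\boldsymbol\varphi_k$; on divergence-free mean-free fields $\|\mathbf u\|_{H^s}^2$ is equivalent to $\|A^{s/2}\mathbf u\|_{L^2}^2=\sum_k\lambda_k^s|u_k|^2$. A strong solution of the Navier--Stokes equations on $[0,T]$ is a (weak) solution with $\mathbf u\in C([0,T],V)\cap L^2([0,T],\mathcal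 D(A))$ and $\frac{d}{dt}\mathbf u\in L^2((0,T);H)$. *)

theory Defs
  imports "HOL-Analysis.Analysis"
begin

text \<open>
  The torus \<open>\<real>\<^sup>3 / \<int>\<^sup>3\<close> is modelled by \<open>\<int>\<^sup>3\<close>-periodic functions on \<open>\<real>\<^sup>3\<close>, integrated over the unit
  cube.  Elements of \<open>L\<^sup>2\<close> are represented by functions; two of them are identified when they agree
  almost everywhere.  Operators on \<open>L\<^sup>2\<close> classes pick a representative by Hilbert choice, so equations
  between their values are always stated almost everywhere.
\<close>

type_synonym field = "real^3 \<Rightarrow> real^3"

definition lattice :: "int^3 \<Rightarrow> real^3" where
  "lattice k = (\<chi> i. real_of_int (k $ i))"

definition periodic :: "(real^3 \<Rightarrow> 'b) \<Rightarrow> bool" where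
  "periodic f \<longleftrightarrow> (\<forall>k x. f (x + lattice k) = f x)"

definition torus :: "(real^3) measure" where
  "torus = lebesgue_on (cbox 0 1)"


subsection \<open>Smooth functions\<close>

definition pd :: "3 \<Rightarrow> (real^3 \<Rightarrow> 'b::real_normed_vector) \<Rightarrow> real^3 \<Rightarrow> 'b" where
  "pd j f x = frechet_derivative f (at x) (axis j 1)"

primrec Ck :: "nat \<Rightarrow> (real^3 \<Rightarrow> 'b::real_normed_vector) \<Rightarrow> bool" where
  "Ck 0 f \<longleftrightarrow> continuous_on UNIV f"
| "Ck (Suc n) f \<longleftrightarrow> (\<forall>x. f differentiable (at x)) \<and> (\<forall>j. Ck n (pd j f))"

definition smooth_torus :: "(real^3 \<Rightarrow> 'b::real_normed_vector) set" where
  "smooth_torus = {f. periodic f \<and> (\<forall>n. Ck n f)}"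

definition smooth_sol :: "field set" where
  "smooth_sol = {f \<in> smooth_torus. (\<forall>x. (\<Sum>j\<in>UNIV. pd j f x $ j) = 0) \<and> (LINT x|torus. f x) = 0}"


subsection \<open>The spaces \<open>L\<^sup>2\<close>, \<open>H\<^sup>\<sigma>\<close>, \<open>H\<close> and \<open>V\<close>\<close>

definition L2 :: "field set" where
  "L2 = {f. periodic f \<and> f \<in> borel_measurable torus \<and> integrable torus (\<lambda>x. (norm (f x))\<^sup>2)}"

definition ip :: "field \<Rightarrow> field \<Rightarrow> real" where
  "ip f g = (LINT x|torus. f x \<bullet> g x)"

definition L2norm :: "field \<Rightarrow> real" where
  "L2norm f = sqrt (ip f f)"

definition fourier :: "field \<Rightarrow> int^3 \<Rightarrow> complex^3" where
  "fourier f k = (\<chi> i. LINT x|torus. of_real (f x $ i) * cis (- 2 * pi * (lattice k \<bullet> x)))"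

definition sobolev_weight :: "real \<Rightarrow> int^3 \<Rightarrow> real" where
  "sobolev_weight \<sigma> k = (1 + 4 * pi\<^sup>2 * (norm (lattice k))\<^sup>2) powr \<sigma>"

definition sobolev :: "real \<Rightarrow> field set" where
  "sobolev \<sigma> = {f \<in> L2. (\<lambda>k. sobolev_weight \<sigma> k * (norm (fourier f k))\<^sup>2) summable_on UNIV}"

definition hnorm :: "real \<Rightarrow> field \<Rightarrow> real" where
  "hnorm \<sigma> f = sqrt (\<Sum>\<^sub>\<infinity>k. sobolev_weight \<sigma> k * (norm (fourier f k))\<^sup>2)"

definition H_space :: "field set" where
  "H_space = {f \<in> L2. \<forall>e>0. \<exists>g\<in>smooth_sol. L2norm (\<lambda>x. f x - g x) < e}"

definition V_space :: "field set" where
  "V_space = {f \<in> sobolev 1. \<forall>e>0. \<exists>g\<in>smooth_sol. hnorm 1 (\<lambda>x. f x - g x) < e}"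


subsection \<open>Differential operators\<close>

definition weak_pd :: "3 \<Rightarrow> field \<Rightarrow> field" where
  "weak_pd j f = (SOME g. g \<in> L2 \<and>
     (\<forall>\<psi> :: real^3 \<Rightarrow> real. \<psi> \<in> smooth_torus \<longrightarrow>
        (LINT x|torus. \<psi> x *\<^sub>R g x) = - (LINT x|torus. pd j \<psi> x *\<^sub>R f x)))"

definition leray :: "field \<Rightarrow> field" where
  "leray f = (SOME g. g \<in> H_space \<and> (\<forall>h\<in>H_space. ip (\<lambda>x. f x - g x) h = 0))"

definition advection :: "field \<Rightarrow> field \<Rightarrow> field" where
  "advection u v = (\<lambda>x. \<Sum>j\<in>UNIV. (u x $ j) *\<^sub>R weak_pd j v x)"

definition B_op :: "field \<Rightarrow> field \<Rightarrow> field" where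
  "B_op u v = leray (advection u v)"

definition dom_A :: "field set" where
  "dom_A = sobolev 2 \<inter> H_space"

definition stokes :: "field \<Rightarrow> field" where
  "stokes f = leray (\<lambda>x. - (\<Sum>j\<in>UNIV. weak_pd j (weak_pd j f) x))"

definition stokes_eigenbasis :: "(nat \<Rightarrow> field) \<Rightarrow> (nat \<Rightarrow> real) \<Rightarrow> bool" where
  "stokes_eigenbasis \<phi> lam \<longleftrightarrow>
     (\<forall>k. \<phi> k \<in> dom_A \<and> (AE x in torus. stokes (\<phi> k) x = lam k *\<^sub>R \<phi> k x)) \<and>
     (\<forall>j k. ip (\<phi> j) (\<phi> k) = (if j = k then 1 else 0)) \<and>
     (\<forall>f\<in>H_space. (\<lambda>n. L2norm (\<lambda>x. f x - (\<Sum>k<n. ip f (\<phi> k) *\<^sub>R \<phi> k x))) \<longlonglongrightarrow> 0)"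

text \<open>\<open>A\<^sup>s f\<close> is the \<open>L\<^sup>2\<close> limit of the series \<open>\<Sum>\<^sub>k \<lambda>\<^sub>k\<^sup>s f\<^sub>k \<phi>\<^sub>k\<close>.\<close>

definition stokes_pow :: "(nat \<Rightarrow> field) \<Rightarrow> (nat \<Rightarrow> real) \<Rightarrow> real \<Rightarrow> field \<Rightarrow> field" where
  "stokes_pow \<phi> lam s f = (SOME g. g \<in> H_space \<and>
     (\<lambda>n. L2norm (\<lambda>x. g x - (\<Sum>k<n. (lam k powr s * ip f (\<phi> k)) *\<^sub>R \<phi> k x))) \<longlonglongrightarrow> 0)"

definition voigt_energy :: "(nat \<Rightarrow> field) \<Rightarrow> (nat \<Rightarrow> real) \<Rightarrow> real \<Rightarrow> real \<Rightarrow> field \<Rightarrow> real" where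
  "voigt_energy \<phi> lam r \<alpha> w =
     (L2norm w)\<^sup>2 + \<alpha> powr (2 * r) * (L2norm (stokes_pow \<phi> lam (r / 2) w))\<^sup>2"


subsection \<open>Functions of time\<close>

definition C_time :: "real \<Rightarrow> field set \<Rightarrow> (field \<Rightarrow> real) \<Rightarrow> (real \<Rightarrow> field) set" where
  "C_time T X N = {u. \<forall>t\<in>{0..T}. u t \<in> X \<and>
     ((\<lambda>\<tau>. N (\<lambda>x. u \<tau> x - u t x)) \<longlongrightarrow> 0) (at t within {0..T})}"

text \<open>Measurability in time is weak measurability in \<open>L\<^sup>2\<close>; by Pettis' theorem this is the same as
  strong measurability, also in the separable spaces \<open>H\<^sup>\<sigma>\<close> embedded in \<open>L\<^sup>2\<close>.\<close>

definition L2_time :: "real \<Rightarrow> field set \<Rightarrow> (field \<Rightarrow> real) \<Rightarrow> (real \<Rightarrow> field) set" where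
  "L2_time T X N = {u.
     (\<forall>v\<in>L2. (\<lambda>t. ip (u t) v) \<in> borel_measurable (lebesgue_on {0..T})) \<and>
     (AE t in lebesgue_on {0..T}. u t \<in> X) \<and>
     integrable (lebesgue_on {0..T}) (\<lambda>t. (N (u t))\<^sup>2)}"

text \<open>\<open>u'\<close> is the time derivative of \<open>u\<close> in \<open>L\<^sup>2((0,T); H)\<close>, that is,
  \<open>u(t) = u(0) + \<integral>\<^sub>0\<^sup>t u'(\<tau>) d\<tau>\<close> in \<open>L\<^sup>2\<close>; the vector-valued integral is tested against \<open>L\<^sup>2\<close>.\<close>

definition time_deriv :: "real \<Rightarrow> (real \<Rightarrow> field) \<Rightarrow> (real \<Rightarrow> field) \<Rightarrow> bool" where
  "time_deriv T u u' \<longleftrightarrow> u' \<in> L2_time T H_space L2norm \<and>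
     (\<forall>v\<in>L2. \<forall>t\<in>{0..T}. ip (u t) v = ip (u 0) v + (LINT \<tau>|lebesgue_on {0..t}. ip (u' \<tau>) v))"


subsection \<open>Solutions\<close>

definition nse_strong :: "real \<Rightarrow> real \<Rightarrow> field \<Rightarrow> (real \<Rightarrow> field) \<Rightarrow> (real \<Rightarrow> field) \<Rightarrow> bool" where
  "nse_strong \<nu> T u0 u u' \<longleftrightarrow>
     u \<in> C_time T V_space (hnorm 1) \<and> u \<in> L2_time T dom_A (hnorm 2) \<and>
     time_deriv T u u' \<and>
     (AE t in lebesgue_on {0..T}. AE x in torus.
        u' t x + B_op (u t) (u t) x + \<nu> *\<^sub>R stokes (u t) x = 0) \<and>
     (AE x in torus. u 0 x = u0 x)"

definition nse_unique_on :: "real \<Rightarrow> real \<Rightarrow> field \<Rightarrow> bool" where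
  "nse_unique_on \<nu> T u0 \<longleftrightarrow> (\<exists>u u'. nse_strong \<nu> T u0 u u' \<and>
     (\<forall>v v'. nse_strong \<nu> T u0 v v' \<longrightarrow> (\<forall>t\<in>{0..T}. AE x in torus. v t x = u t x)))"

definition T_max :: "real \<Rightarrow> field \<Rightarrow> ereal" where
  "T_max \<nu> u0 = Sup (ereal ` {T. 0 < T \<and> nse_unique_on \<nu> T u0})"

text \<open>Membership of \<open>u'(t)\<close> in \<open>H\<^bsup>2r\<^esup>\<close> places it in the domain \<open>H\<^bsup>2r\<^esup> \<inter> H\<close> of \<open>A\<^sup>r\<close>.\<close>

definition nsv_solution ::
  "(nat \<Rightarrow> field) \<Rightarrow> (nat \<Rightarrow> real) \<Rightarrow> real \<Rightarrow> real \<Rightarrow> real \<Rightarrow> real \<Rightarrow> field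
     \<Rightarrow> (real \<Rightarrow> field) \<Rightarrow> (real \<Rightarrow> field) \<Rightarrow> bool" where
  "nsv_solution \<phi> lam r \<nu> \<alpha> T u0 u u' \<longleftrightarrow>
     (\<forall>t\<in>{0..T}. u t \<in> V_space) \<and>
     time_deriv T u u' \<and> (AE t in lebesgue_on {0..T}. u' t \<in> sobolev (2 * r)) \<and>
     (AE t in lebesgue_on {0..T}. AE x in torus.
        u' t x + \<alpha> powr (2 * r) *\<^sub>R stokes_pow \<phi> lam r (u' t) x
          + B_op (u t) (u t) x + \<nu> *\<^sub>R stokes (u t) x = 0) \<and>
     (AE x in torus. u 0 x = u0 x)"

end

theory Submission
  imports Defs
begin

text \<open>
  Everything is reduced to Fourier coefficients.  An eigenfunction of the Stokes operator with
  eigenvalue \<open>\<lambda>\<close> only has frequencies \<open>k\<close> with \<open>4 \<pi>\<^sup>2 |k|\<^sup>2 = \<lambda>\<close>, so \<open>\<Sum>\<^sub>k \<lambda>\<^sub>k\<^sup>\<sigma> f\<^sub>k\<^sup>2\<close> is dominated by the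
  \<open>H\<^sup>\<sigma>\<close> norm and both equations can be read off coefficient by coefficient in the given eigenbasis.

  With \<open>w = u - u\<^sub>\<alpha>\<close> and \<open>E = \<parallel>w\<parallel>\<^sup>2 + \<alpha>\<^bsup>2r\<^esup> \<parallel>A\<^bsup>r/2\<^esup> w\<parallel>\<^sup>2\<close>, testing the difference of the equations with \<open>w\<close> gives
  \<open>E' / 2 + \<nu> \<parallel>\<nabla> w\<parallel>\<^sup>2 = \<langle>(w \<cdot> \<nabla>) w, u\<rangle> + \<alpha>\<^bsup>2r\<^esup> \<langle>A\<^bsup>r/2\<^esup> \<partial>\<^sub>t u, A\<^bsup>r/2\<^esup> w\<rangle>\<close>.  Since \<open>r + s > 3/2\<close>, \<open>u\<close> is bounded on
  \<open>[0, T]\<close>, and Young's inequality absorbs the first term in the viscous one; the second is at most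
  \<open>\<alpha>\<^bsup>2r\<^esup> (T \<parallel>A\<^bsup>r/2\<^esup> \<partial>\<^sub>t u\<parallel>\<^sup>2 + \<parallel>A\<^bsup>r/2\<^esup> w\<parallel>\<^sup>2 / T) / 2\<close>.  Gronwall's inequality, applied to Galerkin sums
  weighted with \<open>e\<^bsup>-ct\<^esup>\<close>, proves the estimate, and the viscous term that is left over controls
  \<open>w\<close> in \<open>L\<^sup>2((0,T), H\<^sup>1)\<close>.
\<close>

section \<open>Completeness of \<open>L\<^sup>2\<close> and integration over the torus\<close>

text \<open>Weak derivatives, projections and fractional powers are Hilbert choices, and time
  derivatives are known only after testing against fixed fields. So each equation is paired with
  single eigenfunctions, and the energy identity is assembled from scalar absolutely continuous
  functions of time. The eigenvalues come in no prescribed order and eigenfunctions of one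
  eigenvalue may share frequencies, so norms are compared by duality and not by an explicit basis.
  The limit in the Galerkin sums is taken without any bound on \<partial>_t u_\<alpha>: the
  difference of the equations stays multiplied by 1 + \<alpha>^(2r) lam^r, so that only coefficients
  of \<partial>_t u appear as a source. Norms of u_\<alpha>, which may depend on \<alpha>, enter
  only the dominating function; the growth rate and the final constant depend on u alone. A
  divergent Bochner integral is 0 by convention, so integrability in time of the norm of A^(r/2)
  \<partial>_t u has to be proved before the right-hand side carries its intended meaning.\<close>

lemma L2_complete:
  fixes f :: "nat \<Rightarrow> 'a \<Rightarrow> 'b::{banach, second_countable_topology}"
  assumes M: "finite_measure M"
    and meas [measurable]: "\<And>n. f n \<in> borel_measurable M"
    and sq: "\<And>m n. integrable M (\<lambda>x. (norm (f m x - f n x))\<^sup>2)"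
    and sq0: "\<And>n. integrable M (\<lambda>x. (norm (f n x))\<^sup>2)"
    and C: "\<And>e. e > 0 \<Longrightarrow> \<exists>N. \<forall>m\<ge>N. \<forall>n\<ge>N. (\<integral>x. (norm (f m x - f n x))\<^sup>2 \<partial>M) < e"
  obtains r where
    "(\<lambda>x. lim (\<lambda>k. f (r k) x)) \<in> borel_measurable M"
    "integrable M (\<lambda>x. (norm (lim (\<lambda>k. f (r k) x)))\<^sup>2)"
    "(\<lambda>n. \<integral>x. (norm (f n x - lim (\<lambda>k. f (r k) x)))\<^sup>2 \<partial>M) \<longlonglongrightarrow> 0"
proof -
  interpret finite_measure M by fact
  \<comment> \<open>Squared gaps below (1/4)^k mean L^2 gaps below (1/2)^k, which makes the
    increments \<open>h k\<close> summable almost everywhere.\<close>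
  have "\<exists>r. \<forall>k. (\<forall>m\<ge>r k. \<forall>n\<ge>r k. (\<integral>x. (norm (f m x - f n x))\<^sup>2 \<partial>M) < (1/4)^k) \<and> r k < r (Suc k)"
  proof (rule dependent_nat_choice)
    show "\<exists>x. \<forall>m\<ge>x. \<forall>n\<ge>x. (\<integral>xa. (norm (f m xa - f n xa))\<^sup>2 \<partial>M) < (1 / 4) ^ 0"
      using C[of 1] by simp
    fix x k
    obtain N where N: "\<forall>m\<ge>N. \<forall>n\<ge>N. (\<integral>x. (norm (f m x - f n x))\<^sup>2 \<partial>M) < (1/4)^(Suc k)"
      using C[of "(1/4)^(Suc k)"] by auto
    show "\<exists>y. (\<forall>m\<ge>y. \<forall>n\<ge>y. (\<integral>xa. (norm (f m xa - f n xa))\<^sup>2 \<partial>M) < (1 / 4) ^ Suc k) \<and> x < y"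
      using N by (intro exI[of _ "max N (Suc x)"]) auto
  qed
  then obtain r where r: "\<And>k m n. m \<ge> r k \<Longrightarrow> n \<ge> r k \<Longrightarrow> (\<integral>x. (norm (f m x - f n x))\<^sup>2 \<partial>M) < (1/4)^k"
    and rS: "\<And>k. r k < r (Suc k)" by blast
  have rmono: "strict_mono r" using rS by (simp add: strict_mono_Suc_iff)
  define h where "h k x = norm (f (r (Suc k)) x - f (r k) x)" for k x
  have h0: "h k x \<ge> 0" for k x by (simp add: h_def)
  have hm [measurable]: "h k \<in> borel_measurable M" for k unfolding h_def by measurable
  \<comment> \<open>A pointwise substitute for Cauchy-Schwarz: where \<open>h k x\<close> exceeds
    (1/2)^k, the product of 2^k and \<open>h k x\<close> is at least 1. After integration the bound
    (1/4)^k on squares becomes (1/2)^k times a constant.\<close>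
  have hle: "h k x \<le> (1/2)^k + 2^k * (h k x)\<^sup>2" for k x
  proof (cases "h k x \<le> (1/2)^k")
    case True then show ?thesis by (simp add: add_increasing2)
  next
    case False
    then have "1 \<le> 2^k * h k x" by (simp add: power_one_over field_simps)
    then have "h k x * 1 \<le> h k x * (2^k * h k x)" using h0 by (intro mult_left_mono) auto
    then show ?thesis by (simp add: power2_eq_square algebra_simps add_increasing)
  qed
  have hsq: "integrable M (\<lambda>x. (h k x)\<^sup>2)" for k unfolding h_def by (rule sq)
  have hdom: "integrable M (\<lambda>x. (1/2)^k + 2^k * (h k x)\<^sup>2)" for k
    using hsq[of k] by auto
  have hint: "integrable M (h k)" for k
    by (rule Bochner_Integration.integrable_bound[OF hdom[of k]]) (auto intro!: AE_I2 simp: hle h0 abs_of_nonneg order_trans[OF hle abs_ge_self])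
  have "(\<integral>x. h k x \<partial>M) \<le> (1/2)^k * (measure M (space M) + 1)" for k
  proof -
    have "(\<integral>x. h k x \<partial>M) \<le> (\<integral>x. (1/2)^k + 2^k * (h k x)\<^sup>2 \<partial>M)"
      by (rule integral_mono[OF hint hdom hle])
    also have "\<dots> = (1/2)^k * measure M (space M) + 2^k * (\<integral>x. (h k x)\<^sup>2 \<partial>M)"
      using hsq[of k] by simp
    also have "(\<integral>x. (h k x)\<^sup>2 \<partial>M) \<le> (1/4)^k"
      unfolding h_def using r[of k "r (Suc k)" "r k"] rS[of k] by auto
    also have "2^k * (1/4)^k = (1/2::real)^k" by (simp flip: power_mult_distrib)
    finally show ?thesis by (simp add: algebra_simps)
  qed
  then have hb: "(\<integral>\<^sup>+x. ennreal (h k x) \<partial>M) \<le> ennreal ((1/2)^k * (measure M (space M) + 1))" for k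
    using hint h0 by (subst nn_integral_eq_integral) (auto intro: ennreal_leI)
  have "(\<integral>\<^sup>+x. (\<Sum>k. ennreal (h k x)) \<partial>M) = (\<Sum>k. \<integral>\<^sup>+x. ennreal (h k x) \<partial>M)"
    by (rule nn_integral_suminf) measurable
  also have "\<dots> \<le> (\<Sum>k. ennreal ((1/2)^k * (measure M (space M) + 1)))"
    by (rule suminf_le) (auto intro: hb)
  also have "\<dots> < \<infinity>"
    by (subst suminf_ennreal2) (auto intro!: summable_mult2 summable_geometric)
  finally have fin: "(\<integral>\<^sup>+x. (\<Sum>k. ennreal (h k x)) \<partial>M) \<noteq> \<infinity>" by simp
  have "AE x in M. (\<Sum>k. ennreal (h k x)) \<noteq> \<infinity>"
    by (rule nn_integral_PInf_AE[OF _ fin]) measurable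
  then have conv: "AE x in M. convergent (\<lambda>k. f (r k) x)"
  proof (eventually_elim)
    case (elim x)
    then have "summable (\<lambda>k. h k x)" by (intro summable_suminf_not_top) (auto simp: h0)
    then have "summable (\<lambda>k. f (r (Suc k)) x - f (r k) x)" unfolding h_def by (rule summable_norm_cancel)
    then have "convergent (\<lambda>n. \<Sum>k<n. f (r (Suc k)) x - f (r k) x)" by (simp add: summable_iff_convergent)
    then have "convergent (\<lambda>n. f (r n) x - f (r 0) x)" by (simp add: sum_lessThan_telescope[where f="\<lambda>k. f (r k) x"])
    then have "convergent (\<lambda>n. (f (r n) x - f (r 0) x) + f (r 0) x)" by (intro convergent_add convergent_const)
    then show ?case by simp
  qed
  define g where "g x = lim (\<lambda>k. f (r k) x)" for x
  have gm [measurable]: "g \<in> borel_measurable M" unfolding g_def by measurable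
  have gl: "AE x in M. (\<lambda>k. f (r k) x) \<longlonglongrightarrow> g x"
    using conv by eventually_elim (simp add: g_def convergent_LIMSEQ_iff)
  \<comment> \<open>Fatou along the subsequence with \<open>n\<close> held fixed. Since
    \<open>n\<close> is arbitrary beyond \<open>r k\<close>, the whole sequence converges, not only
    the subsequence.\<close>
  have fatou: "(\<integral>\<^sup>+x. ennreal ((norm (f n x - g x))\<^sup>2) \<partial>M) \<le> ennreal ((1/4)^k)" if "n \<ge> r k" for n k
  proof -
    have "(\<integral>\<^sup>+x. ennreal ((norm (f n x - g x))\<^sup>2) \<partial>M)
        = (\<integral>\<^sup>+x. liminf (\<lambda>j. ennreal ((norm (f n x - f (r j) x))\<^sup>2)) \<partial>M)"
    proof (rule nn_integral_cong_AE)
      show "AE x in M. ennreal ((norm (f n x - g x))\<^sup>2) = liminf (\<lambda>j. ennreal ((norm (f n x - f (r j) x))\<^sup>2))"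
        using gl by eventually_elim (intro lim_imp_Liminf[symmetric], auto intro!: tendsto_intros)
    qed
    also have "\<dots> \<le> liminf (\<lambda>j. \<integral>\<^sup>+x. ennreal ((norm (f n x - f (r j) x))\<^sup>2) \<partial>M)"
      by (rule nn_integral_liminf) measurable
    also have "\<dots> \<le> ennreal ((1/4)^k)"
    proof (rule Liminf_le)
      show "\<forall>\<^sub>F j in sequentially. (\<integral>\<^sup>+x. ennreal ((norm (f n x - f (r j) x))\<^sup>2) \<partial>M) \<le> ennreal ((1/4)^k)"
        using eventually_ge_at_top[of k]
      proof eventually_elim
        case (elim j)
        have "r k \<le> r j" using rmono elim by (simp add: strict_mono_less_eq)
        then show ?case using r[OF that, of "r j"] sq[of n "r j"]
          by (subst nn_integral_eq_integral) (auto intro!: ennreal_leI)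
      qed
    qed simp
    finally show ?thesis .
  qed
  have int1: "integrable M (\<lambda>x. (norm (f (r 0) x - g x))\<^sup>2)"
    using fatou[of 0 "r 0"] by (intro integrableI_bounded) (auto simp: le_less_trans top_unique)
  have gint: "integrable M (\<lambda>x. (norm (g x))\<^sup>2)"
  proof (rule Bochner_Integration.integrable_bound[of _ "\<lambda>x. 2 * (norm (f (r 0) x - g x))\<^sup>2 + 2 * (norm (f (r 0) x))\<^sup>2"])
    show "integrable M (\<lambda>x. 2 * (norm (f (r 0) x - g x))\<^sup>2 + 2 * (norm (f (r 0) x))\<^sup>2)"
      using int1 sq0 by auto
    have "(norm b)\<^sup>2 \<le> 2 * (norm (a - b))\<^sup>2 + 2 * (norm a)\<^sup>2" for a b :: 'b
    proof -
      have "norm b \<le> norm (a - b) + norm a" using norm_triangle_sub[of b a] by (simp add: norm_minus_commute)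
      then have "(norm b)\<^sup>2 \<le> (norm (a - b) + norm a)\<^sup>2" by (intro power_mono) auto
      also have "\<dots> \<le> 2 * (norm (a - b))\<^sup>2 + 2 * (norm a)\<^sup>2" using sum_squares_bound[of "norm (a - b)" "norm a"] by (simp add: power2_sum)
      finally show ?thesis .
    qed
    from this[of "g x" "f (r 0) x" for x]
    show "AE x in M. norm ((norm (g x))\<^sup>2) \<le> norm (2 * (norm (f (r 0) x - g x))\<^sup>2 + 2 * (norm (f (r 0) x))\<^sup>2)"
      by (intro AE_I2) simp
  qed measurable
  have "(\<lambda>n. \<integral>x. (norm (f n x - g x))\<^sup>2 \<partial>M) \<longlonglongrightarrow> 0"
  proof (rule LIMSEQ_I)
    fix e :: real assume "e > 0"
    then obtain k where k: "(1/4)^k < e" using real_arch_pow_inv[of e "1/4"] by auto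
    have "norm ((\<integral>x. (norm (f n x - g x))\<^sup>2 \<partial>M) - 0) < e" if "n \<ge> r k" for n
    proof -
      have "(\<integral>x. (norm (f n x - g x))\<^sup>2 \<partial>M) \<le> (1/4)^k"
        using fatou[OF that] by (intro integral_real_bounded) auto
      then show ?thesis using k by (simp add: abs_of_nonneg)
    qed
    then show "\<exists>no. \<forall>n\<ge>no. norm ((\<integral>x. (norm (f n x - g x))\<^sup>2 \<partial>M) - 0) < e" by blast
  qed
  then show ?thesis using that[of r] gm gint unfolding g_def[abs_def] by blast
qed

section \<open>Translation and integration by parts on the unit cube\<close>

lemma space_torus [simp]: "space torus = cbox 0 1"
  by (simp add: torus_def)

lemma measure_torus [simp]: "measure torus (cbox 0 1) = 1"
proof -
  have "measure lborel (cbox (0::real^3) 1) = 1"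
  proof (subst content_cbox_cart)
    have "(0::real^3) \<in> cbox 0 1" by (simp add: mem_box_cart)
    then show "cbox 0 1 \<noteq> ({} :: (real^3) set)" by blast
  qed simp
  then show ?thesis
    by (simp add: torus_def measure_restrict_space measure_completion)
qed

lemma finite_measure_torus [simp, intro]: "finite_measure torus"
  unfolding torus_def by (rule finite_measure_lebesgue_on) auto

interpretation torus: finite_measure torus
  by (rule finite_measure_torus)

lemma borel_measurable_torusI: "f \<in> borel_measurable borel \<Longrightarrow> f \<in> borel_measurable torus"
  unfolding torus_def by (simp add: borel_measurable_if_I measurable_completion measurable_restrict_space1)

lemma continuous_torus:
  fixes f :: "real^3 \<Rightarrow> 'b::{banach, second_countable_topology}"
  assumes "continuous_on UNIV f"
  shows "f \<in> borel_measurable torus" "integrable torus f"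
proof -
  show m: "f \<in> borel_measurable torus"
    by (intro borel_measurable_torusI borel_measurable_continuous_onI assms)
  have "compact (f ` cbox 0 1)" using assms by (intro compact_continuous_image) (auto intro: continuous_on_subset)
  then obtain B where "\<forall>x\<in>cbox 0 1. norm (f x) \<le> B" by (meson bounded_iff compact_imp_bounded imageI)
  then show "integrable torus f" using m by (intro torus.integrable_const_bound[of _ B]) auto
qed

lemma torus_integral_eq:
  fixes f :: "real^3 \<Rightarrow> 'b::euclidean_space"
  assumes "integrable torus f"
  shows "integral\<^sup>L torus f = integral (cbox 0 1) f"
  using assms unfolding torus_def by (intro lebesgue_integral_eq_integral) auto

lemma periodic_axis: "periodic f \<Longrightarrow> f (x + axis j 1) = f x"
proof -
  assume "periodic f"
  moreover have "axis j (1::real) = lattice (axis j 1)" by (simp add: lattice_def axis_def vec_eq_iff)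
  ultimately show ?thesis unfolding periodic_def by metis
qed

text \<open>The shifted cube protrudes from the unit cube by a slab of width \<open>h\<close>;
  periodicity moves this slab back by one period, onto the part of the unit cube that the shifted
  one misses.\<close>

lemma torus_integral_shift:
  fixes f :: "real^3 \<Rightarrow> 'b::euclidean_space"
  assumes f: "periodic f" "continuous_on UNIV f" and h: "0 \<le> h" "h \<le> 1"
  shows "(LINT x|torus. f (x + axis j h)) = (LINT x|torus. f x)"
proof -
  let ?e = "axis j (1::real) :: real^3" and ?h = "axis j h :: real^3"
  have ax: "?h = h *\<^sub>R ?e" by (simp add: axis_def vec_eq_iff)
  have fi: "f integrable_on cbox a b" for a b by (rule integrable_continuous) (use f in \<open>auto intro: continuous_on_subset\<close>)
  have inE: "?e \<in> Basis" by simp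
  \<comment> \<open>Coordinate \<open>j\<close> is separated from the others, because the boxes
    compared below differ only there.\<close>
  have all: "(\<forall>i. Q i) \<longleftrightarrow> Q j \<and> (\<forall>i. i \<noteq> j \<longrightarrow> Q i)" for Q by metis
  have "(LINT x|torus. f (x + ?h)) = integral (cbox 0 1) (\<lambda>x. f (x + ?h))"
    by (intro torus_integral_eq continuous_torus continuous_intros continuous_on_compose2[OF f(2)]) auto
  also have "\<dots> = integral (cbox ?h (1 + ?h)) f"
    using integral_shift_cbox[of "?h" "?h" "1 + ?h" f] by simp
  also have "\<dots> = integral (cbox ?h (1 + ?h) \<inter> {x. x \<bullet> ?e \<le> 1}) f + integral (cbox ?h (1 + ?h) \<inter> {x. x \<bullet> ?e \<ge> 1}) f"
    by (rule integral_split[OF fi inE])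
  also have "cbox ?h (1 + ?h) \<inter> {x. x \<bullet> ?e \<ge> 1} = cbox ?e (1 + ?h)"
    using h by (intro set_eqI, simp add: mem_box_cart inner_axis, subst (1 2) all) (auto simp: axis_def)
  also have "integral (cbox ?e (1 + ?h)) f = integral (cbox 0 (1 + ?h - ?e)) (\<lambda>x. f (x + ?e))"
    using integral_shift_cbox[of "?e" "?e" "1 + ?h" f] by simp
  also have "\<dots> = integral (cbox 0 (1 + ?h - ?e)) f" by (simp add: periodic_axis[OF f(1)])
  also have "cbox 0 (1 + ?h - ?e) = cbox 0 1 \<inter> {x. x \<bullet> ?e \<le> h}"
    using h by (intro set_eqI, simp add: mem_box_cart inner_axis, subst (1 2) all) (auto simp: axis_def)
  also have "cbox ?h (1 + ?h) \<inter> {x. x \<bullet> ?e \<le> 1} = cbox 0 1 \<inter> {x. x \<bullet> ?e \<ge> h}"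
    using h by (intro set_eqI, simp add: mem_box_cart inner_axis, subst (1 2) all) (auto simp: axis_def)
  also have "integral (cbox 0 1 \<inter> {x. x \<bullet> ?e \<ge> h}) f + integral (cbox 0 1 \<inter> {x. x \<bullet> ?e \<le> h}) f = integral (cbox 0 1) f"
    using integral_split[OF fi inE, of 0 1 h] by simp
  also have "\<dots> = (LINT x|torus. f x)"
    by (intro torus_integral_eq[symmetric] continuous_torus f)
  finally show ?thesis .
qed

text \<open>By \<open>torus_integral_shift\<close> the integral of f(x + h e_j) does not depend on h
  in [0, 1], so its derivative at h = 0, taken under the integral sign, is zero.\<close>

lemma torus_integral_pd:
  fixes f :: "real^3 \<Rightarrow> 'b::euclidean_space"
  assumes f: "periodic f" "\<And>x. f differentiable (at x)" and c: "continuous_on UNIV (pd j f)"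
  shows "(LINT x|torus. pd j f x) = 0"
proof -
  let ?G = "\<lambda>h. integral (cbox 0 1) (\<lambda>x. f (x + axis j h))"
  have fc: "continuous_on UNIV f" using f(2) by (simp add: continuous_at_imp_continuous_on differentiable_imp_continuous_within)
  define e :: "real^3" where "e = axis j 1"
  have ax: "axis j h = h *\<^sub>R e" for h by (simp add: e_def axis_def vec_eq_iff)
  have d: "((\<lambda>h. f (x + axis j h)) has_vector_derivative pd j f (x + axis j h)) (at h within {0..1})" for x h
  proof -
    have "(f has_derivative frechet_derivative f (at (x + axis j h))) (at (x + axis j h))"
      using f(2) by (simp add: frechet_derivative_works)
    then have "((\<lambda>h. f (x + axis j h)) has_derivative (\<lambda>k. frechet_derivative f (at (x + axis j h)) (k *\<^sub>R e))) (at h)"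
      unfolding ax by (intro has_derivative_compose[where f="\<lambda>h. x + h *\<^sub>R e" and g=f]) (auto intro!: derivative_eq_intros)
    moreover have "frechet_derivative f (at (x + axis j h)) (k *\<^sub>R e) = k *\<^sub>R pd j f (x + axis j h)" for k
      unfolding pd_def e_def[symmetric] using linear_frechet_derivative[OF f(2)] by (simp add: linear_cmul)
    ultimately show ?thesis unfolding has_vector_derivative_def by (simp add: has_derivative_at_withinI)
  qed
  have "(?G has_vector_derivative integral (cbox 0 1) (\<lambda>x. pd j f (x + axis j 0))) (at 0 within {0..1})"
  proof (rule leibniz_rule_vector_derivative)
    show "continuous_on ({0..1} \<times> cbox 0 1) (\<lambda>(h, x). pd j f (x + axis j h))"
      unfolding split_beta ax by (intro continuous_on_compose2[OF c] continuous_intros) auto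
    show "(\<lambda>x. f (x + axis j h)) integrable_on cbox 0 1" for h
      by (intro integrable_continuous continuous_on_compose2[OF fc] continuous_intros) auto
  qed (use d in auto)
  moreover have G: "?G h = ?G 0" if "h \<in> {0..1}" for h
  proof -
    have "?G h = (LINT x|torus. f (x + axis j h))" for h
      by (intro torus_integral_eq[symmetric] continuous_torus continuous_intros continuous_on_compose2[OF fc]) auto
    then show ?thesis using torus_integral_shift[OF f(1) fc, of h j] torus_integral_shift[OF f(1) fc, of 0 j] that by simp
  qed
  have "(?G has_vector_derivative 0) (at 0 within {0..1})"
    by (rule has_vector_derivative_transform[OF _ G has_vector_derivative_const]) auto
  ultimately have "integral (cbox 0 1) (\<lambda>x. pd j f (x + axis j 0)) = 0"
    by (intro vector_derivative_unique_within[of 0 "{0..1}"]) (auto simp: trivial_limit_within islimpt_Icc)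
  moreover have "axis j (0::real) = (0::real^3)" by (simp add: axis_def vec_eq_iff)
  ultimately have "integral (cbox 0 1) (pd j f) = 0" by simp
  then show ?thesis by (simp add: torus_integral_eq continuous_torus c)
qed

section \<open>Characters and Fourier coefficients\<close>

definition ch :: "int^3 \<Rightarrow> real^3 \<Rightarrow> complex" where
  "ch k x = cis (2 * pi * (lattice k \<bullet> x))"

definition fc :: "(real^3 \<Rightarrow> complex) \<Rightarrow> int^3 \<Rightarrow> complex" where
  "fc f k = (LINT x|torus. f x * cnj (ch k x))"

lemma lattice_simps [simp]:
  "lattice 0 = 0" "lattice (k + l) = lattice k + lattice l" "lattice (- k) = - lattice k"
  "lattice (k - l) = lattice k - lattice l" "lattice k $ i = of_int (k $ i)"
  by (simp_all add: lattice_def vec_eq_iff)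

lemma ch_add: "ch (k + l) x = ch k x * ch l x"
  by (simp add: ch_def cis_mult inner_add_left distrib_left)

lemma ch_0 [simp]: "ch 0 x = 1"
  by (simp add: ch_def)

lemma ch_minus: "ch (- k) x = cnj (ch k x)"
  by (simp add: ch_def cis_cnj)

lemma ch_diff: "ch (k - l) x = ch k x * cnj (ch l x)"
  using ch_add[of k "- l" x] by (simp add: ch_minus)

lemma norm_ch [simp]: "norm (ch k x) = 1"
  by (simp add: ch_def)

lemma ch_shift: "ch k (x + y) = ch k x * ch k y"
  by (simp add: ch_def cis_mult inner_add_right distrib_left)

lemma periodic_ch [simp, intro]: "periodic (ch k)"
proof -
  have "ch k (lattice l) = 1" for l
  proof -
    have "lattice k \<bullet> lattice l = of_int (\<Sum>i\<in>UNIV. k $ i * l $ i)"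
      by (simp add: inner_vec_def)
    then show ?thesis unfolding ch_def by (metis cis_multiple_2pi Ints_of_int)
  qed
  then show ?thesis by (simp add: periodic_def ch_shift)
qed

lemma continuous_ch [continuous_intros]: "continuous_on S (ch k)"
  unfolding ch_def[abs_def] cis_conv_exp by (intro continuous_intros)

lemma ch_measurable [measurable]: "ch k \<in> borel_measurable torus"
  by (intro continuous_torus continuous_intros)

text \<open>A shift by half a wavelength, along an axis in which \<open>k\<close> has a nonzero
  entry, multiplies the character by -1 without changing its integral.\<close>

lemma integral_ch: "(LINT x|torus. ch k x) = (if k = 0 then 1 else 0)"
proof (cases "k = 0")
  case False
  then obtain j where j: "k $ j \<noteq> 0" by (auto simp: vec_eq_iff)
  \<comment> \<open>Half a wavelength. As the entry is a nonzero integer, \<open>h\<close> stays in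
    the range [0, 1] that \<open>torus_integral_shift\<close> admits.\<close>
  define h where "h = 1 / (2 * \<bar>real_of_int (k $ j)\<bar>)"
  have h: "0 \<le> h" "h \<le> 1" using j by (auto simp: h_def field_simps)
  have "\<bar>real_of_int (k $ j) * h\<bar> = 1 / 2" using j by (simp add: h_def abs_mult)
  then have "real_of_int (k $ j) * h = 1 / 2 \<or> real_of_int (k $ j) * h = - 1 / 2" by linarith
  then have "2 * pi * (real_of_int (k $ j) * h) = pi \<or> 2 * pi * (real_of_int (k $ j) * h) = - pi" by auto
  then have "cis (2 * pi * (real_of_int (k $ j) * h)) = - 1"
    by (elim disjE) (simp_all only: complex_eq_iff, simp_all)
  then have "ch k (axis j h) = - 1" by (simp add: ch_def inner_axis)
  then have "(LINT x|torus. ch k x) = (LINT x|torus. ch k x * (- 1))"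
    using torus_integral_shift[OF periodic_ch[of k] continuous_ch h, of j] by (simp add: ch_shift)
  then show ?thesis using False by simp
qed simp

section \<open>Square-integrable periodic functions and their Fourier coefficients\<close>

definition Lsq :: "(real^3 \<Rightarrow> 'b::{banach, second_countable_topology}) set" where
  "Lsq = {f. periodic f \<and> f \<in> borel_measurable torus \<and> integrable torus (\<lambda>x. (norm (f x))\<^sup>2)}"

definition nsq :: "(real^3 \<Rightarrow> 'b::{banach, second_countable_topology}) \<Rightarrow> real" where
  "nsq f = (LINT x|torus. (norm (f x))\<^sup>2)"

text \<open>The free value type of \<open>Lsq\<close> lets vector fields and their complex
  components share one set of lemmas.\<close>

lemma L2_Lsq: "L2 = Lsq"
  by (simp add: L2_def Lsq_def)

lemma nsq_nonneg [simp]: "0 \<le> nsq f"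
  by (simp add: nsq_def)

lemma LsqD [measurable_dest]: "f \<in> Lsq \<Longrightarrow> f \<in> borel_measurable torus"
  by (simp add: Lsq_def)

lemma Lsq_sq_integrable: "f \<in> Lsq \<Longrightarrow> integrable torus (\<lambda>x. (norm (f x))\<^sup>2)"
  by (simp add: Lsq_def)

lemma LsqI_bound:
  assumes "periodic g" "g \<in> borel_measurable torus" "integrable torus h"
    and "AE x in torus. (norm (g x))\<^sup>2 \<le> h x"
  shows "g \<in> Lsq"
  unfolding Lsq_def using assms
  by (auto intro!: Bochner_Integration.integrable_bound[OF assms(3)] elim!: eventually_mono)

lemma Lsq_mult_integrable:
  fixes h :: "_ \<Rightarrow> 'c::{banach, second_countable_topology}"
  assumes "f \<in> Lsq" "g \<in> Lsq" "h \<in> borel_measurable torus" "\<And>x. norm (h x) \<le> norm (f x) * norm (g x)"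
  shows "integrable torus h"
proof (rule Bochner_Integration.integrable_bound)
  show "integrable torus (\<lambda>x. (norm (f x))\<^sup>2 + (norm (g x))\<^sup>2)"
    using assms by (intro Bochner_Integration.integrable_add Lsq_sq_integrable)
  have "norm (h x) \<le> (norm (f x))\<^sup>2 + (norm (g x))\<^sup>2" for x
  proof -
    have "0 \<le> norm (f x) * norm (g x)" by simp
    then show ?thesis using assms(4)[of x] sum_squares_bound[of "norm (f x)" "norm (g x)"] by linarith
  qed
  then show "AE x in torus. norm (h x) \<le> norm ((norm (f x))\<^sup>2 + (norm (g x))\<^sup>2)" by simp
qed fact

lemma Lsq_add:
  assumes "f \<in> Lsq" "g \<in> Lsq" shows "(\<lambda>x. f x + g x) \<in> Lsq"
proof (rule LsqI_bound)
  show "periodic (\<lambda>x. f x + g x)" using assms by (auto simp: Lsq_def periodic_def)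
  show "integrable torus (\<lambda>x. 2 * (norm (f x))\<^sup>2 + 2 * (norm (g x))\<^sup>2)"
    using assms by (intro Bochner_Integration.integrable_add integrable_mult_right Lsq_sq_integrable)
  have "(norm (f x + g x))\<^sup>2 \<le> 2 * (norm (f x))\<^sup>2 + 2 * (norm (g x))\<^sup>2" for x
  proof -
    have "(norm (f x + g x))\<^sup>2 \<le> (norm (f x) + norm (g x))\<^sup>2" by (intro power_mono norm_triangle_ineq) auto
    then show ?thesis using sum_squares_bound[of "norm (f x)" "norm (g x)"] by (simp add: power2_sum)
  qed
  then show "AE x in torus. (norm (f x + g x))\<^sup>2 \<le> 2 * (norm (f x))\<^sup>2 + 2 * (norm (g x))\<^sup>2" by simp
qed (use assms in measurable)

lemma Lsq_bounded_linear:
  assumes "f \<in> Lsq" "bounded_linear T" shows "(\<lambda>x. T (f x)) \<in> Lsq"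
proof -
  obtain K where K: "\<And>x. norm (T x) \<le> norm x * K" using bounded_linear.bounded[OF assms(2)] by blast
  have [measurable]: "T \<in> borel_measurable borel"
    by (intro borel_measurable_continuous_onI linear_continuous_on assms)
  show ?thesis
  proof (rule LsqI_bound)
    show "periodic (\<lambda>x. T (f x))" using assms by (auto simp: Lsq_def periodic_def)
    show "integrable torus (\<lambda>x. (norm (f x))\<^sup>2 * K\<^sup>2)"
      using assms by (intro integrable_mult_left Lsq_sq_integrable)
    show "AE x in torus. (norm (T (f x)))\<^sup>2 \<le> (norm (f x))\<^sup>2 * K\<^sup>2"
      using K by (auto simp flip: power_mult_distrib intro!: power_mono)
  qed (use assms in measurable)
qed

lemma Lsq_zero [simp]: "(\<lambda>x. 0) \<in> Lsq"
  by (simp add: Lsq_def periodic_def)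

lemma Lsq_scaleR: "f \<in> Lsq \<Longrightarrow> (\<lambda>x. c *\<^sub>R f x) \<in> Lsq"
  by (rule Lsq_bounded_linear[OF _ bounded_linear_scaleR_right])

lemma Lsq_uminus: "f \<in> Lsq \<Longrightarrow> (\<lambda>x. - f x) \<in> Lsq"
  using Lsq_scaleR[of f "- 1"] by simp

lemma Lsq_diff: "f \<in> Lsq \<Longrightarrow> g \<in> Lsq \<Longrightarrow> (\<lambda>x. f x - g x) \<in> Lsq"
  using Lsq_add[of f "\<lambda>x. - g x"] by (simp add: Lsq_uminus)

lemma Lsq_sum: "(\<And>i. i \<in> I \<Longrightarrow> f i \<in> Lsq) \<Longrightarrow> (\<lambda>x. \<Sum>i\<in>I. f i x) \<in> Lsq"
  by (induction I rule: infinite_finite_induct) (auto intro: Lsq_add)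

lemma Lsq_cmult: "f \<in> Lsq \<Longrightarrow> (\<lambda>x. (c::complex) * f x) \<in> Lsq"
  by (rule Lsq_bounded_linear[OF _ bounded_linear_mult_right])

lemma Lsq_cnj: "f \<in> Lsq \<Longrightarrow> (\<lambda>x. cnj (f x)) \<in> Lsq"
  by (rule Lsq_bounded_linear[OF _ bounded_linear_cnj])

lemma Lsq_continuous:
  assumes "periodic f" "continuous_on UNIV f" shows "f \<in> Lsq"
  unfolding Lsq_def using assms by (auto intro!: continuous_torus continuous_intros)

lemma Lsq_ch [simp, intro]: "ch k \<in> Lsq"
  by (intro Lsq_continuous continuous_intros periodic_ch)

lemma Lsq_mult_bounded:
  fixes f :: "real^3 \<Rightarrow> 'b::{banach, second_countable_topology, real_normed_algebra}"
  assumes "f \<in> Lsq" "periodic g" "g \<in> borel_measurable torus" "AE x in torus. norm (g x) \<le> B"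
  shows "(\<lambda>x. g x * f x) \<in> Lsq"
proof (rule LsqI_bound)
  show "periodic (\<lambda>x. g x * f x)" using assms by (auto simp: Lsq_def periodic_def)
  show "(\<lambda>x. g x * f x) \<in> borel_measurable torus" using assms by (auto simp: Lsq_def)
  show "integrable torus (\<lambda>x. B\<^sup>2 * (norm (f x))\<^sup>2)"
    using assms by (intro integrable_mult_right Lsq_sq_integrable)
  show "AE x in torus. (norm (g x * f x))\<^sup>2 \<le> B\<^sup>2 * (norm (f x))\<^sup>2"
    using assms(4)
  proof eventually_elim
    case (elim x)
    have "norm (g x * f x) \<le> B * norm (f x)"
      using norm_mult_ineq[of "g x" "f x"] mult_right_mono[OF elim, of "norm (f x)"] by simp
    then show ?case by (simp flip: power_mult_distrib add: power_mono)
  qed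
qed

lemma Lsq_ch_mult: "f \<in> Lsq \<Longrightarrow> (\<lambda>x. ch k x * f x) \<in> Lsq"
  by (rule Lsq_mult_bounded[of _ _ 1]) auto

lemma Lsq_integrable:
  assumes "f \<in> Lsq" shows "integrable torus f"
  by (rule Lsq_mult_integrable[OF assms Lsq_ch[of 0] LsqD[OF assms]]) simp

lemma Lsq_cmult_integrable:
  "f \<in> Lsq \<Longrightarrow> g \<in> Lsq \<Longrightarrow> integrable torus (\<lambda>x. f x * cnj (g x))"
  by (rule Lsq_mult_integrable[of f g]) (use LsqD[of f] LsqD[OF Lsq_cnj, of g] in \<open>auto simp: norm_mult\<close>)

lemma fc_integrable: "f \<in> Lsq \<Longrightarrow> integrable torus (\<lambda>x. f x * cnj (ch k x))"
  by (intro Lsq_cmult_integrable Lsq_ch)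

lemma fc_add: "f \<in> Lsq \<Longrightarrow> g \<in> Lsq \<Longrightarrow> fc (\<lambda>x. f x + g x) k = fc f k + fc g k"
  unfolding fc_def by (simp add: distrib_right fc_integrable)

lemma fc_diff: "f \<in> Lsq \<Longrightarrow> g \<in> Lsq \<Longrightarrow> fc (\<lambda>x. f x - g x) k = fc f k - fc g k"
  unfolding fc_def by (simp add: left_diff_distrib fc_integrable)

lemma fc_cmult: "fc (\<lambda>x. c * f x) k = c * fc f k"
  unfolding fc_def by (simp add: mult.assoc)

lemma fc_zero: "fc (\<lambda>x. 0) k = 0"
  unfolding fc_def by simp

lemma fc_sum: "(\<And>i. i \<in> I \<Longrightarrow> f i \<in> Lsq) \<Longrightarrow> fc (\<lambda>x. \<Sum>i\<in>I. f i x) k = (\<Sum>i\<in>I. fc (f i) k)"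
  by (induction I rule: infinite_finite_induct) (auto simp: fc_zero fc_add Lsq_sum)

lemma fc_ch: "fc (ch l) k = (if l = k then 1 else 0)"
  using integral_ch[of "l - k"] by (simp add: fc_def ch_diff)

lemma fc_cnj: "fc (\<lambda>x. cnj (f x)) k = cnj (fc f (- k))"
  using Bochner_Integration.integral_cnj[of torus "\<lambda>x. f x * cnj (ch (- k) x)"]
  by (simp add: fc_def ch_minus)

lemma fc_ch_mult: "fc (\<lambda>x. ch l x * f x) k = fc f (k - l)"
  unfolding fc_def by (simp add: ch_diff mult_ac)

text \<open>Completing the square in \<open>c\<close>. The choice \<open>c = fc f k\<close> gives
  Bessel's inequality for one mode; \<open>nsq_diff_sum\<close> iterates the identity over a finite
  set of modes, using their orthogonality.\<close>

lemma nsq_diff_ch: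
  assumes "f \<in> Lsq"
  shows "nsq (\<lambda>x. f x - c * ch k x) = nsq f - (norm (fc f k))\<^sup>2 + (norm (c - fc f k))\<^sup>2"
proof -
  have eq: "(norm (f x - c * ch k x))\<^sup>2 = (norm (f x))\<^sup>2 - 2 * Re (cnj c * (f x * cnj (ch k x))) + (norm c)\<^sup>2" for x
  proof -
    have "(norm (ch k x))\<^sup>2 = 1" by simp
    then have "Re (ch k x) * Re (ch k x) + Im (ch k x) * Im (ch k x) = 1" unfolding cmod_power2 by (simp add: power2_eq_square)
    then have "(Re c * Re c + Im c * Im c) * (Re (ch k x) * Re (ch k x) + Im (ch k x) * Im (ch k x)) = Re c * Re c + Im c * Im c" by simp
    then show ?thesis unfolding cmod_power2 by (simp add: power2_eq_square algebra_simps)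
  qed
  have "nsq (\<lambda>x. f x - c * ch k x) = nsq f - 2 * Re (cnj c * fc f k) + (norm c)\<^sup>2"
  proof -
    have i: "integrable torus (\<lambda>x. cnj c * (f x * cnj (ch k x)))"
      by (intro integrable_mult_right fc_integrable assms)
    define R where "R x = Re (cnj c * (f x * cnj (ch k x)))" for x
    have "(LINT x|torus. R x) = Re (cnj c * fc f k)"
      unfolding fc_def R_def by (subst integral_Re[OF i]) (simp only: integral_mult_right_zero)
    moreover have "integrable torus R"
      unfolding R_def by (intro integrable_Re i)
    ultimately show ?thesis
      unfolding nsq_def eq R_def[symmetric] using Lsq_sq_integrable[OF assms] by simp
  qed
  also have "\<dots> = nsq f - (norm (fc f k))\<^sup>2 + (norm (c - fc f k))\<^sup>2"
    unfolding cmod_power2 by (simp add: power2_eq_square algebra_simps)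
  finally show ?thesis .
qed

lemma nsq_diff_sum:
  assumes "f \<in> Lsq" "finite S"
  shows "nsq (\<lambda>x. f x - (\<Sum>k\<in>S. c k * ch k x)) = nsq f - (\<Sum>k\<in>S. (norm (fc f k))\<^sup>2) + (\<Sum>k\<in>S. (norm (c k - fc f k))\<^sup>2)"
  using assms(2)
proof induction
  case (insert k S)
  let ?h = "\<lambda>x. f x - (\<Sum>k\<in>S. c k * ch k x)"
  have sL: "(\<lambda>x. \<Sum>k\<in>S. c k * ch k x) \<in> Lsq" by (intro Lsq_sum Lsq_cmult Lsq_ch)
  have h: "?h \<in> Lsq" by (intro Lsq_diff assms sL)
  have "fc ?h k = fc f k - (\<Sum>l\<in>S. c l * fc (ch l) k)"
    by (simp add: fc_diff assms sL fc_sum Lsq_cmult fc_cmult)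
  also have "(\<Sum>l\<in>S. c l * fc (ch l) k) = 0"
    using insert by (intro sum.neutral) (auto simp: fc_ch)
  finally have "fc ?h k = fc f k" by simp
  then have "nsq (\<lambda>x. ?h x - c k * ch k x) = nsq ?h - (norm (fc f k))\<^sup>2 + (norm (c k - fc f k))\<^sup>2"
    using nsq_diff_ch[OF h, of "c k" k] by simp
  moreover have "(\<lambda>x. f x - (\<Sum>k\<in>insert k S. c k * ch k x)) = (\<lambda>x. ?h x - c k * ch k x)"
    using insert(1,2) by (simp add: fun_eq_iff)
  ultimately show ?case using insert by simp
qed simp

section \<open>Uniqueness of Fourier coefficients\<close>

text \<open>The linear span of the characters; as an inductive predicate its closure under products
  (\<open>trig_poly_mult\<close>) is a rule induction.\<close>

inductive trig_poly :: "(real^3 \<Rightarrow> complex) \<Rightarrow> bool" where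
  ch: "trig_poly (ch k)"
| add: "trig_poly f \<Longrightarrow> trig_poly g \<Longrightarrow> trig_poly (\<lambda>x. f x + g x)"
| cmult: "trig_poly f \<Longrightarrow> trig_poly (\<lambda>x. c * f x)"

lemma trig_poly_const: "trig_poly (\<lambda>x. c)"
  using trig_poly.cmult[OF trig_poly.ch[of 0], of c] by simp

lemma trig_poly_mult:
  assumes "trig_poly f" "trig_poly g"
  shows "trig_poly (\<lambda>x. f x * g x)"
  using assms(1)
proof induction
  case (ch k)
  from assms(2) show ?case
  proof induction
    case (ch l)
    then show ?case using trig_poly.ch[of "k + l"] by (simp add: ch_add[abs_def])
  next
    case (add f g)
    then show ?case using trig_poly.add by (simp add: distrib_left)
  next
    case (cmult f c)
    then show ?case using trig_poly.cmult[of _ c] by (simp add: mult.left_commute)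
  qed
next
  case (add f g)
  then show ?case using trig_poly.add by (simp add: distrib_right)
next
  case (cmult f c)
  then show ?case using trig_poly.cmult[of _ c] by (simp add: mult.assoc)
qed

lemma trig_poly_sum: "(\<And>i. i \<in> I \<Longrightarrow> trig_poly (f i)) \<Longrightarrow> trig_poly (\<lambda>x. \<Sum>i\<in>I. f i x)"
  by (induction I rule: infinite_finite_induct) (auto intro: trig_poly.add trig_poly_const)

lemma trig_poly_bounded_continuous:
  assumes "trig_poly f"
  shows "continuous_on UNIV f" "\<exists>B. \<forall>x. norm (f x) \<le> B"
proof -
  show "continuous_on UNIV f" using assms by induction (auto intro!: continuous_intros)
  show "\<exists>B. \<forall>x. norm (f x) \<le> B" using assms
  proof induction
    case (add f g)
    then obtain A B where "\<And>x. norm (f x) \<le> A" "\<And>x. norm (g x) \<le> B" by blast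
    then have "norm (f x + g x) \<le> A + B" for x by (meson norm_triangle_mono)
    then show ?case by blast
  next
    case (cmult f c)
    then obtain A where "\<And>x. norm (f x) \<le> A" by blast
    then have "norm (c * f x) \<le> norm c * A" for x by (simp add: norm_mult mult_left_mono)
    then show ?case by blast
  qed (auto intro: exI[of _ 1])
qed

lemma integrable_mult_bounded:
  fixes f g :: "real^3 \<Rightarrow> complex"
  assumes f: "integrable torus f" and g: "g \<in> borel_measurable torus" and B: "\<And>x. norm (g x) \<le> B"
  shows "integrable torus (\<lambda>x. f x * g x)"
proof (rule Bochner_Integration.integrable_bound)
  show "integrable torus (\<lambda>x. B * norm (f x))" using f by auto
  show "(\<lambda>x. f x * g x) \<in> borel_measurable torus" using f g by measurable
  show "AE x in torus. norm (f x * g x) \<le> norm (B * norm (f x))"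
  proof (intro AE_I2)
    fix x
    have "0 \<le> B" using B[of x] norm_ge_zero order_trans by blast
    then show "norm (f x * g x) \<le> norm (B * norm (f x))"
      using mult_right_mono[OF B[of x], of "norm (f x)"] by (simp add: norm_mult abs_mult mult.commute)
  qed
qed

lemma integral_trig_poly_zero:
  assumes f: "integrable torus f" and z: "\<And>k. fc f k = 0" and g: "trig_poly g"
  shows "(LINT x|torus. f x * g x) = 0"
  using g
proof induction
  case (ch k)
  then show ?case using z[of "- k"] by (simp add: fc_def ch_minus)
next
  case (add p q)
  have "integrable torus (\<lambda>x. f x * p x)" if "trig_poly p" for p
    using trig_poly_bounded_continuous[OF that] f by (auto intro: integrable_mult_bounded continuous_torus)
  then show ?case using add by (simp add: distrib_left)
next
  case (cmult p c)
  then show ?case by (simp add: mult.left_commute)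
qed

text \<open>Embeds the torus as a product of three unit circles. Polynomials in the real and
  imaginary parts of the coordinates pull back to trigonometric polynomials, so Stone-Weierstrass on
  the compact image replaces a kernel argument for the density of the latter.\<close>

definition circ :: "real^3 \<Rightarrow> complex^3" where
  "circ x = (\<chi> i. cis (2 * pi * x $ i))"

lemma continuous_circ: "continuous_on S circ"
  unfolding circ_def[abs_def] cis_conv_exp by (intro continuous_intros)

lemma circ_ch: "circ x $ i = ch (axis i 1) x"
proof -
  have "lattice (axis i 1) = axis i 1" by (simp add: lattice_def axis_def vec_eq_iff)
  then show ?thesis by (simp add: circ_def ch_def inner_axis')
qed

lemma trig_poly_circ:
  assumes "real_polynomial_function p"
  shows "trig_poly (\<lambda>x. complex_of_real (p (circ x)))"
  using assms
proof induction
  case (linear h)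
  \<comment> \<open>With \<open>a = h (axis i 1)\<close> and \<open>b = h (axis i \<i>)\<close>, a
    real-linear \<open>h\<close> contributes a cos + b sin in each coordinate, and this equals (a -
    ib)/2 times the character plus (a + ib)/2 times its conjugate.\<close>
  have "complex_of_real (h (circ x)) = (\<Sum>i\<in>UNIV.
      ((of_real (h (axis i 1)) - \<i> * of_real (h (axis i \<i>))) / 2) * ch (axis i 1) x
      + ((of_real (h (axis i 1)) + \<i> * of_real (h (axis i \<i>))) / 2) * ch (- axis i 1) x)" for x
  proof -
    have "circ x = (\<Sum>i\<in>UNIV. Re (circ x $ i) *\<^sub>R axis i 1 + Im (circ x $ i) *\<^sub>R axis i \<i>)"
      by (simp add: vec_eq_iff axis_def complex_eq_iff if_distrib cong: if_cong)
    then have "h (circ x) = h (\<Sum>i\<in>UNIV. Re (circ x $ i) *\<^sub>R axis i 1 + Im (circ x $ i) *\<^sub>R axis i \<i>)" by simp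
    also have "\<dots> = (\<Sum>i\<in>UNIV. Re (circ x $ i) * h (axis i 1) + Im (circ x $ i) * h (axis i \<i>))"
      using bounded_linear.linear[OF linear] by (simp add: linear_sum linear_add linear_cmul)
    finally show ?thesis unfolding of_real_sum
      by (auto intro!: sum.cong simp: circ_ch ch_minus complex_eq_iff field_simps)
  qed
  then show ?case by (simp only:) (intro trig_poly_sum trig_poly.intros)
next
  case (const c)
  then show ?case by (rule trig_poly_const)
next
  case (add f g)
  then show ?case by (simp add: trig_poly.add)
next
  case (mult f g)
  then show ?case by (simp add: trig_poly_mult)
qed

text \<open>A polynomial within \<open>e\<close> of \<open>g\<close> on the image of
  \<open>circ\<close> has vanishing pairing with \<open>f\<close>, so the pairing with
  \<open>g\<close> is at most \<open>e\<close> times the L^1 norm of \<open>f\<close>.\<close>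

lemma integral_circ_zero:
  assumes f: "integrable torus f" and z: "\<And>k. fc f k = 0"
    and g: "continuous_on UNIV (g :: complex^3 \<Rightarrow> real)"
  shows "(LINT x|torus. f x * of_real (g (circ x))) = 0"
proof -
  let ?K = "circ ` cbox 0 1"
  have K: "compact ?K" by (intro compact_continuous_image continuous_circ compact_cbox)
  define N where "N = (LINT x|torus. norm (f x))"
  have gc: "continuous_on ?K g" using g continuous_on_subset by blast
  obtain B where B: "\<And>x. x \<in> cbox 0 1 \<Longrightarrow> norm (g (circ x)) \<le> B"
    using compact_imp_bounded[OF compact_continuous_image[OF gc K]] unfolding bounded_iff by auto
  have gm: "(\<lambda>x. g (circ x)) \<in> borel_measurable torus"
    by (intro continuous_torus continuous_on_compose2[OF g continuous_circ]) auto
  have fm [measurable]: "f \<in> borel_measurable torus" using f by simp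
  have ig: "integrable torus (\<lambda>x. f x * of_real (g (circ x)))"
  proof (rule Bochner_Integration.integrable_bound[of _ "\<lambda>x. B * norm (f x)"])
    show "AE x in torus. norm (f x * complex_of_real (g (circ x))) \<le> norm (B * norm (f x))"
    proof (intro AE_I2)
      fix x assume x: "x \<in> space torus"
      then have "0 \<le> B" using B[of x] norm_ge_zero order_trans by fastforce
      then show "norm (f x * complex_of_real (g (circ x))) \<le> norm (B * norm (f x))"
        using mult_right_mono[of "norm (g (circ x))" B "norm (f x)"] B[of x] x by (simp add: norm_mult abs_mult mult.commute)
    qed
  qed (use f gm in auto)
  have "norm (LINT x|torus. f x * of_real (g (circ x))) \<le> e * N" if "e > 0" for e
  proof -
    obtain p where p: "real_polynomial_function p" "\<And>y. y \<in> ?K \<Longrightarrow> \<bar>g y - p y\<bar> < e"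
      using Stone_Weierstrass_real_polynomial_function[OF K gc \<open>e > 0\<close>] by blast
    note tp = trig_poly_circ[OF p(1)]
    have ip: "integrable torus (\<lambda>x. f x * of_real (p (circ x)))"
    proof -
      obtain A where "\<forall>x. norm (complex_of_real (p (circ x))) \<le> A"
        using trig_poly_bounded_continuous(2)[OF tp] by blast
      then show ?thesis
        by (intro integrable_mult_bounded[OF f continuous_torus(1)[OF trig_poly_bounded_continuous(1)[OF tp]]]) blast
    qed
    have "(LINT x|torus. f x * of_real (g (circ x))) = (LINT x|torus. f x * of_real (g (circ x)) - f x * of_real (p (circ x)))"
      using integral_trig_poly_zero[OF f z tp] by (subst Bochner_Integration.integral_diff[OF ig ip]) simp
    also have "norm \<dots> \<le> (LINT x|torus. e * norm (f x))"
    proof (rule Bochner_Integration.integral_norm_bound_integral)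
      fix x assume "x \<in> space torus"
      then have "\<bar>g (circ x) - p (circ x)\<bar> \<le> e" using p(2)[of "circ x"] by auto
      then have "norm (f x) * \<bar>g (circ x) - p (circ x)\<bar> \<le> norm (f x) * e" by (intro mult_left_mono) auto
      moreover have "f x * of_real (g (circ x)) - f x * of_real (p (circ x)) = f x * of_real (g (circ x) - p (circ x))"
        by (simp add: algebra_simps)
      ultimately show "norm (f x * of_real (g (circ x)) - f x * of_real (p (circ x))) \<le> e * norm (f x)"
        by (simp add: norm_mult mult.commute del: of_real_diff)
    qed (use f ig ip in auto)
    finally show ?thesis by (simp add: N_def)
  qed
  moreover have "0 \<le> N" by (simp add: N_def)
  ultimately have "norm (LINT x|torus. f x * of_real (g (circ x))) \<le> e" if "e > 0" for e
  proof -
    \<comment> \<open>The accuracy is divided by \<open>N + 1\<close> because the L^1 norm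
      \<open>N\<close> may vanish.\<close>
    have "norm (LINT x|torus. f x * of_real (g (circ x))) \<le> (e / (N + 1)) * N"
      using \<open>0 \<le> N\<close> that by (intro \<open>\<And>e. e > 0 \<Longrightarrow> _\<close>) auto
    also have "\<dots> \<le> e" using \<open>0 \<le> N\<close> that by (simp add: field_simps)
    finally show ?thesis .
  qed
  then have "norm (LINT x|torus. f x * of_real (g (circ x))) \<le> 0" by (rule field_le_epsilon) simp
  then show ?thesis by simp
qed

text \<open>\<open>circ\<close> identifies opposite faces, so one of the two points has to be
  interior: the coordinates then differ by an integer strictly between -1 and 1.\<close>

lemma circ_inj:
  assumes x: "x \<in> box 0 1" and y: "y \<in> cbox 0 1" and e: "circ x = circ y"
  shows "x = y"
proof -
  have "x $ i = y $ i" for i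
  proof -
    have "cis (2 * pi * x $ i) = cis (2 * pi * y $ i)"
      using e by (simp add: circ_def vec_eq_iff)
    then have "sin (2 * pi * x $ i) = sin (2 * pi * y $ i) \<and> cos (2 * pi * x $ i) = cos (2 * pi * y $ i)"
      by (simp add: complex_eq_iff)
    then obtain n :: int where "2 * pi * x $ i = 2 * pi * y $ i + 2 * pi * n"
      unfolding sin_cos_eq_iff by blast
    then have "2 * pi * (x $ i) = 2 * pi * (y $ i + n)" by (simp add: distrib_left)
    then have n: "x $ i = y $ i + n" by simp
    moreover have "0 < x $ i" "x $ i < 1" "0 \<le> y $ i" "y $ i \<le> 1"
      using x y by (auto simp: mem_box_cart)
    ultimately have "-1 < real_of_int n" "real_of_int n < 1" by linarith+
    then have "n = 0" by linarith
    then show ?thesis using n by simp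
  qed
  then show ?thesis by (simp add: vec_eq_iff)
qed

text \<open>\<open>circ\<close> is injective on the open cube, so an open \<open>W\<close> inside it is the preimage in the closed
  cube of the open set \<open>- circ ` (cbox 0 1 - W)\<close>; truncated distance functions to the complement
  approximate its indicator.\<close>

lemma integral_open_zero:
  assumes f: "integrable torus f" and z: "\<And>k. fc f k = 0" and W: "open W" "W \<subseteq> box 0 1"
  shows "(LINT x|torus. indicator W x *\<^sub>R f x) = 0"
proof -
  let ?D = "circ ` (cbox 0 1 - W)"
  have D: "closed ?D"
    by (intro compact_imp_closed compact_continuous_image continuous_circ compact_diff compact_cbox W)
  \<comment> \<open>\<open>infdist\<close> to the empty set is 0 by definition, so the set must be
    shown nonempty; the corner 0 of the cube lies outside every \<open>W\<close>.\<close>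
  have "0 \<in> cbox (0::real^3) 1" "0 \<notin> box (0::real^3) 1" by (auto simp: mem_box_cart)
  then have D0: "?D \<noteq> {}" using W by auto
  define g where "g n z = min 1 (real n * infdist z ?D)" for n :: nat and z
  have gc: "continuous_on UNIV (g n)" for n unfolding g_def[abs_def] by (intro continuous_intros)
  have fm [measurable]: "f \<in> borel_measurable torus" using f by simp
  have Wm: "(indicator W :: _ \<Rightarrow> real) \<in> borel_measurable torus"
    by (intro borel_measurable_torusI borel_measurable_indicator) (use W in auto)
  have gm: "(\<lambda>x. g n (circ x)) \<in> borel_measurable torus" for n
    by (intro continuous_torus continuous_on_compose2[OF gc continuous_circ]) auto
  have lim: "(\<lambda>n. g n (circ x)) \<longlonglongrightarrow> indicator W x" if x: "x \<in> cbox 0 1" for x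
  proof (cases "x \<in> W")
    case True
    have "circ x \<notin> ?D" using circ_inj[of x] W True by auto
    then have d: "infdist (circ x) ?D > 0"
      using D D0 by (simp add: infdist_pos_not_in_closed)
    obtain m where m: "1 < real m * infdist (circ x) ?D" using reals_Archimedean3[OF d] by blast
    have "\<forall>\<^sub>F n in sequentially. g n (circ x) = 1"
      using eventually_ge_at_top[of m]
    proof eventually_elim
      case (elim n)
      then have "real m * infdist (circ x) ?D \<le> real n * infdist (circ x) ?D"
        using d by (intro mult_right_mono) auto
      then show ?case using m by (simp add: g_def)
    qed
    then show ?thesis using True by (simp add: tendsto_eventually)
  next
    case False
    then have "circ x \<in> ?D" using x by auto
    then show ?thesis using False by (simp add: g_def)
  qed
  have "(\<lambda>n. LINT x|torus. f x * of_real (g n (circ x))) \<longlonglongrightarrow> (LINT x|torus. indicator W x *\<^sub>R f x)"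
  proof (rule integral_dominated_convergence[where w="\<lambda>x. norm (f x)"])
    show "AE x in torus. (\<lambda>n. f x * complex_of_real (g n (circ x))) \<longlonglongrightarrow> indicator W x *\<^sub>R f x"
    proof (intro AE_I2)
      fix x assume "x \<in> space torus"
      then have "(\<lambda>n. f x * complex_of_real (g n (circ x))) \<longlonglongrightarrow> f x * of_real (indicator W x)"
        by (intro tendsto_intros lim) auto
      then show "(\<lambda>n. f x * complex_of_real (g n (circ x))) \<longlonglongrightarrow> indicator W x *\<^sub>R f x"
        by (simp add: scaleR_conv_of_real mult.commute)
    qed
    have "\<bar>g n z\<bar> \<le> 1" for n z by (auto simp: g_def infdist_nonneg)
    then show "AE x in torus. norm (f x * complex_of_real (g n (circ x))) \<le> norm (f x)" for n
      by (auto simp: norm_mult mult_left_le)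
  qed (use f gm Wm in auto)
  moreover have "(LINT x|torus. f x * of_real (g n (circ x))) = 0" for n
    by (rule integral_circ_zero[OF f z gc])
  ultimately show ?thesis by (simp add: LIMSEQ_const_iff)
qed

lemma AE_torus_box: "AE x in torus. x \<in> box 0 1"
proof -
  have "negligible (cbox (0::real^3) 1 - box 0 1)" by (rule negligible_frontier_interval)
  then have "AE x in lebesgue. x \<notin> cbox (0::real^3) 1 - box 0 1"
    unfolding negligible_iff_null_sets by (rule AE_not_in)
  then have "AE x in lebesgue. x \<in> cbox (0::real^3) 1 \<longrightarrow> x \<in> box 0 1"
    by eventually_elim blast
  then show ?thesis unfolding torus_def by (subst AE_restrict_space_iff) simp_all
qed

text \<open>Up to a null set, the set where \<open>F\<close> is positive is the intersection of a
  decreasing sequence of open sets. The vanishing integrals pass to it by dominated convergence, and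
  a positive function with integral zero lives on a null set.\<close>

lemma AE_nonpos_of_open:
  fixes F :: "real^3 \<Rightarrow> real"
  assumes F: "integrable torus F"
    and z: "\<And>W. open W \<Longrightarrow> W \<subseteq> box 0 1 \<Longrightarrow> (LINT x|torus. indicator W x *\<^sub>R F x) = 0"
  shows "AE x in torus. F x \<le> 0"
proof -
  define A where "A = {x \<in> box 0 1. F x > 0}"
  have Fm [measurable]: "F \<in> borel_measurable torus" using F by simp
  have "{x \<in> space torus. F x > 0} \<in> sets torus" by measurable
  then have "{x \<in> cbox 0 1. F x > 0} \<in> sets lebesgue"
    by (simp add: torus_def sets_restrict_space_iff)
  then have "{x \<in> cbox 0 1. F x > 0} \<inter> box 0 1 \<in> sets lebesgue" by auto
  moreover have "{x \<in> cbox 0 1. F x > 0} \<inter> box 0 1 = A" using box_subset_cbox[of "0::real^3" 1] by (auto simp: A_def)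
  ultimately have Al: "A \<in> sets lebesgue" by simp
  have "\<exists>T. open T \<and> A \<subseteq> T \<and> T - A \<in> lmeasurable \<and> emeasure lebesgue (T - A) < ennreal (1 / Suc n)" for n
    using sets_lebesgue_outer_open[OF Al, of "1 / Suc n"] by (metis of_nat_0_less_iff zero_less_Suc zero_less_divide_1_iff)
  then obtain T where T: "\<And>n. open (T n)" "\<And>n. A \<subseteq> T n" "\<And>n. emeasure lebesgue (T n - A) < ennreal (1 / Suc n)" by metis
  \<comment> \<open>The finite intersections are still open and decrease, so their indicators
    converge pointwise, to the indicator of \<open>U\<close>.\<close>
  define V where "V n = box 0 1 \<inter> (\<Inter>m\<in>{..n}. T m)" for n
  have V: "open (V n)" "V n \<subseteq> box 0 1" "A \<subseteq> V n" for n
    using T by (auto simp: V_def A_def)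
  define U where "U = box 0 1 \<inter> (\<Inter>m. T m)"
  have "U \<in> sets borel" unfolding U_def using T(1) by auto
  then have Ub: "U \<in> sets lebesgue" by auto
  have "emeasure lebesgue (U - A) \<le> ennreal (1 / Suc n)" for n
  proof -
    have "emeasure lebesgue (U - A) \<le> emeasure lebesgue (T n - A)"
      using T(1)[of n] Al by (intro emeasure_mono) (auto simp: U_def)
    then show ?thesis using T(3)[of n] by simp
  qed
  then have "emeasure lebesgue (U - A) \<le> 0"
  proof (intro LIMSEQ_le_const)
    show "(\<lambda>n. ennreal (1 / Suc n)) \<longlonglongrightarrow> 0"
      using LIMSEQ_Suc[OF lim_inverse_n'] by (intro tendsto_ennrealI[of _ 0, simplified])
  qed auto
  then have "U - A \<in> null_sets lebesgue" using Al Ub by (auto simp: null_sets_def)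
  then have "AE x in lebesgue. x \<notin> U - A" by (rule AE_not_in)
  then have UA: "AE x in torus. x \<notin> U - A"
    unfolding torus_def by (subst AE_restrict_space_iff) (auto elim!: eventually_mono)
  have Vm: "(indicator (V n) :: _ \<Rightarrow> real) \<in> borel_measurable torus" for n
    by (intro borel_measurable_torusI borel_measurable_indicator) (use V in auto)
  have Am: "(indicator A :: _ \<Rightarrow> real) \<in> borel_measurable torus"
    unfolding torus_def using Al by (intro measurable_restrict_space1 borel_measurable_indicator)
  have AU: "A \<subseteq> U" using T by (auto simp: U_def A_def)
  have "(\<lambda>n. LINT x|torus. indicator (V n) x *\<^sub>R F x) \<longlonglongrightarrow> (LINT x|torus. indicator A x *\<^sub>R F x)"
  proof (rule integral_dominated_convergence[where w="\<lambda>x. norm (F x)"])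
    show "AE x in torus. (\<lambda>n. indicator (V n) x *\<^sub>R F x) \<longlonglongrightarrow> indicator A x *\<^sub>R F x"
      using UA
    proof eventually_elim
      case (elim x)
      have "(\<lambda>n. indicator (V n) x :: real) \<longlonglongrightarrow> indicator A x"
      proof (cases "x \<in> A")
        case True
        then have "indicator (V n) x = (1::real)" for n using V(3)[of n] by (auto simp: indicator_def)
        then show ?thesis using True by simp
      next
        case False
        then have "x \<notin> U" using elim by auto
        then obtain m where m: "x \<notin> V m" by (auto simp: U_def V_def)
        have "\<forall>\<^sub>F n in sequentially. indicator (V n) x = (0::real)"
          using eventually_ge_at_top[of m] by eventually_elim (use m in \<open>auto simp: V_def indicator_def\<close>)
        then show ?thesis using False by (simp add: tendsto_eventually)
      qed
      then show ?case by (intro tendsto_intros)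
    qed
    show "AE x in torus. norm (indicator (V n) x *\<^sub>R F x) \<le> norm (F x)" for n
      by (auto simp: indicator_def)
  qed (use F Vm Am in auto)
  then have "(LINT x|torus. indicator A x *\<^sub>R F x) = 0"
    using z[OF V(1,2)] by (simp add: LIMSEQ_const_iff)
  moreover have "integrable torus (\<lambda>x. indicator A x *\<^sub>R F x)"
  proof (rule Bochner_Integration.integrable_bound[OF F])
    show "(\<lambda>x. indicator A x *\<^sub>R F x) \<in> borel_measurable torus" using Am by measurable
  qed (auto simp: indicator_def)
  ultimately have "AE x in torus. indicator A x *\<^sub>R F x = 0"
    by (subst (asm) integral_nonneg_eq_0_iff_AE) (auto simp: A_def indicator_def)
  with AE_torus_box show ?thesis
    by eventually_elim (auto simp: A_def indicator_def split: if_splits)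
qed

text \<open>\<open>AE_nonpos_of_open\<close> bounds a real function from one side only; it is
  applied to the real and imaginary parts of \<open>f\<close> and to their negatives. Integrability
  of \<open>f\<close> suffices, so the lemma precedes any L^2 expansion.\<close>

lemma fourier_unique:
  assumes f: "integrable torus f" and z: "\<And>k. fc f k = 0"
  shows "AE x in torus. f x = 0"
proof -
  have o: "(LINT x|torus. indicator W x *\<^sub>R f x) = 0" "integrable torus (\<lambda>x. indicator W x *\<^sub>R f x)"
    if W: "open W" "W \<subseteq> box 0 1" for W
  proof -
    show "integrable torus (\<lambda>x. indicator W x *\<^sub>R f x)"
    proof (rule Bochner_Integration.integrable_bound[OF f])
      have "(indicator W :: _ \<Rightarrow> real) \<in> borel_measurable torus"
        by (intro borel_measurable_torusI borel_measurable_indicator) (use W in auto)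
      then show "(\<lambda>x. indicator W x *\<^sub>R f x) \<in> borel_measurable torus"
        using f by auto
    qed (auto simp: indicator_def)
  qed (rule integral_open_zero[OF f z W])
  have gen: "AE x in torus. T (f x) \<le> 0" if T: "bounded_linear T" for T :: "complex \<Rightarrow> real"
  proof (rule AE_nonpos_of_open)
    show "integrable torus (\<lambda>x. T (f x))" using f by (rule integrable_bounded_linear[OF T])
    fix W :: "(real^3) set" assume W: "open W" "W \<subseteq> box 0 1"
    have "(LINT x|torus. T (indicator W x *\<^sub>R f x)) = T (LINT x|torus. indicator W x *\<^sub>R f x)"
      by (rule integral_bounded_linear[OF T o(2)[OF W]])
    then show "(LINT x|torus. indicator W x *\<^sub>R T (f x)) = 0"
      using o(1)[OF W] bounded_linear.linear[OF T] by (simp add: linear_cmul linear_0)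
  qed
  have "AE x in torus. Re (f x) \<le> 0" "AE x in torus. Im (f x) \<le> 0"
    "AE x in torus. - Re (f x) \<le> 0" "AE x in torus. - Im (f x) \<le> 0"
    by (rule gen, intro bounded_linear_intros bounded_linear_Re bounded_linear_Im bounded_linear_minus)+
  then show ?thesis by eventually_elim (simp add: complex_eq_iff)
qed

section \<open>The theorems of Riesz-Fischer and Parseval\<close>

lemma has_sum_diff:
  fixes f g :: "'a \<Rightarrow> 'b::real_normed_vector"
  assumes "(f has_sum a) A" "(g has_sum b) A"
  shows "((\<lambda>x. f x - g x) has_sum (a - b)) A"
  using has_sum_add[OF assms(1), of "\<lambda>x. - g x" "- b"] assms(2) by (simp add: has_sum_uminus)

text \<open>Finite cubes of frequencies that exhaust the lattice; they turn unconditional sums into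
  limits of sequences, to which integration theorems apply.\<close>

definition kbox :: "nat \<Rightarrow> (int^3) set" where
  "kbox n = {k. \<forall>i. \<bar>k $ i\<bar> \<le> int n}"

lemma finite_kbox [simp]: "finite (kbox n)"
proof (rule finite_subset)
  show "kbox n \<subseteq> (\<lambda>f. \<chi> i. f i) ` (UNIV \<rightarrow>\<^sub>E {- int n..int n})"
  proof
    fix k assume "k \<in> kbox n"
    then have "vec_nth k \<in> UNIV \<rightarrow>\<^sub>E {- int n..int n}" by (auto simp: kbox_def abs_le_iff minus_le_iff)
    then show "k \<in> (\<lambda>f. \<chi> i. f i) ` (UNIV \<rightarrow>\<^sub>E {- int n..int n})"
      by (rule rev_image_eqI) simp
  qed
  show "finite ((\<lambda>f. \<chi> i. f i) ` (UNIV \<rightarrow>\<^sub>E {- int n..int n}) :: (int^3) set)"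
    by (intro finite_imageI finite_PiE) auto
qed

lemma kbox_mono: "m \<le> n \<Longrightarrow> kbox m \<subseteq> kbox n"
  unfolding kbox_def by (auto intro: order_trans)

lemma kbox_exhaust: "filterlim kbox (finite_subsets_at_top UNIV) sequentially"
  unfolding filterlim_finite_subsets_at_top
proof (intro allI impI, elim conjE)
  fix X :: "(int^3) set" assume X: "finite X"
  have "\<exists>n. \<forall>m\<ge>n. k \<in> kbox m" for k :: "int^3"
  proof -
    have "int (nat \<bar>k $ i\<bar>) \<le> int (\<Sum>i\<in>UNIV. nat \<bar>k $ i\<bar>)" for i
      unfolding of_nat_le_iff by (rule member_le_sum) auto
    then have "\<bar>k $ i\<bar> \<le> int (\<Sum>i\<in>UNIV. nat \<bar>k $ i\<bar>)" for i
      by (simp del: of_nat_sum)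
    moreover have "int (\<Sum>i\<in>UNIV. nat \<bar>k $ i\<bar>) \<le> int m" if "m \<ge> (\<Sum>i\<in>UNIV. nat \<bar>k $ i\<bar>)" for m
      using that by (simp only: of_nat_le_iff)
    ultimately have "k \<in> kbox m" if "m \<ge> (\<Sum>i\<in>UNIV. nat \<bar>k $ i\<bar>)" for m
      unfolding kbox_def using that order_trans by blast
    then show ?thesis by blast
  qed
  then have "\<forall>k. \<forall>\<^sub>F m in sequentially. k \<in> kbox m" by (simp add: eventually_sequentially)
  then have "\<forall>\<^sub>F m in sequentially. \<forall>k\<in>X. k \<in> kbox m" using X by (simp add: eventually_ball_finite)
  then show "\<forall>\<^sub>F n in sequentially. finite (kbox n) \<and> X \<subseteq> kbox n \<and> kbox n \<subseteq> UNIV"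
    by eventually_elim auto
qed

lemma has_sum_kbox: "(f has_sum a) UNIV \<Longrightarrow> (\<lambda>n. sum f (kbox n)) \<longlonglongrightarrow> a"
  unfolding has_sum_def by (rule filterlim_compose[OF _ kbox_exhaust])

lemma norm_fc_le: "f \<in> Lsq \<Longrightarrow> (norm (fc f k))\<^sup>2 \<le> nsq f"
  using nsq_diff_ch[of f "fc f k" k] nsq_nonneg[of "\<lambda>x. f x - fc f k * ch k x"] by simp

lemma bessel_summable:
  assumes "f \<in> Lsq" shows "(\<lambda>k. (norm (fc f k))\<^sup>2) summable_on UNIV"
proof (rule nonneg_bdd_above_summable_on)
  have "(\<Sum>k\<in>S. (norm (fc f k))\<^sup>2) \<le> nsq f" if "finite S" for S
    using nsq_diff_sum[OF assms that, of "fc f"] nsq_nonneg[of "\<lambda>x. f x - (\<Sum>k\<in>S. fc f k * ch k x)"] by simp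
  then show "bdd_above (sum (\<lambda>k. (cmod (fc f k))\<^sup>2) ` {F. F \<subseteq> UNIV \<and> finite F})"
    by (auto intro!: bdd_aboveI[of _ "nsq f"])
qed simp

lemma nsq_cong_AE:
  assumes "AE x in torus. f x = g x" "f \<in> borel_measurable torus" "g \<in> borel_measurable torus"
  shows "nsq f = nsq g"
  unfolding nsq_def using assms by (intro integral_cong_AE) (auto elim!: eventually_mono)

lemma fc_trig_sum: "finite S \<Longrightarrow> fc (\<lambda>x. \<Sum>l\<in>S. c l * ch l x) k = (if k \<in> S then c k else 0)"
  by (simp add: fc_sum Lsq_cmult fc_cmult fc_ch if_distrib cong: if_cong)

lemma Lsq_trig_sum: "(\<lambda>x. \<Sum>l\<in>S. c l * ch l x) \<in> Lsq"
  by (intro Lsq_sum Lsq_cmult Lsq_ch)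

lemma Lsq_complete:
  fixes f :: "nat \<Rightarrow> real^3 \<Rightarrow> 'b::{banach, second_countable_topology}"
  assumes f: "\<And>n. f n \<in> Lsq"
    and C: "\<And>e. e > 0 \<Longrightarrow> \<exists>N. \<forall>m\<ge>N. \<forall>n\<ge>N. nsq (\<lambda>x. f m x - f n x) < e"
  obtains g where "g \<in> Lsq" "(\<lambda>n. nsq (\<lambda>x. f n x - g x)) \<longlonglongrightarrow> 0"
proof (rule L2_complete[of torus f])
  show "integrable torus (\<lambda>x. (norm (f m x - f n x))\<^sup>2)" for m n
    by (intro Lsq_sq_integrable Lsq_diff f)
  fix r assume r: "(\<lambda>x. lim (\<lambda>k. f (r k) x)) \<in> borel_measurable torus"
    "integrable torus (\<lambda>x. (norm (lim (\<lambda>k. f (r k) x)))\<^sup>2)"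
    "(\<lambda>n. LINT x|torus. (norm (f n x - lim (\<lambda>k. f (r k) x)))\<^sup>2) \<longlonglongrightarrow> 0"
  \<comment> \<open>Members of \<open>Lsq\<close> are periodic at every point and not just almost
    everywhere. The pointwise formula for the limit inherits this, since equivalent points carry the
    same sequence, convergent or not.\<close>
  have "periodic (\<lambda>x. lim (\<lambda>k. f (r k) x))"
    using f by (simp add: Lsq_def periodic_def)
  then show thesis using r by (intro that[of "\<lambda>x. lim (\<lambda>k. f (r k) x)"]) (simp_all add: Lsq_def nsq_def)
qed (use f C in \<open>auto simp: nsq_def intro: LsqD Lsq_sq_integrable\<close>)

text \<open>The squared distance of two cube sums is the difference of the corresponding partial
  sums of the squares of the coefficients, so the cube sums are Cauchy. Each Fourier coefficient is
  L^2-continuous and passes to the limit.\<close>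

lemma riesz_fischer:
  assumes c: "(\<lambda>k. (norm (c k))\<^sup>2) summable_on UNIV"
  obtains f where "f \<in> Lsq" "\<And>k. fc f k = c k" "(\<lambda>n. nsq (\<lambda>x. (\<Sum>k\<in>kbox n. c k * ch k x) - f x)) \<longlonglongrightarrow> 0"
proof -
  define p where "p n x = (\<Sum>k\<in>kbox n. c k * ch k x)" for n x
  have p: "p n \<in> Lsq" for n unfolding p_def[abs_def] by (rule Lsq_trig_sum)
  have fcp: "fc (p n) k = (if k \<in> kbox n then c k else 0)" for n k
    unfolding p_def[abs_def] by (simp add: fc_trig_sum)
  define S where "S n = (\<Sum>k\<in>kbox n. (norm (c k))\<^sup>2)" for n
  \<comment> \<open>At the zero function the identity \<open>nsq_diff_sum\<close> evaluates the norm
    of a trigonometric polynomial.\<close>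
  have "nsq (\<lambda>x. 0 - p n x) = S n" for n
    using nsq_diff_sum[OF Lsq_zero finite_kbox[of n], of c] by (simp add: p_def S_def fc_zero nsq_def)
  then have pS: "nsq (p n) = S n" for n by (simp add: nsq_def)
  have d: "nsq (\<lambda>x. p m x - p n x) = \<bar>S m - S n\<bar>" for m n
  proof -
    have le: "nsq (\<lambda>x. p m x - p n x) = \<bar>S m - S n\<bar>" if "n \<le> m" for m n
    proof -
      have sub: "kbox n \<subseteq> kbox m" using that by (rule kbox_mono)
      have "nsq (\<lambda>x. p m x - p n x) = S m - S n"
        unfolding p_def[of n] using nsq_diff_sum[OF p[of m] finite_kbox[of n], of c] sub
        by (simp add: pS fcp S_def subset_iff)
      moreover have "S n \<le> S m" unfolding S_def by (intro sum_mono2 sub) auto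
      ultimately show ?thesis by simp
    qed
    show ?thesis
    proof (cases "n \<le> m")
      case False
      then have "nsq (\<lambda>x. p n x - p m x) = \<bar>S n - S m\<bar>" by (intro le) simp
      then show ?thesis by (simp add: nsq_def norm_minus_commute abs_minus_commute)
    qed (rule le)
  qed
  have "convergent S"
    unfolding S_def[abs_def] using has_sum_kbox[OF has_sum_infsum[OF c]] by (rule convergentI)
  then have "Cauchy S" by (rule convergent_Cauchy)
  then obtain f where f: "f \<in> Lsq" "(\<lambda>n. nsq (\<lambda>x. p n x - f x)) \<longlonglongrightarrow> 0"
    using Lsq_complete[of p, OF p] unfolding d Cauchy_iff real_norm_def by blast
  have "fc f k = c k" for k
  proof -
    have "(\<lambda>n. (norm (fc (p n) k - fc f k))\<^sup>2) \<longlonglongrightarrow> 0"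
    proof (rule tendsto_sandwich[OF _ _ tendsto_const f(2)])
      show "\<forall>\<^sub>F n in sequentially. (norm (fc (p n) k - fc f k))\<^sup>2 \<le> nsq (\<lambda>x. p n x - f x)"
        using norm_fc_le[OF Lsq_diff[OF p f(1)], where k=k] by (simp add: fc_diff p f)
    qed simp
    then have "(\<lambda>n. fc (p n) k - fc f k) \<longlonglongrightarrow> 0"
      by (simp add: tendsto_norm_zero_iff)
    moreover have "\<forall>\<^sub>F n in sequentially. fc (p n) k - fc f k = c k - fc f k"
    proof -
      have "\<forall>\<^sub>F n in sequentially. {k} \<subseteq> kbox n"
        using kbox_exhaust unfolding filterlim_finite_subsets_at_top by (auto elim!: allE[of _ "{k}"] eventually_mono)
      then show ?thesis by eventually_elim (simp add: fcp)
    qed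
    ultimately have "(\<lambda>n::nat. c k - fc f k) \<longlonglongrightarrow> 0" by (rule Lim_transform_eventually)
    then show ?thesis by (simp add: LIMSEQ_const_iff)
  qed
  then show ?thesis using that f unfolding p_def by blast
qed

text \<open>\<open>riesz_fischer\<close> produces a function that has the coefficients of
  \<open>f\<close> and to which the series converges; \<open>fourier_unique\<close> identifies it
  with \<open>f\<close>.\<close>

lemma fourier_expansion:
  assumes f: "f \<in> Lsq"
  shows "(\<lambda>n. nsq (\<lambda>x. (\<Sum>k\<in>kbox n. fc f k * ch k x) - f x)) \<longlonglongrightarrow> 0"
proof -
  obtain g where g: "g \<in> Lsq" "\<And>k. fc g k = fc f k" "(\<lambda>n. nsq (\<lambda>x. (\<Sum>k\<in>kbox n. fc f k * ch k x) - g x)) \<longlonglongrightarrow> 0"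
    using riesz_fischer[OF bessel_summable[OF f]] by blast
  have "AE x in torus. f x - g x = 0"
    by (rule fourier_unique) (auto simp: fc_diff f g Lsq_integrable)
  then have "nsq (\<lambda>x. (\<Sum>k\<in>kbox n. fc f k * ch k x) - g x) = nsq (\<lambda>x. (\<Sum>k\<in>kbox n. fc f k * ch k x) - f x)" for n
    by (intro nsq_cong_AE) (auto intro!: LsqD Lsq_diff Lsq_trig_sum f g elim!: eventually_mono)
  then show ?thesis using g(3) by simp
qed

lemma parseval_nsq:
  assumes f: "f \<in> Lsq"
  shows "((\<lambda>k. (norm (fc f k))\<^sup>2) has_sum nsq f) UNIV"
proof -
  have "nsq (\<lambda>x. (\<Sum>k\<in>kbox n. fc f k * ch k x) - f x) = nsq f - (\<Sum>k\<in>kbox n. (norm (fc f k))\<^sup>2)" for n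
    using nsq_diff_sum[OF f finite_kbox[of n], of "fc f"] by (simp add: nsq_def norm_minus_commute)
  then have "(\<lambda>n. nsq f - (nsq f - (\<Sum>k\<in>kbox n. (norm (fc f k))\<^sup>2))) \<longlonglongrightarrow> nsq f - 0"
    using fourier_expansion[OF f] by (intro tendsto_diff) auto
  moreover have hs: "((\<lambda>k. (norm (fc f k))\<^sup>2) has_sum (\<Sum>\<^sub>\<infinity>k. (norm (fc f k))\<^sup>2)) UNIV"
    by (intro has_sum_infsum bessel_summable f)
  ultimately have "(\<Sum>\<^sub>\<infinity>k. (norm (fc f k))\<^sup>2) = nsq f"
    using has_sum_kbox[OF hs] LIMSEQ_unique by auto
  then show ?thesis using hs by simp
qed

lemma parseval:
  assumes f: "f \<in> Lsq" and g: "g \<in> Lsq"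
  shows "((\<lambda>k. fc f k * cnj (fc g k)) has_sum (LINT x|torus. f x * cnj (g x))) UNIV"
proof -
  \<comment> \<open>Polarisation over the units 1, -1, i, -i reduces the Hermitian product to norms,
    for which \<open>parseval_nsq\<close> is available.\<close>
  have pol: "a * cnj b = (of_real ((norm (a + b))\<^sup>2) - of_real ((norm (a - b))\<^sup>2)
      + \<i> * (of_real ((norm (a + \<i> * b))\<^sup>2) - of_real ((norm (a - \<i> * b))\<^sup>2))) / 4" for a b :: complex
    unfolding cmod_power2 by (simp add: complex_eq_iff power2_eq_square algebra_simps)
  let ?N = "\<lambda>h. complex_of_real (nsq h)"
  have hs: "((\<lambda>k. complex_of_real ((norm (fc f k + c * fc g k))\<^sup>2)) has_sum ?N (\<lambda>x. f x + c * g x)) UNIV" for c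
    using parseval_nsq[OF Lsq_add[OF f Lsq_cmult[OF g, of c]]]
    by (subst has_sum_of_real_iff) (simp add: fc_add f g Lsq_cmult fc_cmult)
  have nI: "integrable torus (\<lambda>x. complex_of_real ((norm (f x + c * g x))\<^sup>2))"
    and nE: "(LINT x|torus. complex_of_real ((norm (f x + c * g x))\<^sup>2)) = ?N (\<lambda>x. f x + c * g x)" for c
    using Lsq_sq_integrable[OF Lsq_add[OF f Lsq_cmult[OF g, of c]]] by (auto simp: nsq_def simp del: of_real_power)
  have "((\<lambda>k. (of_real ((norm (fc f k + 1 * fc g k))\<^sup>2) - of_real ((norm (fc f k + (- 1) * fc g k))\<^sup>2)
      + \<i> * (of_real ((norm (fc f k + \<i> * fc g k))\<^sup>2) - of_real ((norm (fc f k + (- \<i>) * fc g k))\<^sup>2))) / 4)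
     has_sum (?N (\<lambda>x. f x + 1 * g x) - ?N (\<lambda>x. f x + (- 1) * g x)
      + \<i> * (?N (\<lambda>x. f x + \<i> * g x) - ?N (\<lambda>x. f x + (- \<i>) * g x))) / 4) UNIV"
    by (intro has_sum_divide_const has_sum_add has_sum_diff has_sum_cmult_right hs)
  then have "((\<lambda>k. fc f k * cnj (fc g k)) has_sum (?N (\<lambda>x. f x + 1 * g x) - ?N (\<lambda>x. f x + (- 1) * g x)
      + \<i> * (?N (\<lambda>x. f x + \<i> * g x) - ?N (\<lambda>x. f x + (- \<i>) * g x))) / 4) UNIV"
    by (subst pol) simp
  moreover have "(LINT x|torus. f x * cnj (g x)) = (?N (\<lambda>x. f x + 1 * g x) - ?N (\<lambda>x. f x + (- 1) * g x)
      + \<i> * (?N (\<lambda>x. f x + \<i> * g x) - ?N (\<lambda>x. f x + (- \<i>) * g x))) / 4"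
  proof -
    have "(LINT x|torus. f x * cnj (g x)) = (LINT x|torus. (of_real ((norm (f x + 1 * g x))\<^sup>2) - of_real ((norm (f x + (- 1) * g x))\<^sup>2)
      + \<i> * (of_real ((norm (f x + \<i> * g x))\<^sup>2) - of_real ((norm (f x + (- \<i>) * g x))\<^sup>2))) / 4)"
    by (subst pol) simp
  also have "\<dots> = (?N (\<lambda>x. f x + 1 * g x) - ?N (\<lambda>x. f x + (- 1) * g x)
      + \<i> * (?N (\<lambda>x. f x + \<i> * g x) - ?N (\<lambda>x. f x + (- \<i>) * g x))) / 4"
    unfolding integral_divide_zero nE[symmetric]
    by (simp only: Bochner_Integration.integral_add Bochner_Integration.integral_diff integral_mult_right_zero
        Bochner_Integration.integrable_diff integrable_mult_right nI)
    finally show ?thesis .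
  qed
  ultimately show ?thesis by (simp only:)
qed

text \<open>No pointwise convergence of the series is used: the squared excess of |f| over the sum
  is at most the squared error of every cube sum, so its integral is zero.\<close>

lemma sup_le_sum_fc:
  assumes f: "f \<in> Lsq" and s: "(\<lambda>k. norm (fc f k)) summable_on UNIV"
  shows "AE x in torus. norm (f x) \<le> (\<Sum>\<^sub>\<infinity>k. norm (fc f k))"
proof -
  let ?S = "\<Sum>\<^sub>\<infinity>k. norm (fc f k)"
  define h where "h x = (max 0 (norm (f x) - ?S))\<^sup>2" for x
  have fm [measurable]: "f \<in> borel_measurable torus" using f by (rule LsqD)
  have hm [measurable]: "h \<in> borel_measurable torus" unfolding h_def by measurable
  have le: "h x \<le> (norm ((\<Sum>k\<in>kbox n. fc f k * ch k x) - f x))\<^sup>2" for x n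
  proof -
    have "norm (\<Sum>k\<in>kbox n. fc f k * ch k x) \<le> (\<Sum>k\<in>kbox n. norm (fc f k))"
      by (rule order_trans[OF norm_sum]) (simp add: norm_mult)
    also have "\<dots> \<le> ?S" by (rule finite_sum_le_infsum[OF s]) auto
    finally have "norm (f x) - ?S \<le> norm ((\<Sum>k\<in>kbox n. fc f k * ch k x) - f x)"
      using norm_triangle_ineq2[of "f x" "\<Sum>k\<in>kbox n. fc f k * ch k x"] by (simp add: norm_minus_commute)
    then show ?thesis unfolding h_def by (intro power_mono) auto
  qed
  have li: "integrable torus (\<lambda>x. (norm ((\<Sum>k\<in>kbox n. fc f k * ch k x) - f x))\<^sup>2)" for n
    by (intro Lsq_sq_integrable Lsq_diff Lsq_trig_sum f)
  have hi: "integrable torus h"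
    by (rule Bochner_Integration.integrable_bound[OF li[of 0]]) (use le[of _ 0] in \<open>auto simp: h_def\<close>)
  have "integral\<^sup>L torus h \<le> nsq (\<lambda>x. (\<Sum>k\<in>kbox n. fc f k * ch k x) - f x)" for n
    unfolding nsq_def by (intro integral_mono hi li le)
  then have "integral\<^sup>L torus h \<le> 0"
    by (intro LIMSEQ_le_const[OF fourier_expansion[OF f]]) auto
  moreover have "0 \<le> integral\<^sup>L torus h" by (intro integral_nonneg_AE) (simp add: h_def)
  ultimately have "AE x in torus. h x = 0"
    by (subst integral_nonneg_eq_0_iff_AE[symmetric]) (use hi in \<open>auto simp: h_def\<close>)
  then show ?thesis by eventually_elim (auto simp: h_def max_def split: if_splits)
qed

lemma integrable_mult_l1:
  assumes A: "A \<in> Lsq" "(\<lambda>k. norm (fc A k)) summable_on UNIV" and Y: "integrable torus (Y :: _ \<Rightarrow> complex)"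
  shows "integrable torus (\<lambda>x. A x * Y x)"
    and "norm (LINT x|torus. A x * Y x) \<le> (\<Sum>\<^sub>\<infinity>k. norm (fc A k)) * (LINT x|torus. norm (Y x))"
proof -
  have [measurable]: "A \<in> borel_measurable torus" "Y \<in> borel_measurable torus" using A Y LsqD by auto
  have S: "0 \<le> (\<Sum>\<^sub>\<infinity>k. norm (fc A k))" by (simp add: infsum_nonneg)
  have b: "AE x in torus. norm (A x * Y x) \<le> (\<Sum>\<^sub>\<infinity>k. norm (fc A k)) * norm (Y x)"
    using sup_le_sum_fc[OF A] by eventually_elim (simp add: norm_mult mult_right_mono)
  have Yi: "integrable torus (\<lambda>x. (\<Sum>\<^sub>\<infinity>k. norm (fc A k)) * norm (Y x))" using Y by auto
  show i: "integrable torus (\<lambda>x. A x * Y x)"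
    by (rule Bochner_Integration.integrable_bound[OF Yi]) (use b S in \<open>auto elim!: eventually_mono simp: abs_mult\<close>)
  have "norm (LINT x|torus. A x * Y x) \<le> (LINT x|torus. (\<Sum>\<^sub>\<infinity>k. norm (fc A k)) * norm (Y x))"
    by (rule order_trans[OF integral_norm_bound integral_mono_AE]) (use i Yi b in auto)
  then show "norm (LINT x|torus. A x * Y x) \<le> (\<Sum>\<^sub>\<infinity>k. norm (fc A k)) * (LINT x|torus. norm (Y x))"
    by simp
qed

text \<open>After removal of the modes in \<open>F\<close>, the sum of the absolute coefficients of
  \<open>A\<close> is the tail of a convergent sum, and \<open>integrable_mult_l1\<close> bounds the
  pairing with \<open>Y\<close> by this tail. Both the convolution formula for the convective term
  and its antisymmetry rest on this expansion.\<close>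

lemma product_has_sum:
  assumes A: "A \<in> Lsq" "(\<lambda>k. norm (fc A k)) summable_on UNIV" and Y: "integrable torus (Y :: _ \<Rightarrow> complex)"
  shows "((\<lambda>p. fc A p * (LINT x|torus. ch p x * Y x)) has_sum (LINT x|torus. A x * Y x)) UNIV"
proof -
  let ?S = "\<Sum>\<^sub>\<infinity>k. norm (fc A k)" and ?N = "LINT x|torus. norm (Y x)"
  have b: "dist (\<Sum>p\<in>F. fc A p * (LINT x|torus. ch p x * Y x)) (LINT x|torus. A x * Y x) \<le> (?S - (\<Sum>p\<in>F. norm (fc A p))) * ?N"
    if F: "finite F" for F
  proof -
    let ?R = "\<lambda>x. A x - (\<Sum>p\<in>F. fc A p * ch p x)"
    have R: "?R \<in> Lsq" by (intro Lsq_diff Lsq_trig_sum A)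
    have fcR: "norm (fc ?R k) = norm (fc A k) - (if k \<in> F then norm (fc A k) else 0)" for k
      by (simp add: fc_diff A Lsq_trig_sum fc_trig_sum F)
    have hsF: "((\<lambda>k. if k \<in> F then norm (fc A k) else 0) has_sum (\<Sum>p\<in>F. norm (fc A p))) UNIV"
    proof -
      have "((\<lambda>k. if k \<in> F then norm (fc A k) else 0) has_sum a) UNIV \<longleftrightarrow> ((\<lambda>k. norm (fc A k)) has_sum a) F" for a
        by (rule has_sum_cong_neutral) auto
      then show ?thesis using has_sum_finite[OF F] by blast
    qed
    have "((\<lambda>k. norm (fc A k) - (if k \<in> F then norm (fc A k) else 0)) has_sum (?S - (\<Sum>p\<in>F. norm (fc A p)))) UNIV"
      by (intro has_sum_diff hsF has_sum_infsum A)
    then have hR: "((\<lambda>k. norm (fc ?R k)) has_sum (?S - (\<Sum>p\<in>F. norm (fc A p)))) UNIV" unfolding fcR .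
    have chi: "integrable torus (\<lambda>x. fc A p * (ch p x * Y x))" for p
      using integrable_mult_bounded[OF Y ch_measurable, of p 1] by (intro integrable_mult_right) (simp add: mult.commute)
    have "(LINT x|torus. ?R x * Y x) = (LINT x|torus. A x * Y x - (\<Sum>p\<in>F. fc A p * (ch p x * Y x)))"
      by (intro Bochner_Integration.integral_cong) (simp_all add: left_diff_distrib sum_distrib_right mult.assoc)
    also have "\<dots> = (LINT x|torus. A x * Y x) - (\<Sum>p\<in>F. fc A p * (LINT x|torus. ch p x * Y x))"
      using integrable_mult_l1(1)[OF A Y] chi by simp
    finally show ?thesis
      using integrable_mult_l1(2)[OF R _ Y] hR by (simp add: dist_norm norm_minus_commute infsumI has_sum_imp_summable)
  qed
  have "((\<lambda>F. (?S - (\<Sum>p\<in>F. norm (fc A p))) * ?N) \<longlongrightarrow> (?S - ?S) * ?N) (finite_subsets_at_top UNIV)"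
    using has_sum_infsum[OF A(2)] unfolding has_sum_def by (intro tendsto_intros)
  then have l: "((\<lambda>F. (?S - (\<Sum>p\<in>F. norm (fc A p))) * ?N) \<longlongrightarrow> 0) (finite_subsets_at_top UNIV)" by simp
  show ?thesis unfolding has_sum_def
    by (rule Lim_null_comparison[THEN LIM_zero_cancel, OF _ l])
      (use b in \<open>auto simp: dist_norm intro!: eventually_finite_subsets_at_top_weakI\<close>)
qed

section \<open>Vector fields and weak derivatives\<close>

abbreviation cf :: "3 \<Rightarrow> field \<Rightarrow> real^3 \<Rightarrow> complex" where
  "cf i f \<equiv> (\<lambda>x. complex_of_real (f x $ i))"

text \<open>The Fourier symbol of the \<open>j\<close>-th partial derivative.\<close>

definition dk :: "3 \<Rightarrow> int^3 \<Rightarrow> complex" where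
  "dk j k = \<i> * complex_of_real (2 * pi * real_of_int (k $ j))"

lemma fourier_nth: "fourier f k $ i = fc (cf i f) k"
  unfolding fourier_def fc_def ch_def by (simp add: cis_cnj)

lemma Lsq_cf: "f \<in> L2 \<Longrightarrow> cf i f \<in> Lsq"
  unfolding L2_Lsq
  by (rule Lsq_bounded_linear[of f "\<lambda>v. complex_of_real (v $ i)"])
    (auto intro: bounded_linear_compose[OF bounded_linear_of_real bounded_linear_vec_nth])

lemmas L2_add = Lsq_add[where 'a="real^3", folded L2_Lsq]
  and L2_diff = Lsq_diff[where 'a="real^3", folded L2_Lsq]
  and L2_scaleR = Lsq_scaleR[where 'a="real^3", folded L2_Lsq]
  and L2_uminus = Lsq_uminus[where 'a="real^3", folded L2_Lsq]
  and L2_sum = Lsq_sum[where 'b="real^3", folded L2_Lsq]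
  and L2_zero [simp] = Lsq_zero[where 'a="real^3", folded L2_Lsq]
  and L2D = LsqD[where 'a="real^3", folded L2_Lsq]

lemma fourier_add: "f \<in> L2 \<Longrightarrow> g \<in> L2 \<Longrightarrow> fourier (\<lambda>x. f x + g x) k = fourier f k + fourier g k"
  by (simp add: vec_eq_iff fourier_nth fc_add Lsq_cf)

lemma fourier_diff: "f \<in> L2 \<Longrightarrow> g \<in> L2 \<Longrightarrow> fourier (\<lambda>x. f x - g x) k = fourier f k - fourier g k"
  by (simp add: vec_eq_iff fourier_nth fc_diff Lsq_cf)

lemma fourier_scaleR: "fourier (\<lambda>x. c *\<^sub>R f x) k = c *\<^sub>R fourier f k"
  by (simp add: vec_eq_iff fourier_nth fc_cmult) (simp add: scaleR_conv_of_real)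

lemma fourier_zero [simp]: "fourier (\<lambda>x. 0) k = 0"
  by (simp add: vec_eq_iff fourier_nth fc_zero)

lemma fourier_sum: "(\<And>i. i \<in> I \<Longrightarrow> f i \<in> L2) \<Longrightarrow> fourier (\<lambda>x. \<Sum>i\<in>I. f i x) k = (\<Sum>i\<in>I. fourier (f i) k)"
  by (induction I rule: infinite_finite_induct) (auto simp: fourier_add L2_sum)

lemma fourier_minus: "fourier f (- k) $ i = cnj (fourier f k $ i)"
  using fc_cnj[of "cf i f" "- k"] by (simp add: fourier_nth)

lemma ip_integrable: "f \<in> L2 \<Longrightarrow> g \<in> L2 \<Longrightarrow> integrable torus (\<lambda>x. f x \<bullet> g x)"
  by (rule Lsq_mult_integrable[of f g]) (auto simp: L2_Lsq[symmetric] Cauchy_Schwarz_ineq2 intro!: borel_measurable_inner L2D)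

lemma has_sum_sum:
  fixes f :: "'i \<Rightarrow> 'a \<Rightarrow> 'b::{topological_comm_monoid_add}"
  assumes "\<And>i. i \<in> I \<Longrightarrow> (f i has_sum a i) A"
  shows "((\<lambda>x. \<Sum>i\<in>I. f i x) has_sum (\<Sum>i\<in>I. a i)) A"
  using assms by (induction I rule: infinite_finite_induct) (auto intro!: has_sum_add has_sum_0)

text \<open>The inner product on \<open>complex^3\<close> is the real one, that is, the real part of
  the Hermitian product; hence the real part of Parseval's identity, summed over the
  components.\<close>

lemma ip_has_sum:
  assumes "f \<in> L2" "g \<in> L2"
  shows "((\<lambda>k. fourier f k \<bullet> fourier g k) has_sum ip f g) UNIV"
proof -
  have I: "integrable torus (\<lambda>x. f x $ i * g x $ i)" for i
    using integrable_Re[OF Lsq_cmult_integrable[OF Lsq_cf[OF assms(1), of i] Lsq_cf[OF assms(2), of i]]] by simp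
  have "((\<lambda>k. Re (fc (cf i f) k * cnj (fc (cf i g) k))) has_sum (LINT x|torus. f x $ i * g x $ i)) UNIV" for i
  proof -
    have "((\<lambda>k. Re (fc (cf i f) k * cnj (fc (cf i g) k))) has_sum Re (LINT x|torus. cf i f x * cnj (cf i g x))) UNIV"
      by (intro has_sum_Re parseval Lsq_cf assms)
    also have "(LINT x|torus. cf i f x * cnj (cf i g x)) = of_real (LINT x|torus. f x $ i * g x $ i)"
      using integral_complex_of_real[of torus "\<lambda>x. f x $ i * g x $ i"] by simp
    finally show ?thesis by simp
  qed
  then have "((\<lambda>k. \<Sum>i\<in>UNIV. Re (fc (cf i f) k * cnj (fc (cf i g) k))) has_sum (\<Sum>i\<in>UNIV. LINT x|torus. f x $ i * g x $ i)) UNIV"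
    by (intro has_sum_sum)
  also have "(\<Sum>i\<in>UNIV. LINT x|torus. f x $ i * g x $ i) = ip f g"
    unfolding ip_def inner_vec_def using I by simp
  finally show ?thesis by (simp add: inner_vec_def inner_complex_def fourier_nth)
qed

lemma ip_self: "ip f f = nsq f"
  by (simp add: ip_def nsq_def power2_norm_eq_inner)

lemma L2norm_sq: "(L2norm f)\<^sup>2 = nsq f"
  by (simp add: L2norm_def ip_self)

lemma L2norm_nsq: "L2norm f = sqrt (nsq f)"
  by (simp add: L2norm_def ip_self)

lemma nsq_has_sum: "f \<in> L2 \<Longrightarrow> ((\<lambda>k. (norm (fourier f k))\<^sup>2) has_sum nsq f) UNIV"
  using ip_has_sum[of f f] by (simp add: ip_self power2_norm_eq_inner)

lemma fourier_summable: "f \<in> L2 \<Longrightarrow> (\<lambda>k. (norm (fourier f k))\<^sup>2) summable_on UNIV"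
  using nsq_has_sum has_sum_imp_summable by blast

lemma norm_fourier_le: "f \<in> L2 \<Longrightarrow> norm (fourier f k) \<le> L2norm f"
  using finite_sum_le_has_sum[OF nsq_has_sum, of f "{k}"] by (simp add: L2norm_nsq real_le_rsqrt)

lemma ip_commute: "ip f g = ip g f"
  by (simp add: ip_def inner_commute)

lemma ip_add_left: "f \<in> L2 \<Longrightarrow> g \<in> L2 \<Longrightarrow> h \<in> L2 \<Longrightarrow> ip (\<lambda>x. f x + g x) h = ip f h + ip g h"
  unfolding ip_def by (simp add: inner_add_left ip_integrable)

lemma ip_diff_left: "f \<in> L2 \<Longrightarrow> g \<in> L2 \<Longrightarrow> h \<in> L2 \<Longrightarrow> ip (\<lambda>x. f x - g x) h = ip f h - ip g h"
  unfolding ip_def by (simp add: inner_diff_left ip_integrable)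

lemma ip_scaleR_left: "ip (\<lambda>x. c *\<^sub>R f x) h = c * ip f h"
  unfolding ip_def by simp

lemma ip_sum_left: "(\<And>i. i \<in> I \<Longrightarrow> f i \<in> L2) \<Longrightarrow> h \<in> L2 \<Longrightarrow> ip (\<lambda>x. \<Sum>i\<in>I. f i x) h = (\<Sum>i\<in>I. ip (f i) h)"
  by (induction I rule: infinite_finite_induct) (auto simp: ip_add_left L2_sum, simp_all add: ip_def)

lemma ip_cong_AE:
  assumes "AE x in torus. f x = g x" "f \<in> L2" "g \<in> L2" "h \<in> L2"
  shows "ip f h = ip g h"
  unfolding ip_def using assms
  by (intro integral_cong_AE) (auto intro!: borel_measurable_inner L2D elim!: eventually_mono)

lemma ip_CS: "f \<in> L2 \<Longrightarrow> g \<in> L2 \<Longrightarrow> \<bar>ip f g\<bar> \<le> L2norm f * L2norm g"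
proof -
  assume f: "f \<in> L2" and g: "g \<in> L2"
  have q: "0 \<le> nsq f + 2 * t * ip f g + t\<^sup>2 * nsq g" for t
  proof -
    have "(norm (f x + t *\<^sub>R g x))\<^sup>2 = (norm (f x))\<^sup>2 + 2 * t * (f x \<bullet> g x) + t\<^sup>2 * (norm (g x))\<^sup>2" for x
      unfolding power2_norm_eq_inner inner_add_left inner_add_right inner_scaleR_left inner_scaleR_right
      by (subst inner_commute[of "g x" "f x"]) (simp add: power2_eq_square algebra_simps)
    moreover have "integrable torus (\<lambda>x. (norm (f x))\<^sup>2)" "integrable torus (\<lambda>x. (norm (g x))\<^sup>2)"
      using f g by (auto simp: L2_def)
    ultimately have "nsq (\<lambda>x. f x + t *\<^sub>R g x) = nsq f + 2 * t * ip f g + t\<^sup>2 * nsq g"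
      unfolding nsq_def ip_def using ip_integrable[OF f g] by simp
    then show ?thesis using nsq_nonneg[of "\<lambda>x. f x + t *\<^sub>R g x"] by simp
  qed
  have "(ip f g)\<^sup>2 \<le> nsq f * nsq g"
  proof (cases "nsq g = 0")
    case True
    have "ip f g = 0"
    proof (rule ccontr)
      assume n: "ip f g \<noteq> 0"
      \<comment> \<open>If \<open>nsq g\<close> vanishes, the quadratic is affine in its argument;
        this argument gives it the value -1.\<close>
      have "2 * (- (nsq f + 1) / (2 * ip f g)) * ip f g = - (nsq f + 1)" using n by simp
      then show False using q[of "- (nsq f + 1) / (2 * ip f g)"] True by simp
    qed
    then show ?thesis by simp
  next
    case False
    then have pos: "nsq g > 0" using nsq_nonneg[of g] by linarith
    have "nsq f + 2 * (- ip f g / nsq g) * ip f g + (- ip f g / nsq g)\<^sup>2 * nsq g = nsq f - (ip f g)\<^sup>2 / nsq g"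
      using pos by (simp add: power2_eq_square field_simps)
    then have "0 \<le> nsq f - (ip f g)\<^sup>2 / nsq g" using q[of "- ip f g / nsq g"] by simp
    then show ?thesis using pos by (simp add: field_simps)
  qed
  then have "sqrt ((ip f g)\<^sup>2) \<le> sqrt (nsq f * nsq g)" by (rule real_sqrt_le_mono)
  then show ?thesis by (simp add: L2norm_nsq real_sqrt_mult)
qed

lemma L2_complex_field:
  assumes "\<And>i. h i \<in> Lsq"
  shows "(\<lambda>x. \<chi> i. Re (h i x)) \<in> L2"
proof -
  have "(\<lambda>x. \<Sum>i\<in>UNIV. Re (h i x) *\<^sub>R axis i 1) \<in> (Lsq :: field set)"
    by (intro Lsq_sum Lsq_bounded_linear[OF assms, of "\<lambda>z. Re z *\<^sub>R axis i 1" for i])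
      (intro bounded_linear_intros bounded_linear_Re)
  moreover have "(\<chi> i. Re (h i x)) = (\<Sum>i\<in>UNIV. Re (h i x) *\<^sub>R axis i 1)" for x
    by (simp add: vec_eq_iff axis_def if_distrib cong: if_cong)
  ultimately show ?thesis by (simp add: L2_Lsq)
qed

text \<open>The Hermitian symmetry of \<open>c\<close> means that taking real parts of the complex
  functions found by \<open>riesz_fischer\<close> leaves their coefficients unchanged.\<close>

lemma riesz_fischer_field:
  assumes c: "(\<lambda>k. (norm (c k))\<^sup>2) summable_on UNIV" and h: "\<And>k i. c (- k) $ i = cnj (c k $ i)"
  obtains f where "f \<in> L2" "\<And>k. fourier f k = c k"
proof -
  have "\<exists>f. f \<in> Lsq \<and> (\<forall>k. fc f k = c k $ i)" for i
  proof -
    have "(\<lambda>k. (norm (c k $ i))\<^sup>2) summable_on UNIV"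
      by (rule summable_on_comparison_test[OF c]) (auto intro!: power_mono Finite_Cartesian_Product.norm_nth_le)
    then show ?thesis by (rule riesz_fischer) blast
  qed
  then obtain h where hL: "\<And>i. h i \<in> Lsq" and hc: "\<And>i k. fc (h i) k = c k $ i" by metis
  show thesis
  proof (rule that[OF L2_complex_field[OF hL]])
    fix k
    have "fc (\<lambda>x. complex_of_real (Re (h i x))) k = c k $ i" for i
    proof -
      have "complex_of_real (Re z) = (1 / 2) * (z + cnj z)" for z by (simp add: complex_eq_iff)
      then have "fc (\<lambda>x. complex_of_real (Re (h i x))) k = (1 / 2) * (c k $ i + cnj (c (- k) $ i))"
        by (simp only: fc_cmult fc_add[OF hL Lsq_cnj[OF hL]] fc_cnj hc)
      then show ?thesis by (simp add: h)
    qed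
    then show "fourier (\<lambda>x. \<chi> i. Re (h i x)) k = c k" by (simp add: vec_eq_iff fourier_nth)
  qed
qed

text \<open>The derivative of the product of T f with a conjugate character has integral zero by
  \<open>torus_integral_pd\<close>. The map \<open>T\<close> covers real scalar test functions as
  well as components of fields.\<close>

lemma fc_pd:
  fixes f :: "real^3 \<Rightarrow> 'b::real_normed_vector"
  assumes f: "periodic f" "\<And>x. f differentiable (at x)" "continuous_on UNIV (pd j f)" and T: "bounded_linear T"
  shows "fc (\<lambda>x. T (pd j f x)) k = dk j k * fc (\<lambda>x. T (f x)) k"
proof -
  have fcont: "continuous_on UNIV f" using f(2) by (simp add: continuous_at_imp_continuous_on differentiable_imp_continuous_within)
  let ?F = "\<lambda>x. T (f x) * cnj (ch k x)"
  have D: "(?F has_derivative (\<lambda>h. T (f x) * (- \<i> * of_real (2 * pi * (lattice k \<bullet> h)) * cnj (ch k x)) + T (frechet_derivative f (at x) h) * cnj (ch k x))) (at x)" for x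
  proof -
    have a: "((\<lambda>x. T (f x)) has_derivative (\<lambda>h. T (frechet_derivative f (at x) h))) (at x)"
      using f(2)[of x] by (intro bounded_linear.has_derivative[OF T]) (simp add: frechet_derivative_works)
    have c: "cnj (ch k x) = exp (- \<i> * of_real (2 * pi * (lattice k \<bullet> x)))" for x
      unfolding ch_def cis_cnj by (simp add: cis_conv_exp)
    have b: "((\<lambda>x. cnj (ch k x)) has_derivative (\<lambda>h. - \<i> * of_real (2 * pi * (lattice k \<bullet> h)) * cnj (ch k x))) (at x)"
    proof -
      have "bounded_linear (\<lambda>x. - \<i> * complex_of_real (2 * pi * (lattice k \<bullet> x)))"
        by (intro bounded_linear_const_mult bounded_linear_compose[OF bounded_linear_of_real] bounded_linear_inner_right)
      from has_derivative_compose[OF bounded_linear_imp_has_derivative[OF this] DERIV_exp[unfolded has_field_derivative_def]]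
      show ?thesis unfolding c by (simp only: mult.commute)
    qed
    show ?thesis by (rule has_derivative_mult[OF a b])
  qed
  have pdF: "pd j ?F x = T (pd j f x) * cnj (ch k x) - dk j k * (T (f x) * cnj (ch k x))" for x
    unfolding pd_def frechet_derivative_at[OF D, symmetric]
    by (simp add: dk_def inner_axis algebra_simps)
  have chc: "continuous_on UNIV (\<lambda>x. cnj (ch k x))" by (intro continuous_intros)
  have c1: "continuous_on UNIV (\<lambda>x. T (pd j f x) * cnj (ch k x))"
    by (intro continuous_on_mult chc bounded_linear.continuous_on[OF T f(3)])
  have c2: "continuous_on UNIV ?F"
    by (intro continuous_on_mult chc bounded_linear.continuous_on[OF T fcont])
  have "(LINT x|torus. pd j ?F x) = 0"
  proof (rule torus_integral_pd)
    show "periodic ?F" using f(1) periodic_ch[of k] by (simp add: periodic_def)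
    show "?F differentiable at x" for x using D by (auto simp: differentiable_def)
    show "continuous_on UNIV (pd j ?F)" unfolding pdF by (intro continuous_intros c1 c2)
  qed
  also have "(LINT x|torus. pd j ?F x) = fc (\<lambda>x. T (pd j f x)) k - dk j k * fc (\<lambda>x. T (f x)) k"
    unfolding pdF fc_def using continuous_torus(2)[OF c1] continuous_torus(2)[OF c2] by simp
  finally show ?thesis by simp
qed

text \<open>A real Fourier mode with cosine amplitude \<open>v\<close> and sine amplitude
  \<open>w\<close>. The family is closed under differentiation, which makes smoothness an induction.
  Scalar modes serve as test functions, vector modes with amplitudes perpendicular to
  \<open>m\<close> as smooth divergence-free fields.\<close>

definition trigf :: "int^3 \<Rightarrow> 'b::real_normed_vector \<Rightarrow> 'b \<Rightarrow> real^3 \<Rightarrow> 'b" where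
  "trigf m v w x = Re (ch m x) *\<^sub>R v + Im (ch m x) *\<^sub>R w"

lemma pd_trigf: "pd j (trigf m v w) = trigf m ((2 * pi * of_int (m $ j)) *\<^sub>R w) (- (2 * pi * of_int (m $ j)) *\<^sub>R v)"
  and trigf_differentiable: "trigf m v w differentiable (at x)"
proof -
  have D: "(trigf m v w has_derivative (\<lambda>h. (2 * pi * (lattice m \<bullet> h)) *\<^sub>R (cos (2 * pi * (lattice m \<bullet> x)) *\<^sub>R w - sin (2 * pi * (lattice m \<bullet> x)) *\<^sub>R v))) (at x)" for x
    unfolding trigf_def[abs_def] ch_def by (auto intro!: derivative_eq_intros simp: algebra_simps)
  show "trigf m v w differentiable (at x)" using D by (auto simp: differentiable_def)
  show "pd j (trigf m v w) = trigf m ((2 * pi * of_int (m $ j)) *\<^sub>R w) (- (2 * pi * of_int (m $ j)) *\<^sub>R v)"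
    unfolding pd_def frechet_derivative_at[OF D, symmetric]
    by (simp add: fun_eq_iff trigf_def ch_def inner_axis algebra_simps)
qed

lemma Ck_trigf: "Ck n (trigf m v w)"
proof (induction n arbitrary: v w)
  case 0
  show ?case unfolding trigf_def[abs_def] Ck.simps by (intro continuous_intros)
next
  case (Suc n)
  then show ?case by (simp only: Ck.simps pd_trigf trigf_differentiable simp_thms)
qed

lemma trigf_smooth: "trigf m v w \<in> smooth_torus"
proof -
  have "ch m (x + lattice k) = ch m x" for x k using periodic_ch[of m] by (simp add: periodic_def)
  then show ?thesis by (simp add: smooth_torus_def Ck_trigf) (simp add: periodic_def trigf_def)
qed

lemma smooth_torusD:
  assumes "f \<in> smooth_torus"
  shows "periodic f" "f differentiable (at x)" "continuous_on UNIV f" "continuous_on UNIV (pd j f)"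
proof -
  have "Ck 0 f" "Ck (Suc 0) f" using assms unfolding smooth_torus_def by blast+
  then show "periodic f" "f differentiable (at x)" "continuous_on UNIV f" "continuous_on UNIV (pd j f)"
    using assms by (auto simp: smooth_torus_def)
qed

lemma pd_periodic:
  assumes "periodic f" shows "periodic (pd j f)"
  unfolding periodic_def
proof (intro allI)
  fix k x
  have gen: "(f has_derivative D) (at y)" if "(f has_derivative D) (at (y + l))" "\<And>z. f (z + l) = f z" for D y l
  proof -
    have "((\<lambda>z. z + l) has_derivative (\<lambda>h. h)) (at y)" by (auto intro!: derivative_eq_intros)
    from has_derivative_compose[OF this that(1)] show ?thesis by (simp add: that(2))
  qed
  have p: "f (z + lattice l) = f z" for z l using assms by (simp add: periodic_def)
  \<comment> \<open>\<open>frechet_derivative\<close> is a choice from the derivatives at a point.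
    The two predicates in \<open>D\<close> coincide, hence so do the choices, whether or not
    \<open>f\<close> is differentiable.\<close>
  have "(f has_derivative D) (at (x + lattice k)) \<longleftrightarrow> (f has_derivative D) (at x)" for D
  proof
    assume "(f has_derivative D) (at x)"
    then have "(f has_derivative D) (at ((x + lattice k) + lattice (- k)))" by simp
    then show "(f has_derivative D) (at (x + lattice k))" by (rule gen[OF _ p])
  qed (rule gen[OF _ p])
  then show "pd j f (x + lattice k) = pd j f x" unfolding pd_def frechet_derivative_def by (simp only:)
qed

section \<open>Sobolev weights and norms\<close>

lemma norm_vec_sq: "(norm (v :: 'a::real_normed_vector ^ 'n))\<^sup>2 = (\<Sum>i\<in>UNIV. (norm (v $ i))\<^sup>2)"
  by (simp add: norm_vec_def L2_set_def sum_nonneg)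

lemma norm_dk: "(norm (dk j k))\<^sup>2 = 4 * pi\<^sup>2 * (of_int (k $ j))\<^sup>2"
  by (simp add: dk_def norm_mult power_mult_distrib)

lemma norm_lattice_sq: "(norm (lattice k))\<^sup>2 = (\<Sum>j\<in>UNIV. (of_int (k $ j))\<^sup>2)"
  by (simp add: norm_vec_sq)

lemma sum_norm_dk: "(\<Sum>j\<in>UNIV. (norm (dk j k))\<^sup>2) = 4 * pi\<^sup>2 * (norm (lattice k))\<^sup>2"
  by (simp add: norm_dk norm_lattice_sq sum_distrib_left)

lemma sobolev_weight_pos: "0 < sobolev_weight \<sigma> k"
proof -
  have "0 < 1 + 4 * pi\<^sup>2 * (norm (lattice k))\<^sup>2" by (intro add_pos_nonneg) auto
  then show ?thesis by (simp add: sobolev_weight_def)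
qed

lemma sobolev_weight_1: "sobolev_weight 1 k = 1 + 4 * pi\<^sup>2 * (norm (lattice k))\<^sup>2"
proof -
  have "0 \<le> 1 + 4 * pi\<^sup>2 * (norm (lattice k))\<^sup>2" by (intro add_nonneg_nonneg) auto
  then show ?thesis by (simp add: sobolev_weight_def)
qed

lemma sobolev_weight_add: "sobolev_weight (\<sigma> + \<tau>) k = sobolev_weight \<sigma> k * sobolev_weight \<tau> k"
  by (simp add: sobolev_weight_def powr_add)

lemma sobolev_weight_mono: "\<sigma> \<le> \<tau> \<Longrightarrow> sobolev_weight \<sigma> k \<le> sobolev_weight \<tau> k"
  unfolding sobolev_weight_def by (intro powr_mono) auto

lemma sobolev_weight_0: "sobolev_weight 0 k = 1"
  using sobolev_weight_pos[of 0 k] by (simp add: sobolev_weight_def split: if_splits)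

lemma sobolev_L2: "f \<in> sobolev \<sigma> \<Longrightarrow> f \<in> L2"
  by (simp add: sobolev_def)

lemma sobolev_summable: "f \<in> sobolev \<sigma> \<Longrightarrow> (\<lambda>k. sobolev_weight \<sigma> k * (norm (fourier f k))\<^sup>2) summable_on UNIV"
  by (simp add: sobolev_def)

lemma sobolev_mono: "f \<in> sobolev \<tau> \<Longrightarrow> \<sigma> \<le> \<tau> \<Longrightarrow> f \<in> sobolev \<sigma>"
  unfolding sobolev_def
  by (auto intro!: mult_right_mono sobolev_weight_mono mult_nonneg_nonneg less_imp_le[OF sobolev_weight_pos]
      elim: summable_on_comparison_test)

lemma hnorm_sq: "f \<in> sobolev \<sigma> \<Longrightarrow> (hnorm \<sigma> f)\<^sup>2 = (\<Sum>\<^sub>\<infinity>k. sobolev_weight \<sigma> k * (norm (fourier f k))\<^sup>2)"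
  unfolding hnorm_def
  by (subst real_sqrt_pow2) (auto intro!: infsum_nonneg mult_nonneg_nonneg less_imp_le[OF sobolev_weight_pos])

lemma hnorm_has_sum:
  "f \<in> sobolev \<sigma> \<Longrightarrow> ((\<lambda>k. sobolev_weight \<sigma> k * (norm (fourier f k))\<^sup>2) has_sum (hnorm \<sigma> f)\<^sup>2) UNIV"
  by (simp add: hnorm_sq sobolev_summable)

lemma hnorm_nonneg [simp]: "0 \<le> hnorm \<sigma> f"
  unfolding hnorm_def by (auto intro!: infsum_nonneg mult_nonneg_nonneg less_imp_le[OF sobolev_weight_pos])

lemma hnorm_mono:
  assumes "f \<in> sobolev \<tau>" "\<sigma> \<le> \<tau>" shows "hnorm \<sigma> f \<le> hnorm \<tau> f"
proof -
  have "(hnorm \<sigma> f)\<^sup>2 \<le> (hnorm \<tau> f)\<^sup>2"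
    by (rule has_sum_mono[OF hnorm_has_sum[OF sobolev_mono[OF assms]] hnorm_has_sum[OF assms(1)]])
      (intro mult_right_mono sobolev_weight_mono assms, simp)
  then show ?thesis by (rule power2_le_imp_le) simp
qed

lemma L2_sobolev_0: "L2 = sobolev 0"
  by (auto simp: sobolev_def sobolev_weight_0 fourier_summable)

lemma hnorm_0: "f \<in> L2 \<Longrightarrow> hnorm 0 f = L2norm f"
  using infsumI[OF nsq_has_sum[of f]] by (simp add: hnorm_def sobolev_weight_0 L2norm_nsq)

lemma L2norm_le_hnorm: "f \<in> sobolev \<sigma> \<Longrightarrow> 0 \<le> \<sigma> \<Longrightarrow> L2norm f \<le> hnorm \<sigma> f"
  using hnorm_mono[of f \<sigma> 0] sobolev_L2[of f \<sigma>] by (simp add: hnorm_0)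

lemma norm_diff_sq_le: "(norm (a - b))\<^sup>2 \<le> 2 * (norm a)\<^sup>2 + 2 * (norm (b :: 'a::real_normed_vector))\<^sup>2"
proof -
  have "(norm (a - b))\<^sup>2 \<le> (norm a + norm b)\<^sup>2" by (intro power_mono norm_triangle_ineq4) auto
  then show ?thesis using sum_squares_bound[of "norm a" "norm b"] by (simp add: power2_sum)
qed

lemma sobolev_diff:
  assumes "f \<in> sobolev \<sigma>" "g \<in> sobolev \<sigma>"
  shows "(\<lambda>x. f x - g x) \<in> sobolev \<sigma>"
    and "(hnorm \<sigma> (\<lambda>x. f x - g x))\<^sup>2 \<le> 2 * (hnorm \<sigma> f)\<^sup>2 + 2 * (hnorm \<sigma> g)\<^sup>2"
proof -
  have fg: "f \<in> L2" "g \<in> L2" using assms sobolev_L2 by auto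
  let ?w = "sobolev_weight \<sigma>"
  have hs: "((\<lambda>k. 2 * (?w k * (norm (fourier f k))\<^sup>2) + 2 * (?w k * (norm (fourier g k))\<^sup>2)) has_sum (2 * (hnorm \<sigma> f)\<^sup>2 + 2 * (hnorm \<sigma> g)\<^sup>2)) UNIV"
    by (intro has_sum_add has_sum_cmult_right hnorm_has_sum assms)
  have le: "?w k * (norm (fourier (\<lambda>x. f x - g x) k))\<^sup>2 \<le> 2 * (?w k * (norm (fourier f k))\<^sup>2) + 2 * (?w k * (norm (fourier g k))\<^sup>2)" for k
    using mult_left_mono[OF norm_diff_sq_le[of "fourier f k" "fourier g k"], of "?w k"] sobolev_weight_pos[of \<sigma> k]
    by (simp add: fourier_diff fg algebra_simps)
  show d: "(\<lambda>x. f x - g x) \<in> sobolev \<sigma>"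
    unfolding sobolev_def using L2_diff[OF fg] less_imp_le[OF sobolev_weight_pos]
    by (auto intro!: summable_on_comparison_test[OF has_sum_imp_summable[OF hs]] le)
  show "(hnorm \<sigma> (\<lambda>x. f x - g x))\<^sup>2 \<le> 2 * (hnorm \<sigma> f)\<^sup>2 + 2 * (hnorm \<sigma> g)\<^sup>2"
    by (rule has_sum_mono[OF hnorm_has_sum[OF d] hs le])
qed

section \<open>Weak derivatives and the Laplacian as Fourier multipliers\<close>

definition wpd_coeff :: "3 \<Rightarrow> field \<Rightarrow> int^3 \<Rightarrow> complex^3" where
  "wpd_coeff j f k = (\<chi> i. dk j k * fourier f k $ i)"

lemma norm_wpd_coeff: "(norm (wpd_coeff j f k))\<^sup>2 = (norm (dk j k))\<^sup>2 * (norm (fourier f k))\<^sup>2"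
  by (simp add: norm_vec_sq wpd_coeff_def norm_mult power_mult_distrib sum_distrib_left)

lemma sum_norm_wpd_coeff: "(\<Sum>j\<in>UNIV. (norm (wpd_coeff j f k))\<^sup>2) = 4 * pi\<^sup>2 * (norm (lattice k))\<^sup>2 * (norm (fourier f k))\<^sup>2"
  by (simp add: norm_wpd_coeff sum_norm_dk flip: sum_distrib_right)

lemma norm_dk_le: "(norm (dk j k))\<^sup>2 \<le> sobolev_weight 1 k"
  using member_le_sum[of j UNIV "\<lambda>j. (norm (dk j k))\<^sup>2"] by (simp add: sum_norm_dk sobolev_weight_1)

lemma wpd_coeff_weight: "sobolev_weight \<sigma> k * (norm (wpd_coeff j f k))\<^sup>2 \<le> sobolev_weight (\<sigma> + 1) k * (norm (fourier f k))\<^sup>2"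
proof -
  have "(sobolev_weight \<sigma> k * (norm (fourier f k))\<^sup>2) * (norm (dk j k))\<^sup>2 \<le> (sobolev_weight \<sigma> k * (norm (fourier f k))\<^sup>2) * sobolev_weight 1 k"
    using sobolev_weight_pos[of \<sigma> k] by (intro mult_left_mono norm_dk_le) auto
  then show ?thesis by (simp add: norm_wpd_coeff sobolev_weight_add mult_ac)
qed

lemma integral_scaleR_component:
  assumes \<psi>: "(\<lambda>x. complex_of_real (\<psi> x)) \<in> Lsq" and f: "f \<in> L2"
  shows "complex_of_real ((LINT x|torus. \<psi> x *\<^sub>R f x) $ i) = (LINT x|torus. complex_of_real (\<psi> x) * cnj (cf i f x))"
proof -
  have "(\<lambda>x. Re (complex_of_real (\<psi> x))) \<in> borel_measurable torus"
    using LsqD[OF \<psi>] by (rule borel_measurable_Re[THEN measurable_compose_rev])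
  then have m: "\<psi> \<in> borel_measurable torus" by simp
  have fL: "f \<in> Lsq" using f by (simp add: L2_Lsq)
  have I: "integrable torus (\<lambda>x. \<psi> x *\<^sub>R f x)"
    using m L2D[OF f] by (intro Lsq_mult_integrable[OF \<psi> fL]) auto
  have "(LINT x|torus. \<psi> x *\<^sub>R f x) $ i = (LINT x|torus. (\<psi> x *\<^sub>R f x) $ i)"
    by (rule integral_bounded_linear[OF bounded_linear_vec_nth I, symmetric])
  then show ?thesis
    using integral_complex_of_real[of torus "\<lambda>x. \<psi> x * f x $ i"] by simp
qed

lemma weak_pd_exists:
  assumes f: "f \<in> sobolev 1"
  obtains g where "g \<in> L2" "\<And>k. fourier g k = wpd_coeff j f k"
proof (rule riesz_fischer_field)
  show "(\<lambda>k. (norm (wpd_coeff j f k))\<^sup>2) summable_on UNIV"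
  proof (rule summable_on_comparison_test[OF sobolev_summable[OF f]])
    show "(norm (wpd_coeff j f k))\<^sup>2 \<le> sobolev_weight 1 k * (norm (fourier f k))\<^sup>2" for k
      using wpd_coeff_weight[of 0 k j f] by (simp add: sobolev_weight_0)
  qed simp
  show "wpd_coeff j f (- k) $ i = cnj (wpd_coeff j f k $ i)" for k i
    by (simp add: wpd_coeff_def fourier_minus dk_def)
qed (use that in blast)

lemma smooth_Lsq:
  fixes \<psi> :: "real^3 \<Rightarrow> real"
  assumes "\<psi> \<in> smooth_torus"
  shows "(\<lambda>x. complex_of_real (\<psi> x)) \<in> Lsq" "(\<lambda>x. complex_of_real (pd j \<psi> x)) \<in> Lsq"
proof -
  note s = smooth_torusD[OF assms]
  show "(\<lambda>x. complex_of_real (\<psi> x)) \<in> Lsq"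
    using s(1) by (intro Lsq_continuous continuous_intros s(3)) (simp add: periodic_def)
  show "(\<lambda>x. complex_of_real (pd j \<psi> x)) \<in> Lsq"
    using pd_periodic[OF s(1), of j] by (intro Lsq_continuous continuous_intros s(4)) (simp add: periodic_def)
qed

lemma cnj_dk: "cnj (dk j k) = - dk j k"
  by (simp add: dk_def)

text \<open>By Parseval, integration by parts amounts to moving the purely imaginary symbol
  \<open>dk j k\<close> from one factor to the other, which changes its sign.\<close>

lemma weak_identity:
  assumes f: "f \<in> L2" and g: "g \<in> L2" and c: "\<And>k. fourier g k = wpd_coeff j f k"
    and \<psi>: "\<psi> \<in> smooth_torus"
  shows "(LINT x|torus. \<psi> x *\<^sub>R g x) = - (LINT x|torus. pd j \<psi> x *\<^sub>R f x)"
proof -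
  have "(LINT x|torus. \<psi> x *\<^sub>R g x) $ i = - ((LINT x|torus. pd j \<psi> x *\<^sub>R f x) $ i)" for i
  proof -
    let ?P = "\<lambda>x. complex_of_real (\<psi> x)" and ?Q = "\<lambda>x. complex_of_real (pd j \<psi> x)"
    have Q: "fc ?Q k = dk j k * fc ?P k" for k
      using fc_pd[OF smooth_torusD(1,2,4)[OF \<psi>] bounded_linear_of_real, of j k] .
    have "((\<lambda>k. - (fc ?Q k * cnj (fc (cf i f) k))) has_sum - (LINT x|torus. ?Q x * cnj (cf i f x))) UNIV"
      using parseval[OF smooth_Lsq(2)[OF \<psi>] Lsq_cf[OF f]] by (simp add: has_sum_uminus)
    moreover have "- (fc ?Q k * cnj (fc (cf i f) k)) = fc ?P k * cnj (fc (cf i g) k)" for k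
      using c[of k] by (simp add: Q fourier_nth[symmetric] wpd_coeff_def cnj_dk)
    ultimately have "(LINT x|torus. ?P x * cnj (cf i g x)) = - (LINT x|torus. ?Q x * cnj (cf i f x))"
      using parseval[OF smooth_Lsq(1)[OF \<psi>] Lsq_cf[OF g], of i] has_sum_unique by fastforce
    then have "complex_of_real ((LINT x|torus. \<psi> x *\<^sub>R g x) $ i) = complex_of_real (- ((LINT x|torus. pd j \<psi> x *\<^sub>R f x) $ i))"
      unfolding of_real_minus integral_scaleR_component[OF smooth_Lsq(1)[OF \<psi>] g] integral_scaleR_component[OF smooth_Lsq(2)[OF \<psi>] f] .
    then show ?thesis by (simp only: of_real_eq_iff)
  qed
  then show ?thesis by (simp add: vec_eq_iff)
qed

text \<open>Weak derivatives are tested with real functions only, so a complex coefficient is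
  assembled from a cosine mode and a sine mode.\<close>

lemma fc_cf_trigf:
  assumes f: "f \<in> L2"
  shows "fc (cf i f) m = complex_of_real ((LINT x|torus. trigf m 1 0 x *\<^sub>R f x) $ i)
    - \<i> * complex_of_real ((LINT x|torus. trigf m 0 1 x *\<^sub>R f x) $ i)"
proof -
  have L: "(\<lambda>x. complex_of_real (trigf m a b x)) \<in> Lsq" for a b
    by (intro smooth_Lsq trigf_smooth)
  have I: "integrable torus (\<lambda>x. complex_of_real (trigf m a b x) * cnj (cf i f x))" for a b
    by (intro Lsq_cmult_integrable L Lsq_cf f)
  have "cf i f x * cnj (ch m x) = complex_of_real (trigf m 1 0 x) * cnj (cf i f x) - \<i> * (complex_of_real (trigf m 0 1 x) * cnj (cf i f x))" for x
    by (simp add: trigf_def complex_eq_iff)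
  then show ?thesis
    unfolding fc_def integral_scaleR_component[OF L f]
    by (simp only: Bochner_Integration.integral_diff[OF I integrable_mult_right[OF I]] integral_mult_right_zero)
qed

text \<open>The cosine and sine modes are admissible test functions whose derivatives are again
  modes of the same frequency, so the defining identity already fixes every Fourier
  coefficient.\<close>

lemma weak_pd_unique:
  assumes f: "f \<in> L2" and g: "g \<in> L2"
    and w: "\<And>\<psi>::real^3 \<Rightarrow> real. \<psi> \<in> smooth_torus \<Longrightarrow> (LINT x|torus. \<psi> x *\<^sub>R g x) = - (LINT x|torus. pd j \<psi> x *\<^sub>R f x)"
  shows "fourier g k = wpd_coeff j f k"
proof -
  let ?c = "2 * pi * real_of_int (k $ j)"
  let ?R = "\<lambda>f::field. LINT x|torus. trigf k 1 0 x *\<^sub>R f x" and ?I = "\<lambda>f::field. LINT x|torus. trigf k 0 1 x *\<^sub>R f x"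
  have a: "trigf k 0 (- ?c) x *\<^sub>R f x = (- ?c) *\<^sub>R (trigf k 0 1 x *\<^sub>R f x)"
    "trigf k ?c 0 x *\<^sub>R f x = ?c *\<^sub>R (trigf k 1 0 x *\<^sub>R f x)" for x
    by (simp_all add: trigf_def)
  have p: "pd j (trigf k (1::real) 0) = trigf k 0 (- ?c)" "pd j (trigf k 0 (1::real)) = trigf k ?c 0"
    by (simp_all add: pd_trigf)
  have "?R g = - (LINT x|torus. trigf k 0 (- ?c) x *\<^sub>R f x)"
    using w[OF trigf_smooth, of k 1 0] unfolding p .
  then have R: "?R g = ?c *\<^sub>R ?I f" unfolding a integral_scaleR_right by simp
  have "?I g = - (LINT x|torus. trigf k ?c 0 x *\<^sub>R f x)"
    using w[OF trigf_smooth, of k 0 1] unfolding p .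
  then have I: "?I g = - ?c *\<^sub>R ?R f" unfolding a integral_scaleR_right by simp
  have "fc (cf i g) k = dk j k * fc (cf i f) k" for i
    unfolding fc_cf_trigf[OF f] fc_cf_trigf[OF g] R I by (simp add: dk_def algebra_simps)
  then show ?thesis by (simp add: vec_eq_iff fourier_nth wpd_coeff_def)
qed

text \<open>On H^1 the Hilbert choice in \<open>weak_pd\<close> has a candidate, the function with
  coefficients \<open>wpd_coeff\<close>; by uniqueness whatever is chosen has the same
  coefficients.\<close>

lemma weak_pd:
  assumes f: "f \<in> sobolev 1"
  shows "weak_pd j f \<in> L2" "fourier (weak_pd j f) k = wpd_coeff j f k"
proof -
  obtain g where g: "g \<in> L2" "\<And>k. fourier g k = wpd_coeff j f k" using weak_pd_exists[OF f] by blast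
  have "\<exists>g. g \<in> L2 \<and> (\<forall>\<psi> :: real^3 \<Rightarrow> real. \<psi> \<in> smooth_torus \<longrightarrow>
        (LINT x|torus. \<psi> x *\<^sub>R g x) = - (LINT x|torus. pd j \<psi> x *\<^sub>R f x))"
    using weak_identity[OF sobolev_L2[OF f] g] g(1) by blast
  then have w: "weak_pd j f \<in> L2 \<and> (\<forall>\<psi> :: real^3 \<Rightarrow> real. \<psi> \<in> smooth_torus \<longrightarrow>
        (LINT x|torus. \<psi> x *\<^sub>R weak_pd j f x) = - (LINT x|torus. pd j \<psi> x *\<^sub>R f x))"
    unfolding weak_pd_def by (rule someI_ex)
  then show "weak_pd j f \<in> L2" by blast
  then show "fourier (weak_pd j f) k = wpd_coeff j f k"
    using w by (intro weak_pd_unique[OF sobolev_L2[OF f]]) auto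
qed

lemma weak_pd_sobolev:
  assumes f: "f \<in> sobolev (\<sigma> + 1)" and \<sigma>: "0 \<le> \<sigma>"
  shows "weak_pd j f \<in> sobolev \<sigma>"
proof -
  have f1: "f \<in> sobolev 1" by (rule sobolev_mono[OF f]) (use \<sigma> in simp)
  have "(\<lambda>k. sobolev_weight \<sigma> k * (norm (fourier (weak_pd j f) k))\<^sup>2) summable_on UNIV"
    unfolding weak_pd(2)[OF f1] using less_imp_le[OF sobolev_weight_pos]
    by (auto intro!: summable_on_comparison_test[OF sobolev_summable[OF f]] wpd_coeff_weight)
  then show ?thesis using weak_pd(1)[OF f1] by (simp add: sobolev_def)
qed

text \<open>Minus the Laplacian, so its symbol is nonnegative; \<open>stokes f\<close> is
  \<open>leray (lap f)\<close>.\<close>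

definition lap :: "field \<Rightarrow> field" where
  "lap f = (\<lambda>x. - (\<Sum>j\<in>UNIV. weak_pd j (weak_pd j f) x))"

lemma lap:
  assumes f: "f \<in> sobolev 2"
  shows "lap f \<in> L2" "fourier (lap f) k = (4 * pi\<^sup>2 * (norm (lattice k))\<^sup>2) *\<^sub>R fourier f k"
proof -
  have f1: "f \<in> sobolev 1" by (rule sobolev_mono[OF f]) simp
  have w1: "weak_pd j f \<in> sobolev 1" for j using weak_pd_sobolev[of f 1 j] f by simp
  have L: "weak_pd j (weak_pd j f) \<in> L2" for j by (rule weak_pd(1)[OF w1])
  show "lap f \<in> L2" unfolding lap_def by (intro L2_uminus L2_sum L)
  have "(dk j k)\<^sup>2 = - complex_of_real (4 * pi\<^sup>2 * (of_int (k $ j))\<^sup>2)" for j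
    by (simp add: dk_def power_mult_distrib)
  then have "(\<Sum>j\<in>UNIV. (dk j k)\<^sup>2) = - complex_of_real (4 * pi\<^sup>2 * (norm (lattice k))\<^sup>2)"
    by (simp add: norm_lattice_sq sum_negf sum_distrib_left)
  moreover have "(\<Sum>j\<in>UNIV. dk j k * (dk j k * z)) = (\<Sum>j\<in>UNIV. (dk j k)\<^sup>2) * z" for z
    by (simp add: power2_eq_square mult.assoc sum_distrib_right)
  ultimately have d: "(\<Sum>j\<in>UNIV. dk j k * (dk j k * z)) = - complex_of_real (4 * pi\<^sup>2 * (norm (lattice k))\<^sup>2) * z" for z
    by (simp only:)
  have "fourier (lap f) k = - fourier (\<lambda>x. \<Sum>j\<in>UNIV. weak_pd j (weak_pd j f) x) k"
    unfolding lap_def using fourier_scaleR[of "- 1"] by simp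
  also have "\<dots> = - (\<Sum>j\<in>UNIV. wpd_coeff j (weak_pd j f) k)"
    by (simp add: fourier_sum L weak_pd(2)[OF w1])
  also have "\<dots> = (4 * pi\<^sup>2 * (norm (lattice k))\<^sup>2) *\<^sub>R fourier f k"
    by (simp add: vec_eq_iff wpd_coeff_def weak_pd(2)[OF f1] d) (simp add: scaleR_conv_of_real)
  finally show "fourier (lap f) k = (4 * pi\<^sup>2 * (norm (lattice k))\<^sup>2) *\<^sub>R fourier f k" .
qed

lemma smooth_field_L2:
  fixes g :: field
  assumes "g \<in> smooth_torus" shows "g \<in> L2" "pd j g \<in> L2"
  using smooth_torusD[OF assms] pd_periodic by (auto simp: L2_Lsq intro!: Lsq_continuous)

lemma fourier_pd:
  fixes g :: field
  assumes "g \<in> smooth_torus" shows "fourier (pd j g) k = wpd_coeff j g k"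
proof -
  have "bounded_linear (\<lambda>v::real^3. complex_of_real (v $ i))" for i
    by (intro bounded_linear_compose[OF bounded_linear_of_real bounded_linear_vec_nth])
  from fc_pd[OF smooth_torusD(1,2,4)[OF assms] this] show ?thesis
    by (simp add: vec_eq_iff wpd_coeff_def fourier_nth)
qed

lemma smooth_sobolev_1:
  fixes g :: field
  assumes g: "g \<in> smooth_torus" shows "g \<in> sobolev 1"
proof -
  have "(\<lambda>k. (norm (fourier g k))\<^sup>2 + (\<Sum>j\<in>UNIV. (norm (fourier (pd j g) k))\<^sup>2)) summable_on UNIV"
    by (intro summable_on_add fourier_summable smooth_field_L2 g
        has_sum_imp_summable[OF has_sum_sum[where a="\<lambda>j. nsq (pd j g)", OF nsq_has_sum]])
  then show ?thesis
    using smooth_field_L2(1)[OF g]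
    by (simp add: sobolev_def fourier_pd[OF g] sum_norm_wpd_coeff sobolev_weight_1 algebra_simps)
qed

section \<open>Solenoidal fields and the spaces H and V\<close>

definition solenoidal :: "field \<Rightarrow> bool" where
  "solenoidal f \<longleftrightarrow> (\<forall>k. (\<Sum>j\<in>UNIV. dk j k * fourier f k $ j) = 0) \<and> fourier f 0 = 0"

lemma smooth_sol_solenoidal:
  assumes g: "g \<in> smooth_sol" shows "solenoidal g"
proof -
  have gs: "g \<in> smooth_torus" and dv: "\<And>x. (\<Sum>j\<in>UNIV. pd j g x $ j) = 0" and m: "(LINT x|torus. g x) = 0"
    using g by (auto simp: smooth_sol_def)
  have "(\<Sum>j\<in>UNIV. dk j k * fourier g k $ j) = 0" for k
  proof -
    have "(\<Sum>j\<in>UNIV. dk j k * fourier g k $ j) = (\<Sum>j\<in>UNIV. fc (cf j (pd j g)) k)"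
      using fourier_pd[OF gs] by (simp add: vec_eq_iff fourier_nth wpd_coeff_def)
    also have "\<dots> = fc (\<lambda>x. \<Sum>j\<in>UNIV. cf j (pd j g) x) k"
      by (intro fc_sum[symmetric] Lsq_cf smooth_field_L2 gs)
    also have "(\<lambda>x. \<Sum>j\<in>UNIV. cf j (pd j g) x) = (\<lambda>x. 0)"
      using dv by (simp flip: of_real_sum)
    finally show ?thesis by (simp add: fc_zero)
  qed
  moreover have "fc (cf i g) 0 = 0" for i
  proof -
    have "integrable torus g" using smooth_torusD[OF gs] by (intro continuous_torus)
    from integral_bounded_linear[OF bounded_linear_vec_nth this, of i]
    have "(LINT x|torus. g x $ i) = 0" by (simp add: m)
    then show ?thesis by (simp add: fc_def)
  qed
  ultimately show ?thesis by (simp add: solenoidal_def vec_eq_iff fourier_nth)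
qed

lemma H_space_L2: "f \<in> H_space \<Longrightarrow> f \<in> L2"
  by (simp add: H_space_def)

text \<open>Each of the conditions involves the Fourier coefficient at a single frequency, which
  depends continuously on the field in L^2, so the closure of the smooth fields inherits
  them.\<close>

lemma H_space_solenoidal:
  assumes f: "f \<in> H_space" shows "solenoidal f"
proof -
  have fL: "f \<in> L2" using f by (rule H_space_L2)
  have ap: "\<exists>g. solenoidal g \<and> norm (fourier f k - fourier g k) \<le> e" if "e > 0" for e k
  proof -
    obtain g where g: "g \<in> smooth_sol" "L2norm (\<lambda>x. f x - g x) < e" using f \<open>e > 0\<close> by (auto simp: H_space_def)
    have gL: "g \<in> L2" using g(1) smooth_field_L2 by (auto simp: smooth_sol_def)
    show ?thesis
      using norm_fourier_le[OF L2_diff[OF fL gL], of k] g smooth_sol_solenoidal[OF g(1)]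
      by (intro exI[of _ g]) (simp add: fourier_diff fL gL)
  qed
  have "(\<Sum>j\<in>UNIV. dk j k * fourier f k $ j) = 0" for k
  proof -
    define M where "M = (\<Sum>j\<in>UNIV. norm (dk j k))"
    have M: "0 \<le> M" by (simp add: M_def sum_nonneg)
    have "norm (\<Sum>j\<in>UNIV. dk j k * fourier f k $ j) \<le> e" if e: "e > 0" for e
    proof -
      \<comment> \<open>\<open>M + 1\<close> replaces \<open>M\<close>, which vanishes at the
        frequency 0.\<close>
      obtain g where g: "solenoidal g" "norm (fourier f k - fourier g k) \<le> e / (M + 1)"
        using ap[of "e / (M + 1)" k] M e by (auto simp: add_nonneg_pos)
      have "(\<Sum>j\<in>UNIV. dk j k * fourier f k $ j) = (\<Sum>j\<in>UNIV. dk j k * (fourier f k - fourier g k) $ j)"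
        using g(1) by (simp add: solenoidal_def algebra_simps sum_subtractf)
      also have "norm \<dots> \<le> (\<Sum>j\<in>UNIV. norm (dk j k) * (e / (M + 1)))"
      proof (rule order_trans[OF norm_sum sum_mono])
        fix j
        show "norm (dk j k * (fourier f k - fourier g k) $ j) \<le> norm (dk j k) * (e / (M + 1))"
          unfolding norm_mult
          by (intro mult_left_mono order_trans[OF Finite_Cartesian_Product.norm_nth_le g(2)]) simp
      qed
      also have "\<dots> = M * (e / (M + 1))" by (simp only: M_def[symmetric] flip: sum_distrib_right)
      also have "\<dots> \<le> e" using M e by (simp add: field_simps)
      finally show ?thesis .
    qed
    then have "norm (\<Sum>j\<in>UNIV. dk j k * fourier f k $ j) \<le> 0" by (rule field_le_epsilon) simp
    then show ?thesis by simp
  qed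
  moreover have n: "norm (fourier f 0) \<le> e" if e: "e > 0" for e
  proof -
    obtain g where g: "solenoidal g" "norm (fourier f 0 - fourier g 0) \<le> e" using ap[OF e] by blast
    have "fourier g 0 = 0" using g(1) unfolding solenoidal_def by blast
    then show ?thesis using g(2) by simp
  qed
  have "norm (fourier f 0) \<le> 0" by (rule field_le_epsilon, drule n, simp)
  then have "fourier f 0 = 0" by simp
  ultimately show ?thesis unfolding solenoidal_def by blast
qed

lemma V_space_H_space:
  assumes "f \<in> V_space" shows "f \<in> H_space"
proof -
  have f: "f \<in> sobolev 1" using assms by (simp add: V_space_def)
  have "\<exists>g\<in>smooth_sol. L2norm (\<lambda>x. f x - g x) < e" if e: "e > 0" for e
  proof -
    obtain g where g: "g \<in> smooth_sol" "hnorm 1 (\<lambda>x. f x - g x) < e" using assms e unfolding V_space_def by blast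
    then have "g \<in> sobolev 1" by (intro smooth_sobolev_1) (simp add: smooth_sol_def)
    then show ?thesis using L2norm_le_hnorm[OF sobolev_diff(1)[OF f]] g
      by (intro bexI[of _ g]) (auto intro: le_less_trans)
  qed
  then show ?thesis using sobolev_L2[OF f] by (simp add: H_space_def)
qed

lemma trigf_smooth_sol:
  assumes "m \<noteq> 0" "lattice m \<bullet> v = 0" "lattice m \<bullet> w = 0"
  shows "trigf m v w \<in> smooth_sol"
proof -
  have I: "integrable torus (ch m)" by (intro Lsq_integrable Lsq_ch)
  have "(LINT x|torus. Re (ch m x)) = 0" "(LINT x|torus. Im (ch m x)) = 0"
    using integral_Re[OF I] integral_Im[OF I] assms(1) by (simp_all add: integral_ch)
  moreover have "integrable torus (\<lambda>x. Re (ch m x))" "integrable torus (\<lambda>x. Im (ch m x))"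
    using I by (auto intro: integrable_Re integrable_Im)
  ultimately have "(LINT x|torus. trigf m v w x) = 0" unfolding trigf_def by simp
  moreover have "(\<Sum>j\<in>UNIV. pd j (trigf m v w) x $ j) = 2 * pi * (Re (ch m x) * (lattice m \<bullet> w) - Im (ch m x) * (lattice m \<bullet> v))" for x
    unfolding pd_trigf trigf_def inner_vec_def
    by (simp add: sum_distrib_left sum_subtractf algebra_simps)
  ultimately show ?thesis using assms trigf_smooth by (simp add: smooth_sol_def)
qed

lemma smooth_sol_H_space:
  assumes "g \<in> smooth_sol" shows "g \<in> H_space"
proof -
  have "g \<in> L2" using assms smooth_field_L2 by (auto simp: smooth_sol_def)
  moreover have "L2norm (\<lambda>x. g x - g x) = 0" by (simp add: L2norm_def ip_def)
  ultimately show ?thesis using assms by (force simp: H_space_def)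
qed

text \<open>Pairing with a mode reads off the real and imaginary parts of the coefficient at
  \<open>m\<close>. With amplitudes taken from that coefficient itself, the value is its squared
  norm; \<open>phi_support\<close> uses this.\<close>

lemma ip_trigf:
  assumes f: "f \<in> L2"
  shows "ip f (trigf m v w) = (\<Sum>i\<in>UNIV. Re (fourier f m $ i) * v $ i - Im (fourier f m $ i) * w $ i)"
proof -
  have L: "(\<lambda>x. complex_of_real (trigf m a b x)) \<in> Lsq" for a b
    by (intro smooth_Lsq trigf_smooth)
  have I: "integrable torus (\<lambda>x. trigf m a b x * f x $ i)" for a b :: real and i
    using integrable_Re[OF Lsq_cmult_integrable[OF L[of a b] Lsq_cf[OF f, of i]]] by simp
  have eq: "complex_of_real ((LINT x|torus. trigf m a b x *\<^sub>R f x) $ i) = complex_of_real (LINT x|torus. trigf m a b x * f x $ i)" for a b i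
    unfolding integral_scaleR_component[OF L f]
    using integral_complex_of_real[of torus "\<lambda>x. trigf m a b x * f x $ i"] by simp
  have R: "Re (fourier f m $ i) = (LINT x|torus. trigf m 1 0 x * f x $ i)"
    and J: "Im (fourier f m $ i) = - (LINT x|torus. trigf m 0 1 x * f x $ i)" for i
    unfolding fourier_nth fc_cf_trigf[OF f] eq by simp_all
  have "f x \<bullet> trigf m v w x = (\<Sum>i\<in>UNIV. (trigf m 1 0 x * f x $ i) * v $ i + (trigf m 0 1 x * f x $ i) * w $ i)" for x
    by (simp add: inner_vec_def trigf_def algebra_simps)
  then show ?thesis unfolding ip_def R J using I by simp
qed

section \<open>Sobolev embedding and the convective term\<close>

lemma sum_kbox_prod:
  fixes a :: "int \<Rightarrow> real"
  shows "(\<Sum>k\<in>kbox n. \<Prod>i\<in>UNIV. a (k $ i)) = (\<Sum>m\<in>{- int n..int n}. a m) ^ 3"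
proof -
  have "(\<Sum>m\<in>{- int n..int n}. a m) ^ 3 = (\<Prod>i\<in>(UNIV::3 set). \<Sum>m\<in>{- int n..int n}. a m)" by simp
  also have "\<dots> = (\<Sum>g\<in>UNIV \<rightarrow>\<^sub>E {- int n..int n}. \<Prod>i\<in>(UNIV::3 set). a (g i))"
    by (rule prod_sum_PiE) auto
  also have "\<dots> = (\<Sum>k\<in>kbox n. \<Prod>i\<in>UNIV. a (k $ i))"
  proof (rule sum.reindex_bij_witness[of _ vec_nth vec_lambda])
    fix k :: "int^3" assume "k \<in> kbox n"
    then show "vec_nth k \<in> UNIV \<rightarrow>\<^sub>E {- int n..int n}" by (auto simp: kbox_def abs_le_iff minus_le_iff)
  qed (auto simp: kbox_def PiE_iff abs_le_iff minus_le_iff)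
  finally show ?thesis by simp
qed

text \<open>The weight is split into three equal powers, and one coordinate is kept in each. The sum
  over a cube then factorises into the third power of a one-dimensional sum with exponent 2 \<sigma>
  / 3, which converges because this exceeds 1.\<close>

lemma sobolev_weight_summable:
  assumes "\<sigma> > 3/2"
  shows "sobolev_weight (- \<sigma>) summable_on UNIV"
proof -
  define a where "a m = (1 + (real_of_int m)\<^sup>2) powr (- \<sigma> / 3)" for m
  have le: "sobolev_weight (- \<sigma>) k \<le> (\<Prod>i\<in>UNIV. a (k $ i))" for k
  proof -
    let ?w = "1 + 4 * pi\<^sup>2 * (norm (lattice k))\<^sup>2"
    have "1 \<le> ?w" by simp
    have w: "1 + (real_of_int (k $ i))\<^sup>2 \<le> ?w" for i
    proof -
      have "(real_of_int (k $ i))\<^sup>2 \<le> (norm (lattice k))\<^sup>2"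
        unfolding norm_lattice_sq by (rule member_le_sum) auto
      moreover have "1 \<le> pi\<^sup>2" using pi_gt3 by (intro one_le_power) simp
      then have "1 * (norm (lattice k))\<^sup>2 \<le> 4 * pi\<^sup>2 * (norm (lattice k))\<^sup>2"
        by (intro mult_right_mono) auto
      ultimately show ?thesis by simp
    qed
    have "sobolev_weight (- \<sigma>) k = (\<Prod>i\<in>(UNIV::3 set). ?w powr (- \<sigma> / 3))"
      unfolding sobolev_weight_def by (simp add: power3_eq_cube flip: powr_add)
    also have "\<dots> \<le> (\<Prod>i\<in>UNIV. a (k $ i))"
      unfolding a_def using assms by (intro prod_mono conjI powr_mono2' w) (auto intro: add_pos_nonneg)
    finally show ?thesis .
  qed
  have sm: "summable (\<lambda>n. a (int n))"
  proof (rule summable_comparison_test_ev)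
    show "summable (\<lambda>n. real n powr (2 * (- \<sigma> / 3)))"
      using assms by (subst summable_real_powr_iff) simp
    show "\<forall>\<^sub>F n in sequentially. norm (a (int n)) \<le> real n powr (2 * (- \<sigma> / 3))"
      \<comment> \<open>n = 0 is excluded: there \<open>powr\<close> has base 0 and value 0, whereas
        \<open>a 0\<close> is 1.\<close>
      using eventually_gt_at_top[of 0]
    proof eventually_elim
      case (elim n)
      have "a (int n) \<le> ((real n)\<^sup>2) powr (- \<sigma> / 3)"
        unfolding a_def using elim assms by (intro powr_mono2') auto
      also have "\<dots> = real n powr (2 * (- \<sigma> / 3))"
      proof -
        have "(real n)\<^sup>2 = real n powr 2" using elim by simp
        then show ?thesis by (simp only: powr_powr)
      qed
      finally show ?case by (simp add: a_def)
    qed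
  qed
  have a0: "0 \<le> a m" for m by (simp add: a_def)
  let ?A = "\<Sum>n. a (int n)"
  \<comment> \<open>\<open>a\<close> is even. Zero occurs in both halves, which only enlarges the
    bound.\<close>
  have A: "(\<Sum>m\<in>{- int n..int n}. a m) \<le> 2 * ?A" for n
  proof -
    have "{- int n..int n} = (\<lambda>j. int j) ` {..n} \<union> (\<lambda>j. - int j) ` {..n}"
    proof (intro set_eqI iffI)
      fix m assume "m \<in> {- int n..int n}"
      then show "m \<in> (\<lambda>j. int j) ` {..n} \<union> (\<lambda>j. - int j) ` {..n}"
        by (cases "0 \<le> m") (auto intro: rev_image_eqI[of "nat m"] rev_image_eqI[of "nat (- m)"])
    qed auto
    then have "(\<Sum>m\<in>{- int n..int n}. a m) \<le> (\<Sum>m\<in>(\<lambda>j. int j) ` {..n}. a m) + (\<Sum>m\<in>(\<lambda>j. - int j) ` {..n}. a m)"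
      using sum.union_inter[of "int ` {..n}" "(\<lambda>j. - int j) ` {..n}" a]
        sum_nonneg[of "int ` {..n} \<inter> (\<lambda>j. - int j) ` {..n}" a, OF a0] by simp
    also have "(\<Sum>m\<in>(\<lambda>j. - int j) ` {..n}. a m) = (\<Sum>j\<le>n. a (int j))"
      by (subst sum.reindex) (auto simp: inj_on_def a_def)
    also have "(\<Sum>m\<in>(\<lambda>j. int j) ` {..n}. a m) = (\<Sum>j\<le>n. a (int j))"
      by (subst sum.reindex) (auto simp: inj_on_def)
    also have "(\<Sum>j\<le>n. a (int j)) \<le> ?A" by (rule sum_le_suminf[OF sm]) (auto simp: a0)
    finally show ?thesis by simp
  qed
  show ?thesis
  proof (rule nonneg_bdd_above_summable_on)
    have "sum (sobolev_weight (- \<sigma>)) F \<le> (2 * ?A) ^ 3" if F: "finite F" for F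
    proof -
      have "\<forall>\<^sub>F n in sequentially. finite (kbox n) \<and> F \<subseteq> kbox n \<and> kbox n \<subseteq> UNIV"
        using kbox_exhaust F unfolding filterlim_finite_subsets_at_top by blast
      then obtain n where "F \<subseteq> kbox n" unfolding eventually_sequentially by blast
      then have "sum (sobolev_weight (- \<sigma>)) F \<le> sum (sobolev_weight (- \<sigma>)) (kbox n)"
        by (intro sum_mono2) (auto intro: less_imp_le sobolev_weight_pos)
      also have "\<dots> \<le> (\<Sum>k\<in>kbox n. \<Prod>i\<in>UNIV. a (k $ i))" by (intro sum_mono le)
      also have "\<dots> \<le> (2 * ?A) ^ 3"
        unfolding sum_kbox_prod by (intro power_mono A sum_nonneg a0)
      finally show ?thesis .
    qed
    then show "bdd_above (sum (sobolev_weight (- \<sigma>)) ` {F. F \<subseteq> UNIV \<and> finite F})"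
      by (auto intro!: bdd_aboveI[of _ "(2 * ?A) ^ 3"])
  qed (auto intro: less_imp_le sobolev_weight_pos)
qed

lemma bounded_finite_sums:
  fixes f :: "'a \<Rightarrow> real"
  assumes "\<And>x. 0 \<le> f x" "\<And>F. finite F \<Longrightarrow> sum f F \<le> B"
  shows "f summable_on UNIV" "infsum f UNIV \<le> B"
proof -
  show "f summable_on UNIV"
    using assms by (intro nonneg_bdd_above_summable_on) (auto intro!: bdd_aboveI[of _ B])
  then show "infsum f UNIV \<le> B" using assms by (intro infsum_le_finite_sums) auto
qed

definition Wsum :: "real \<Rightarrow> real" where
  "Wsum \<sigma> = (\<Sum>\<^sub>\<infinity>k. sobolev_weight (- \<sigma>) k)"

text \<open>Cauchy-Schwarz after splitting the weight of order \<tau> into orders -(\<sigma> -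
  \<tau>) and \<sigma>. The case \<tau> = 0 bounds the field itself; \<tau> = r is the absolutely
  summable factor in \<open>advection_Hr\<close>.\<close>

lemma sobolev_l1:
  assumes f: "f \<in> sobolev \<sigma>" and \<sigma>: "\<sigma> - \<tau> > 3/2"
  shows "(\<lambda>k. sqrt (sobolev_weight \<tau> k) * norm (fourier f k)) summable_on UNIV"
    and "(\<Sum>\<^sub>\<infinity>k. sqrt (sobolev_weight \<tau> k) * norm (fourier f k)) \<le> sqrt (Wsum (\<sigma> - \<tau>)) * hnorm \<sigma> f"
proof -
  have B: "(\<Sum>k\<in>F. sqrt (sobolev_weight \<tau> k) * norm (fourier f k)) \<le> sqrt (Wsum (\<sigma> - \<tau>)) * hnorm \<sigma> f" if "finite F" for F
  proof -
    have eq: "sqrt (sobolev_weight \<tau> k) * norm (fourier f k)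
      = sqrt (sobolev_weight (- (\<sigma> - \<tau>)) k) * (sqrt (sobolev_weight \<sigma> k) * norm (fourier f k))" for k
      using sobolev_weight_add[of "- (\<sigma> - \<tau>)" \<sigma> k] by (simp add: real_sqrt_mult)
    have "(\<Sum>k\<in>F. sqrt (sobolev_weight \<tau> k) * norm (fourier f k))\<^sup>2
      \<le> (\<Sum>k\<in>F. (sqrt (sobolev_weight (- (\<sigma> - \<tau>)) k))\<^sup>2) * (\<Sum>k\<in>F. (sqrt (sobolev_weight \<sigma> k) * norm (fourier f k))\<^sup>2)"
      unfolding eq by (rule Cauchy_Schwarz_ineq_sum)
    also have "\<dots> = (\<Sum>k\<in>F. sobolev_weight (- (\<sigma> - \<tau>)) k) * (\<Sum>k\<in>F. sobolev_weight \<sigma> k * (norm (fourier f k))\<^sup>2)"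
      using less_imp_le[OF sobolev_weight_pos] by (simp add: power_mult_distrib)
    also have "\<dots> \<le> Wsum (\<sigma> - \<tau>) * (hnorm \<sigma> f)\<^sup>2"
      unfolding Wsum_def hnorm_sq[OF f] using less_imp_le[OF sobolev_weight_pos] that
      by (intro mult_mono finite_sum_le_infsum sobolev_weight_summable \<sigma> sobolev_summable f infsum_nonneg sum_nonneg) auto
    finally have "sqrt ((\<Sum>k\<in>F. sqrt (sobolev_weight \<tau> k) * norm (fourier f k))\<^sup>2) \<le> sqrt (Wsum (\<sigma> - \<tau>) * (hnorm \<sigma> f)\<^sup>2)"
      by (rule real_sqrt_le_mono)
    then show ?thesis by (simp add: real_sqrt_mult)
  qed
  have p: "0 \<le> sqrt (sobolev_weight \<tau> k) * norm (fourier f k)" for k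
    using less_imp_le[OF sobolev_weight_pos] by simp
  show "(\<lambda>k. sqrt (sobolev_weight \<tau> k) * norm (fourier f k)) summable_on UNIV"
    by (rule bounded_finite_sums(1)[OF p B])
  show "(\<Sum>\<^sub>\<infinity>k. sqrt (sobolev_weight \<tau> k) * norm (fourier f k)) \<le> sqrt (Wsum (\<sigma> - \<tau>)) * hnorm \<sigma> f"
    by (rule bounded_finite_sums(2)[OF p B])
qed

lemma sobolev_sup:
  assumes f: "f \<in> sobolev \<sigma>" and \<sigma>: "\<sigma> > 3/2"
  shows "(\<lambda>k. norm (fc (cf j f) k)) summable_on UNIV"
    and "AE x in torus. \<bar>f x $ j\<bar> \<le> sqrt (Wsum \<sigma>) * hnorm \<sigma> f"
proof -
  have s: "(\<lambda>k. norm (fourier f k)) summable_on UNIV" and b: "(\<Sum>\<^sub>\<infinity>k. norm (fourier f k)) \<le> sqrt (Wsum \<sigma>) * hnorm \<sigma> f"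
    using sobolev_l1[OF f, of 0] \<sigma> by (simp_all add: sobolev_weight_0)
  have le: "norm (fc (cf j f) k) \<le> norm (fourier f k)" for k
    unfolding fourier_nth[symmetric] by (rule Finite_Cartesian_Product.norm_nth_le)
  show s': "(\<lambda>k. norm (fc (cf j f) k)) summable_on UNIV"
    by (rule summable_on_comparison_test[OF s le]) auto
  have "(\<Sum>\<^sub>\<infinity>k. norm (fc (cf j f) k)) \<le> sqrt (Wsum \<sigma>) * hnorm \<sigma> f"
    using infsum_mono[OF s' s le] b by linarith
  moreover have "AE x in torus. norm (cf j f x) \<le> (\<Sum>\<^sub>\<infinity>k. norm (fc (cf j f) k))"
    by (intro sup_le_sum_fc Lsq_cf sobolev_L2[OF f] s')
  ultimately show "AE x in torus. \<bar>f x $ j\<bar> \<le> sqrt (Wsum \<sigma>) * hnorm \<sigma> f"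
    by (auto elim!: eventually_mono)
qed

text \<open>The squared L^2 norm of the gradient.\<close>

definition gsq :: "field \<Rightarrow> real" where
  "gsq v = (\<Sum>j\<in>UNIV. nsq (weak_pd j v))"

lemma gsq_has_sum:
  assumes v: "v \<in> sobolev 1"
  shows "((\<lambda>k. 4 * pi\<^sup>2 * (norm (lattice k))\<^sup>2 * (norm (fourier v k))\<^sup>2) has_sum gsq v) UNIV"
proof -
  have "((\<lambda>k. \<Sum>j\<in>UNIV. (norm (fourier (weak_pd j v) k))\<^sup>2) has_sum gsq v) UNIV"
    unfolding gsq_def by (intro has_sum_sum nsq_has_sum weak_pd v)
  then show ?thesis unfolding weak_pd(2)[OF v] sum_norm_wpd_coeff .
qed

lemma hnorm_1_sq: "v \<in> sobolev 1 \<Longrightarrow> (hnorm 1 v)\<^sup>2 = nsq v + gsq v"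
  using has_sum_add[OF nsq_has_sum[OF sobolev_L2] gsq_has_sum, of v 1] hnorm_has_sum[of v 1]
  by (auto simp: sobolev_weight_1 algebra_simps intro: has_sum_unique)

lemma gsq_nonneg [simp]: "0 \<le> gsq v"
  by (simp add: gsq_def sum_nonneg)

section \<open>Bounds and antisymmetry of the convective term\<close>

lemma advection_bounded:
  assumes a: "a \<in> L2" and v: "v \<in> sobolev 1" and B: "\<And>j. AE x in torus. \<bar>a x $ j\<bar> \<le> B"
  shows "advection a v \<in> L2" "nsq (advection a v) \<le> 3 * B\<^sup>2 * gsq v"
proof -
  have am: "(\<lambda>x. a x $ j) \<in> borel_measurable torus" for j
    using borel_measurable_Re[THEN measurable_compose_rev, OF LsqD[OF Lsq_cf[OF a]]] by simp
  have wL: "weak_pd j v \<in> L2" for j by (rule weak_pd(1)[OF v])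
  have m: "advection a v \<in> borel_measurable torus"
    unfolding advection_def by (intro borel_measurable_sum borel_measurable_scaleR am L2D wL)
  have I: "integrable torus (\<lambda>x. 3 * B\<^sup>2 * (\<Sum>j\<in>UNIV. (norm (weak_pd j v x))\<^sup>2))"
    using wL by (intro integrable_mult_right Bochner_Integration.integrable_sum) (simp add: L2_def)
  have "AE x in torus. \<forall>j. \<bar>a x $ j\<bar> \<le> B" using B by (simp add: AE_all_countable)
  then have b: "AE x in torus. (norm (advection a v x))\<^sup>2 \<le> 3 * B\<^sup>2 * (\<Sum>j\<in>UNIV. (norm (weak_pd j v x))\<^sup>2)"
  proof eventually_elim
    case (elim x)
    have "norm (advection a v x) \<le> (\<Sum>j\<in>UNIV. norm ((a x $ j) *\<^sub>R weak_pd j v x))"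
      unfolding advection_def by (rule norm_sum)
    also have "\<dots> \<le> (\<Sum>j\<in>UNIV. B * norm (weak_pd j v x))"
      using elim by (intro sum_mono) (simp add: mult_right_mono)
    finally have "(norm (advection a v x))\<^sup>2 \<le> (\<Sum>j\<in>UNIV. B * norm (weak_pd j v x))\<^sup>2"
      by (intro power_mono) auto
    also have "\<dots> \<le> (\<Sum>j\<in>(UNIV::3 set). B\<^sup>2) * (\<Sum>j\<in>UNIV. (norm (weak_pd j v x))\<^sup>2)"
      by (rule Cauchy_Schwarz_ineq_sum)
    finally show ?case by simp
  qed
  show "advection a v \<in> L2" unfolding L2_Lsq
  proof (rule LsqI_bound[OF _ m I b])
    have "periodic (weak_pd j v)" for j using wL[of j] by (simp add: L2_def)
    then show "periodic (advection a v)" using a by (simp add: L2_def periodic_def advection_def)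
  qed
  then have "integrable torus (\<lambda>x. (norm (advection a v x))\<^sup>2)" by (simp add: L2_def)
  then have "nsq (advection a v) \<le> (LINT x|torus. 3 * B\<^sup>2 * (\<Sum>j\<in>UNIV. (norm (weak_pd j v x))\<^sup>2))"
    unfolding nsq_def using I b by (intro integral_mono_AE)
  also have "\<dots> = 3 * B\<^sup>2 * gsq v"
    using wL by (simp add: gsq_def nsq_def L2_def)
  finally show "nsq (advection a v) \<le> 3 * B\<^sup>2 * gsq v" .
qed

lemma advection_sobolev:
  assumes a: "a \<in> sobolev \<sigma>" and v: "v \<in> sobolev 1" and \<sigma>: "\<sigma> > 3/2"
  shows "advection a v \<in> L2" "nsq (advection a v) \<le> 3 * Wsum \<sigma> * (hnorm \<sigma> a)\<^sup>2 * gsq v"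
proof -
  have W: "0 \<le> Wsum \<sigma>" unfolding Wsum_def by (intro infsum_nonneg less_imp_le sobolev_weight_pos)
  note A = advection_bounded[OF sobolev_L2[OF a] v sobolev_sup(2)[OF a \<sigma>]]
  show "advection a v \<in> L2" by (rule A)
  show "nsq (advection a v) \<le> 3 * Wsum \<sigma> * (hnorm \<sigma> a)\<^sup>2 * gsq v"
    using A(2) W by (simp add: power_mult_distrib mult.assoc)
qed

lemma integrable_mult_Lsq:
  "f \<in> Lsq \<Longrightarrow> g \<in> Lsq \<Longrightarrow> integrable torus (\<lambda>x. (f x :: complex) * g x)"
  using Lsq_cmult_integrable[of f "\<lambda>x. cnj (g x)"] by (simp add: Lsq_cnj)

text \<open>The convolution theorem: \<open>product_has_sum\<close> expands the transporting field,
  and what remains at frequency \<open>p\<close> is the coefficient at \<open>k - p\<close> of the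
  differentiated field.\<close>

lemma fourier_advection:
  assumes a: "a \<in> sobolev \<sigma>" and v: "v \<in> sobolev 1" and \<sigma>: "\<sigma> > 3/2"
  shows "((\<lambda>p. (\<Sum>j\<in>UNIV. fourier a p $ j * dk j (k - p)) * fourier v (k - p) $ i) has_sum fourier (advection a v) k $ i) UNIV"
proof -
  have aL: "a \<in> L2" using a by (rule sobolev_L2)
  have wL: "cf i (weak_pd j v) \<in> Lsq" for j by (intro Lsq_cf weak_pd(1) v)
  have h: "((\<lambda>p. fourier a p $ j * dk j (k - p) * fourier v (k - p) $ i) has_sum
      (LINT x|torus. cf j a x * (cf i (weak_pd j v) x * cnj (ch k x)))) UNIV" for j
  proof -
    have eq: "fc (cf j a) p * (LINT x|torus. ch p x * (cf i (weak_pd j v) x * cnj (ch k x))) = fourier a p $ j * dk j (k - p) * fourier v (k - p) $ i" for p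
    proof -
      have "(LINT x|torus. ch p x * (cf i (weak_pd j v) x * cnj (ch k x))) = fc (cf i (weak_pd j v)) (k - p)"
        using fc_ch_mult[of p "cf i (weak_pd j v)" k] by (simp add: fc_def mult.assoc)
      also have "\<dots> = dk j (k - p) * fourier v (k - p) $ i"
        by (simp add: weak_pd(2)[OF v] wpd_coeff_def flip: fourier_nth)
      finally show ?thesis by (simp add: fourier_nth)
    qed
    show ?thesis
      using product_has_sum[OF Lsq_cf[OF aL] sobolev_sup(1)[OF a \<sigma>, of j] fc_integrable[OF wL[of j], of k]] unfolding eq .
  qed
  have I: "integrable torus (\<lambda>x. cf j a x * (cf i (weak_pd j v) x * cnj (ch k x)))" for j
    by (rule integrable_mult_l1(1)[OF Lsq_cf[OF aL] sobolev_sup(1)[OF a \<sigma>] fc_integrable[OF wL]])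
  have "fourier (advection a v) k $ i = (LINT x|torus. (\<Sum>j\<in>UNIV. cf j a x * (cf i (weak_pd j v) x * cnj (ch k x))))"
    unfolding fourier_nth fc_def by (simp add: advection_def sum_distrib_right mult.assoc)
  also have "\<dots> = (\<Sum>j\<in>UNIV. LINT x|torus. cf j a x * (cf i (weak_pd j v) x * cnj (ch k x)))"
    by (intro Bochner_Integration.integral_sum I)
  finally have e: "fourier (advection a v) k $ i = \<dots>" .
  show ?thesis unfolding e sum_distrib_right by (intro has_sum_sum h)
qed

text \<open>Young's inequality for the convolution of an l^1 with an l^2 sequence. Cauchy-Schwarz
  with weight \<open>a\<close> bounds the square of the convolution by the sum of \<open>a\<close>
  times the convolution of \<open>a\<close> with the squares of \<open>b\<close>; summing over
  \<open>k\<close> uses translation invariance.\<close>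

lemma young_l1_l2:
  fixes a b :: "int^3 \<Rightarrow> real"
  assumes a: "\<And>k. 0 \<le> a k" "a summable_on UNIV" and b: "\<And>k. 0 \<le> b k" "(\<lambda>k. (b k)\<^sup>2) summable_on UNIV"
  shows "(\<lambda>p. a p * b (k - p)) summable_on UNIV"
    and "finite K \<Longrightarrow> (\<Sum>k\<in>K. (\<Sum>\<^sub>\<infinity>p. a p * b (k - p))\<^sup>2) \<le> (infsum a UNIV)\<^sup>2 * (\<Sum>\<^sub>\<infinity>k. (b k)\<^sup>2)"
proof -
  let ?A = "infsum a UNIV" and ?B = "\<Sum>\<^sub>\<infinity>k. (b k)\<^sup>2"
  have A0: "0 \<le> ?A" by (intro infsum_nonneg a)
  have B: "(\<Sum>k\<in>F. (b k)\<^sup>2) \<le> ?B" if "finite F" for F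
    using that b by (intro finite_sum_le_infsum) auto
  have B': "(\<Sum>k\<in>F. (b (k - p))\<^sup>2) \<le> ?B" if "finite F" for F p
  proof -
    have "(\<Sum>k\<in>F. (b (k - p))\<^sup>2) = (\<Sum>k\<in>(\<lambda>k. k - p) ` F. (b k)\<^sup>2)"
      by (subst sum.reindex) (auto simp: inj_on_def)
    then show ?thesis using B[of "(\<lambda>k. k - p) ` F"] that by simp
  qed
  have s2: "(\<lambda>p. a p * (b (k - p))\<^sup>2) summable_on UNIV" for k
  proof (rule summable_on_comparison_test)
    show "(\<lambda>p. a p * ?B) summable_on UNIV" by (intro summable_on_cmult_left a)
    show "a p * (b (k - p))\<^sup>2 \<le> a p * ?B" for p
      using B'[of "{k}" p] by (intro mult_left_mono a) simp
  qed (use a in auto)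
  define Q where "Q k = (\<Sum>\<^sub>\<infinity>p. a p * (b (k - p))\<^sup>2)" for k
  have Q0: "0 \<le> Q k" for k unfolding Q_def by (intro infsum_nonneg mult_nonneg_nonneg a) auto
  have F: "(\<Sum>p\<in>F. a p * b (k - p)) \<le> sqrt (?A * Q k)" if "finite F" for F k
  proof -
    have "(\<Sum>p\<in>F. a p * b (k - p))\<^sup>2 = (\<Sum>p\<in>F. sqrt (a p) * (sqrt (a p) * b (k - p)))\<^sup>2"
      using a(1) by (simp flip: mult.assoc)
    also have "\<dots> \<le> (\<Sum>p\<in>F. (sqrt (a p))\<^sup>2) * (\<Sum>p\<in>F. (sqrt (a p) * b (k - p))\<^sup>2)"
      by (rule Cauchy_Schwarz_ineq_sum)
    also have "\<dots> = (\<Sum>p\<in>F. a p) * (\<Sum>p\<in>F. a p * (b (k - p))\<^sup>2)"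
      using a(1) by (simp add: power_mult_distrib)
    also have "\<dots> \<le> ?A * Q k"
      unfolding Q_def using that a A0 by (intro mult_mono finite_sum_le_infsum s2 sum_nonneg) auto
    finally show ?thesis by (rule real_le_rsqrt)
  qed
  have p: "0 \<le> a p * b (k - p)" for p k using a b by simp
  show sm: "(\<lambda>p. a p * b (k - p)) summable_on UNIV" for k
    by (rule bounded_finite_sums(1)[OF p F])
  have le: "(\<Sum>\<^sub>\<infinity>p. a p * b (k - p))\<^sup>2 \<le> ?A * Q k" for k
  proof -
    have "(\<Sum>\<^sub>\<infinity>p. a p * b (k - p)) \<le> sqrt (?A * Q k)" by (rule bounded_finite_sums(2)[OF p F])
    then have "(\<Sum>\<^sub>\<infinity>p. a p * b (k - p))\<^sup>2 \<le> (sqrt (?A * Q k))\<^sup>2" by (intro power_mono infsum_nonneg p)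
    then show ?thesis using A0 Q0 by simp
  qed
  assume K: "finite K"
  have "(\<Sum>k\<in>K. Q k) \<le> ?A * ?B"
  proof (rule has_sum_mono)
    show "((\<lambda>p. \<Sum>k\<in>K. a p * (b (k - p))\<^sup>2) has_sum (\<Sum>k\<in>K. Q k)) UNIV"
      unfolding Q_def by (intro has_sum_sum has_sum_infsum s2)
    show "((\<lambda>p. a p * ?B) has_sum ?A * ?B) UNIV"
      by (intro has_sum_cmult_left has_sum_infsum a)
    show "(\<Sum>k\<in>K. a p * (b (k - p))\<^sup>2) \<le> a p * ?B" for p
      unfolding sum_distrib_left[symmetric] by (intro mult_left_mono B' K a)
  qed
  then have "?A * (\<Sum>k\<in>K. Q k) \<le> ?A * (?A * ?B)" by (intro mult_left_mono A0)
  moreover have "(\<Sum>k\<in>K. (\<Sum>\<^sub>\<infinity>p. a p * b (k - p))\<^sup>2) \<le> (\<Sum>k\<in>K. ?A * Q k)" by (intro sum_mono le)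
  ultimately show "(\<Sum>k\<in>K. (\<Sum>\<^sub>\<infinity>p. a p * b (k - p))\<^sup>2) \<le> ?A\<^sup>2 * ?B"
    by (simp add: sum_distrib_left power2_eq_square mult.assoc)
qed

lemma has_sum_norm_le:
  fixes f :: "'a \<Rightarrow> 'b::real_normed_vector"
  assumes f: "(f has_sum a) A" and g: "(g has_sum b) A" and le: "\<And>x. norm (f x) \<le> g x"
  shows "norm a \<le> b"
proof -
  have s: "(\<lambda>x. norm (f x)) summable_on A"
    by (rule summable_on_comparison_test[OF has_sum_imp_summable[OF g]]) (use le in auto)
  have "norm a \<le> (\<Sum>\<^sub>\<infinity>x\<in>A. norm (f x))"
    by (rule norm_has_sum_bound[OF has_sum_infsum[OF s] f])
  also have "\<dots> \<le> b"
    by (rule has_sum_mono[OF has_sum_infsum[OF s] g le])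
  finally show ?thesis .
qed

text \<open>An inequality of Peetre type: |k|^2 is at most 2|p|^2 + 2|k - p|^2, and the product form
  follows because the cross term is nonnegative. The factor 2^r is at most 2 since r \<le>
  1.\<close>

lemma sobolev_weight_peetre:
  assumes "0 \<le> r" "r \<le> 1"
  shows "sobolev_weight r k \<le> 2 * sobolev_weight r p * sobolev_weight r (k - p)"
proof -
  let ?w = "\<lambda>k. 1 + 4 * pi\<^sup>2 * (norm (lattice k))\<^sup>2"
  have pos: "0 < ?w k" for k by (intro add_pos_nonneg) auto
  have "lattice k = lattice p + lattice (k - p)" by simp
  then have "norm (lattice k) \<le> norm (lattice p) + norm (lattice (k - p))" by (metis norm_triangle_ineq)
  then have "(norm (lattice k))\<^sup>2 \<le> (norm (lattice p) + norm (lattice (k - p)))\<^sup>2" by (intro power_mono) auto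
  also have "\<dots> \<le> 2 * (norm (lattice p))\<^sup>2 + 2 * (norm (lattice (k - p)))\<^sup>2"
    using sum_squares_bound[of "norm (lattice p)" "norm (lattice (k - p))"] by (simp add: power2_sum)
  finally have le: "4 * pi\<^sup>2 * (norm (lattice k))\<^sup>2 \<le> 4 * pi\<^sup>2 * (2 * (norm (lattice p))\<^sup>2 + 2 * (norm (lattice (k - p)))\<^sup>2)"
    by (intro mult_left_mono) auto
  define P R where "P = 4 * pi\<^sup>2 * (norm (lattice p))\<^sup>2" and "R = 4 * pi\<^sup>2 * (norm (lattice (k - p)))\<^sup>2"
  have "0 \<le> P" "0 \<le> R" by (auto simp: P_def R_def)
  moreover have "0 \<le> P * R" using \<open>0 \<le> P\<close> \<open>0 \<le> R\<close> by (rule mult_nonneg_nonneg)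
  moreover have "4 * pi\<^sup>2 * (norm (lattice k))\<^sup>2 \<le> 2 * P + 2 * R"
    using le unfolding P_def R_def by (simp only: distrib_left mult_ac)
  moreover have "2 * ((1 + P) * (1 + R)) = 2 + 2 * P + 2 * R + 2 * (P * R)" by (simp add: algebra_simps)
  ultimately have "?w k \<le> 2 * ((1 + P) * (1 + R))" by linarith
  then have "?w k \<le> 2 * (?w p * ?w (k - p))" unfolding P_def R_def .
  then have "?w k powr r \<le> (2 * (?w p * ?w (k - p))) powr r"
    using pos[of k] assms by (intro powr_mono2) auto
  also have "\<dots> = 2 powr r * (?w p powr r * ?w (k - p) powr r)"
    using pos less_imp_le by (simp add: powr_mult)
  also have "\<dots> \<le> 2 * (?w p powr r * ?w (k - p) powr r)"
    using powr_mono[of r 1 2] assms by (intro mult_right_mono) auto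
  finally show ?thesis by (simp add: sobolev_weight_def)
qed

lemma sum_dk_le:
  "norm (\<Sum>j\<in>UNIV. v $ j * dk j q) \<le> norm (v :: complex^3) * (2 * pi * norm (lattice q))"
proof -
  have "norm (\<Sum>j\<in>UNIV. v $ j * dk j q) \<le> (\<Sum>j\<in>UNIV. norm (v $ j) * norm (dk j q))"
    by (rule order_trans[OF norm_sum]) (simp add: norm_mult)
  also have "\<dots> \<le> norm v * (2 * pi * norm (lattice q))"
  proof (rule power2_le_imp_le)
    have "(\<Sum>j\<in>UNIV. norm (v $ j) * norm (dk j q))\<^sup>2 \<le> (\<Sum>j\<in>UNIV. (norm (v $ j))\<^sup>2) * (\<Sum>j\<in>UNIV. (norm (dk j q))\<^sup>2)"
      by (rule Cauchy_Schwarz_ineq_sum)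
    also have "\<dots> = (norm v * (2 * pi * norm (lattice q)))\<^sup>2"
      by (simp add: sum_norm_dk power_mult_distrib norm_vec_sq[of v])
    finally show "(\<Sum>j\<in>UNIV. norm (v $ j) * norm (dk j q))\<^sup>2 \<le> (norm v * (2 * pi * norm (lattice q)))\<^sup>2" .
  qed auto
  finally show ?thesis .
qed

text \<open>The Peetre inequality distributes the weight of order \<open>r\<close> over both factors
  of the convolution. The weighted coefficients of \<open>a\<close> are then absolutely summable
  because \<tau> - r > 3/2, those of the gradient of \<open>v\<close> are square-summable, and
  \<open>young_l1_l2\<close> applies. The 6 is the Peetre factor 2 times three components.\<close>

lemma advection_Hr:
  assumes r: "0 \<le> r" "r \<le> 1" and \<tau>: "\<tau> - r > 3/2"
    and a: "a \<in> sobolev \<tau>" and v: "v \<in> sobolev (r + 1)"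
  shows "advection a v \<in> sobolev r"
    and "(hnorm r (advection a v))\<^sup>2 \<le> 6 * Wsum (\<tau> - r) * (hnorm \<tau> a)\<^sup>2 * (hnorm (r + 1) v)\<^sup>2"
proof -
  have \<tau>': "\<tau> > 3/2" using r \<tau> by linarith
  have v1: "v \<in> sobolev 1" using v by (rule sobolev_mono) (use r in simp)
  have wp: "0 \<le> sobolev_weight \<sigma> k" for \<sigma> k by (rule less_imp_le[OF sobolev_weight_pos])
  have W: "0 \<le> Wsum (\<tau> - r)" unfolding Wsum_def by (intro infsum_nonneg wp)
  define A where "A p = sqrt (sobolev_weight r p) * norm (fourier a p)" for p
  define b where "b i q = sqrt (sobolev_weight r q) * (2 * pi * norm (lattice q)) * norm (fourier v q $ i)" for i q
  have A: "0 \<le> A p" "A summable_on UNIV" for p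
    using sobolev_l1(1)[OF a \<tau>] wp by (simp_all add: A_def[abs_def])
  have AS: "(infsum A UNIV)\<^sup>2 \<le> Wsum (\<tau> - r) * (hnorm \<tau> a)\<^sup>2"
  proof -
    have "(infsum A UNIV)\<^sup>2 \<le> (sqrt (Wsum (\<tau> - r)) * hnorm \<tau> a)\<^sup>2"
      using sobolev_l1(2)[OF a \<tau>] by (intro power_mono infsum_nonneg A) (simp add: A_def[abs_def])
    then show ?thesis using W by (simp add: power_mult_distrib)
  qed
  have b0: "0 \<le> b i q" for i q using wp by (simp add: b_def)
  have bV: "(b i q)\<^sup>2 \<le> sobolev_weight (r + 1) q * (norm (fourier v q))\<^sup>2" for i q
  proof -
    have "(b i q)\<^sup>2 = sobolev_weight r q * (4 * pi\<^sup>2 * (norm (lattice q))\<^sup>2) * (norm (fourier v q $ i))\<^sup>2"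
      using wp by (simp add: b_def power_mult_distrib)
    also have "\<dots> \<le> sobolev_weight r q * sobolev_weight 1 q * (norm (fourier v q))\<^sup>2"
      by (intro mult_mono power_mono Finite_Cartesian_Product.norm_nth_le mult_nonneg_nonneg wp) (auto simp: sobolev_weight_1)
    finally show ?thesis by (simp add: sobolev_weight_add)
  qed
  have bS: "(\<lambda>q. (b i q)\<^sup>2) summable_on UNIV" for i
    by (rule summable_on_comparison_test[OF sobolev_summable[OF v] bV]) simp
  have bI: "(\<Sum>\<^sub>\<infinity>q. (b i q)\<^sup>2) \<le> (hnorm (r + 1) v)\<^sup>2" for i
    by (rule has_sum_mono[OF has_sum_infsum[OF bS] hnorm_has_sum[OF v] bV])
  let ?f = "fourier (advection a v)"
  have est: "sobolev_weight r k * (norm (?f k $ i))\<^sup>2 \<le> 2 * (\<Sum>\<^sub>\<infinity>p. A p * b i (k - p))\<^sup>2" for k i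
  proof -
    let ?g = "\<lambda>p. (\<Sum>j\<in>UNIV. fourier a p $ j * dk j (k - p)) * fourier v (k - p) $ i"
    have sm: "(\<lambda>p. A p * b i (k - p)) summable_on UNIV" by (rule young_l1_l2(1)[OF A b0 bS])
    have le: "sqrt (sobolev_weight r k) * norm (?g p) \<le> sqrt 2 * (A p * b i (k - p))" for p
    proof -
      have "norm (?g p) \<le> norm (fourier a p) * (2 * pi * norm (lattice (k - p))) * norm (fourier v (k - p) $ i)"
        unfolding norm_mult by (intro mult_right_mono sum_dk_le) auto
      moreover have "sqrt (sobolev_weight r k) \<le> sqrt 2 * sqrt (sobolev_weight r p) * sqrt (sobolev_weight r (k - p))"
        using real_sqrt_le_mono[OF sobolev_weight_peetre[OF r, of k p]] by (simp add: real_sqrt_mult)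
      ultimately have "sqrt (sobolev_weight r k) * norm (?g p) \<le> (sqrt 2 * sqrt (sobolev_weight r p) * sqrt (sobolev_weight r (k - p))) *
         (norm (fourier a p) * (2 * pi * norm (lattice (k - p))) * norm (fourier v (k - p) $ i))"
        using wp by (intro mult_mono) auto
      then show ?thesis by (simp add: A_def b_def mult_ac)
    qed
    have hs: "((\<lambda>p. of_real (sqrt (sobolev_weight r k)) * ?g p) has_sum of_real (sqrt (sobolev_weight r k)) * (?f k $ i)) UNIV"
      by (intro has_sum_cmult_right fourier_advection[OF a v1 \<tau>'])
    have "norm (of_real (sqrt (sobolev_weight r k)) * (?f k $ i)) \<le> sqrt 2 * (\<Sum>\<^sub>\<infinity>p. A p * b i (k - p))"
    proof (rule has_sum_norm_le[OF hs])
      show "((\<lambda>p. sqrt 2 * (A p * b i (k - p))) has_sum sqrt 2 * (\<Sum>\<^sub>\<infinity>p. A p * b i (k - p))) UNIV"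
        by (intro has_sum_cmult_right has_sum_infsum sm)
      show "norm (complex_of_real (sqrt (sobolev_weight r k)) * ?g p) \<le> sqrt 2 * (A p * b i (k - p))" for p
        using le[of p] wp by (simp add: norm_mult)
    qed
    then have "(sqrt (sobolev_weight r k) * norm (?f k $ i))\<^sup>2 \<le> (sqrt 2 * (\<Sum>\<^sub>\<infinity>p. A p * b i (k - p)))\<^sup>2"
      using wp by (intro power_mono) (simp_all add: norm_mult)
    then show ?thesis using wp by (simp add: power_mult_distrib)
  qed
  have B: "(\<Sum>k\<in>K. sobolev_weight r k * (norm (?f k))\<^sup>2) \<le> 6 * Wsum (\<tau> - r) * (hnorm \<tau> a)\<^sup>2 * (hnorm (r + 1) v)\<^sup>2" if K: "finite K" for K
  proof -
    have "(\<Sum>k\<in>K. sobolev_weight r k * (norm (?f k))\<^sup>2) = (\<Sum>i\<in>UNIV. \<Sum>k\<in>K. sobolev_weight r k * (norm (?f k $ i))\<^sup>2)"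
      by (subst sum.swap) (simp add: norm_vec_sq sum_distrib_left)
    also have "\<dots> \<le> (\<Sum>i\<in>(UNIV::3 set). 2 * (Wsum (\<tau> - r) * (hnorm \<tau> a)\<^sup>2 * (hnorm (r + 1) v)\<^sup>2))"
    proof (rule sum_mono)
      fix i
      have "(\<Sum>k\<in>K. sobolev_weight r k * (norm (?f k $ i))\<^sup>2) \<le> (\<Sum>k\<in>K. 2 * (\<Sum>\<^sub>\<infinity>p. A p * b i (k - p))\<^sup>2)"
        by (intro sum_mono est)
      also have "\<dots> \<le> 2 * ((infsum A UNIV)\<^sup>2 * (\<Sum>\<^sub>\<infinity>q. (b i q)\<^sup>2))"
        unfolding sum_distrib_left[symmetric] using young_l1_l2(2)[OF A b0 bS K] by simp
      also have "\<dots> \<le> 2 * (Wsum (\<tau> - r) * (hnorm \<tau> a)\<^sup>2 * (hnorm (r + 1) v)\<^sup>2)"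
        using W by (intro mult_left_mono mult_mono AS bI) (auto intro: infsum_nonneg)
      finally show "(\<Sum>k\<in>K. sobolev_weight r k * (norm (?f k $ i))\<^sup>2) \<le> \<dots>" .
    qed
    finally show ?thesis by simp
  qed
  have p: "0 \<le> sobolev_weight r k * (norm (?f k))\<^sup>2" for k using wp by simp
  show s: "advection a v \<in> sobolev r"
    using advection_sobolev(1)[OF a v1 \<tau>'] bounded_finite_sums(1)[OF p B] by (simp add: sobolev_def)
  show "(hnorm r (advection a v))\<^sup>2 \<le> 6 * Wsum (\<tau> - r) * (hnorm \<tau> a)\<^sup>2 * (hnorm (r + 1) v)\<^sup>2"
    unfolding hnorm_sq[OF s] by (rule bounded_finite_sums(2)[OF p B])
qed

text \<open>The sum over j of a_j \<partial>_j (b . c) has integral zero for divergence-free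
  \<open>a\<close>. It is expanded in the Fourier coefficients of \<open>a\<close>; the term at
  frequency \<open>p\<close> contains the divergence of \<open>a\<close> at \<open>p\<close> as a
  factor.\<close>

lemma advection_antisym:
  assumes a: "a \<in> sobolev \<sigma>" "solenoidal a" and \<sigma>: "\<sigma> > 3/2" and b: "b \<in> sobolev 1" and c: "c \<in> sobolev 1"
  shows "ip (advection a b) c = - ip (advection a c) b"
proof -
  have aL: "a \<in> L2" and bL: "b \<in> L2" and cL: "c \<in> L2" using a b c sobolev_L2 by auto
  have wb: "cf i (weak_pd j b) \<in> Lsq" and wc: "cf i (weak_pd j c) \<in> Lsq" for i j
    by (intro Lsq_cf weak_pd(1) b c)+
  define Z where "Z i j x = cf i (weak_pd j b) x * cf i c x + cf i b x * cf i (weak_pd j c) x" for i j x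
  have ZI: "integrable torus (Z i j)" for i j
    unfolding Z_def[abs_def] by (intro Bochner_Integration.integrable_add integrable_mult_Lsq wb wc Lsq_cf bL cL)
  \<comment> \<open>\<open>Z i j\<close> stands for the derivative of b_i c_i. That product is only
    known to be integrable, so the integration by parts against \<open>ch p\<close> goes through
    Parseval for the two factors instead of a weak derivative of the product.\<close>
  have Zp: "(LINT x|torus. ch p x * Z i j x) = - dk j p * (LINT x|torus. (ch p x * cf i b x) * cnj (cf i c x))" for p i j
  proof -
    have 1: "((\<lambda>m. dk j (m - p) * fourier b (m - p) $ i * cnj (fourier c m $ i)) has_sum (LINT x|torus. (ch p x * cf i (weak_pd j b) x) * cnj (cf i c x))) UNIV"
      using parseval[OF Lsq_ch_mult[OF wb[of j i], of p] Lsq_cf[OF cL, of i]]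
      by (simp add: fc_ch_mult fourier_nth[symmetric] weak_pd(2)[OF b] wpd_coeff_def)
    have 2: "((\<lambda>m. fourier b (m - p) $ i * cnj (dk j m * fourier c m $ i)) has_sum (LINT x|torus. (ch p x * cf i b x) * cnj (cf i (weak_pd j c) x))) UNIV"
      using parseval[OF Lsq_ch_mult[OF Lsq_cf[OF bL, of i], of p] wc[of j i]]
      by (simp add: fc_ch_mult fourier_nth[symmetric] weak_pd(2)[OF c] wpd_coeff_def)
    have 3: "((\<lambda>m. - dk j p * (fourier b (m - p) $ i * cnj (fourier c m $ i))) has_sum - dk j p * (LINT x|torus. (ch p x * cf i b x) * cnj (cf i c x))) UNIV"
      using parseval[OF Lsq_ch_mult[OF Lsq_cf[OF bL, of i], of p] Lsq_cf[OF cL, of i]]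
      by (intro has_sum_cmult_right) (simp add: fc_ch_mult fourier_nth[symmetric])
    have "dk j (m - p) * fourier b (m - p) $ i * cnj (fourier c m $ i) + fourier b (m - p) $ i * cnj (dk j m * fourier c m $ i)
       = - dk j p * (fourier b (m - p) $ i * cnj (fourier c m $ i))" for m
      unfolding complex_cnj_mult cnj_dk by (simp add: dk_def algebra_simps)
    then have "(LINT x|torus. (ch p x * cf i (weak_pd j b) x) * cnj (cf i c x)) + (LINT x|torus. (ch p x * cf i b x) * cnj (cf i (weak_pd j c) x))
      = - dk j p * (LINT x|torus. (ch p x * cf i b x) * cnj (cf i c x))"
      using has_sum_unique[OF _ 3] has_sum_add[OF 1 2] by (simp only:)
    moreover have "(LINT x|torus. ch p x * Z i j x) = (LINT x|torus. (ch p x * cf i (weak_pd j b) x) * cnj (cf i c x) + (ch p x * cf i b x) * cnj (cf i (weak_pd j c) x))"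
      by (simp add: Z_def algebra_simps)
    moreover have "\<dots> = (LINT x|torus. (ch p x * cf i (weak_pd j b) x) * cnj (cf i c x)) + (LINT x|torus. (ch p x * cf i b x) * cnj (cf i (weak_pd j c) x))"
      by (intro Bochner_Integration.integral_add Lsq_cmult_integrable Lsq_ch_mult wb wc Lsq_cf bL cL)
    ultimately show ?thesis by simp
  qed
  have zero: "(\<Sum>j\<in>UNIV. LINT x|torus. cf j a x * Z i j x) = 0" for i
  proof -
    have hs: "((\<lambda>p. \<Sum>j\<in>UNIV. fc (cf j a) p * (LINT x|torus. ch p x * Z i j x)) has_sum (\<Sum>j\<in>UNIV. LINT x|torus. cf j a x * Z i j x)) UNIV"
      by (intro has_sum_sum product_has_sum Lsq_cf aL sobolev_sup(1)[OF a(1) \<sigma>] ZI)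
    have "(\<Sum>j\<in>UNIV. fc (cf j a) p * (LINT x|torus. ch p x * Z i j x)) = 0" for p
    proof -
      have "(\<Sum>j\<in>UNIV. fc (cf j a) p * (LINT x|torus. ch p x * Z i j x))
        = - (\<Sum>j\<in>UNIV. dk j p * fourier a p $ j) * (LINT x|torus. (ch p x * cf i b x) * cnj (cf i c x))"
        unfolding Zp by (simp add: sum_distrib_right sum_negf[symmetric] fourier_nth mult_ac)
      then show ?thesis using a(2) by (simp add: solenoidal_def)
    qed
    then have "((\<lambda>p::int^3. 0) has_sum (\<Sum>j\<in>UNIV. LINT x|torus. cf j a x * Z i j x)) UNIV"
      using hs by simp
    then show ?thesis using has_sum_unique has_sum_0_simp by blast
  qed
  have AI: "integrable torus (\<lambda>x. cf j a x * Z i j x)" for i j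
    by (rule integrable_mult_l1(1)[OF Lsq_cf[OF aL] sobolev_sup(1)[OF a(1) \<sigma>] ZI])
  note adv = advection_sobolev(1)[OF a(1) _ \<sigma>]
  have "ip (advection a b) c + ip (advection a c) b = (LINT x|torus. advection a b x \<bullet> c x + advection a c x \<bullet> b x)"
    unfolding ip_def by (intro Bochner_Integration.integral_add[symmetric] ip_integrable adv b c bL cL)
  then have "complex_of_real (ip (advection a b) c + ip (advection a c) b) = (LINT x|torus. complex_of_real (advection a b x \<bullet> c x + advection a c x \<bullet> b x))"
    by (simp only: integral_complex_of_real)
  also have "\<dots> = (LINT x|torus. (\<Sum>i\<in>UNIV. \<Sum>j\<in>UNIV. cf j a x * Z i j x))"
    by (intro Bochner_Integration.integral_cong refl)
      (simp add: advection_def inner_vec_def Z_def sum_distrib_right sum_distrib_left distrib_left sum.distrib mult_ac)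
  also have "\<dots> = (\<Sum>i\<in>UNIV. \<Sum>j\<in>UNIV. LINT x|torus. cf j a x * Z i j x)"
    using AI by (simp only: Bochner_Integration.integral_sum Bochner_Integration.integrable_sum)
  finally have "complex_of_real (ip (advection a b) c + ip (advection a c) b) = 0" by (simp only: zero) simp
  then show ?thesis by (simp only: of_real_eq_0_iff eq_neg_iff_add_eq_0)
qed

section \<open>Expansion in Stokes eigenfunctions\<close>

lemma pd_add:
  assumes "\<And>x. f differentiable (at x)" "\<And>x. g differentiable (at x)"
  shows "pd j (\<lambda>x. f x + g x) = (\<lambda>x. pd j f x + pd j g x)"
proof
  fix x
  have "((\<lambda>x. f x + g x) has_derivative (\<lambda>h. frechet_derivative f (at x) h + frechet_derivative g (at x) h)) (at x)"
    using assms by (intro has_derivative_add) (simp_all add: frechet_derivative_works)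
  from frechet_derivative_at[OF this] show "pd j (\<lambda>x. f x + g x) x = pd j f x + pd j g x"
    unfolding pd_def by metis
qed

lemma pd_scaleR:
  assumes "\<And>x. f differentiable (at x)"
  shows "pd j (\<lambda>x. c *\<^sub>R f x) = (\<lambda>x. c *\<^sub>R pd j f x)"
proof
  fix x
  have "((\<lambda>x. c *\<^sub>R f x) has_derivative (\<lambda>h. c *\<^sub>R frechet_derivative f (at x) h)) (at x)"
    using assms by (intro has_derivative_scaleR_right) (simp add: frechet_derivative_works)
  from frechet_derivative_at[OF this] show "pd j (\<lambda>x. c *\<^sub>R f x) x = c *\<^sub>R pd j f x"
    unfolding pd_def by metis
qed

lemma Ck_add: "Ck n f \<Longrightarrow> Ck n g \<Longrightarrow> Ck n (\<lambda>x. f x + g x)"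
proof (induction n arbitrary: f g)
  case (Suc n)
  then show ?case by (auto simp: pd_add)
qed (simp add: continuous_on_add)

lemma Ck_scaleR: "Ck n f \<Longrightarrow> Ck n (\<lambda>x. c *\<^sub>R f x)"
proof (induction n arbitrary: f)
  case (Suc n)
  then show ?case by (auto simp: pd_scaleR)
qed (simp add: continuous_intros)

lemma smooth_sol_add:
  assumes f: "f \<in> smooth_sol" and g: "g \<in> smooth_sol"
  shows "(\<lambda>x. f x + g x) \<in> smooth_sol"
proof -
  have s: "f \<in> smooth_torus" "g \<in> smooth_torus" using assms by (auto simp: smooth_sol_def)
  have "pd j (\<lambda>x. f x + g x) = (\<lambda>x. pd j f x + pd j g x)" for j
    by (intro pd_add smooth_torusD s)
  moreover have "integrable torus f" "integrable torus g"
    using smooth_torusD(3)[OF s(1)] smooth_torusD(3)[OF s(2)] by (auto intro: continuous_torus)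
  moreover have "(\<lambda>x. f x + g x) \<in> smooth_torus"
    using s by (auto simp: smooth_torus_def periodic_def Ck_add)
  ultimately show ?thesis using assms by (simp add: smooth_sol_def sum.distrib)
qed

lemma smooth_sol_scaleR:
  assumes f: "f \<in> smooth_sol"
  shows "(\<lambda>x. c *\<^sub>R f x) \<in> smooth_sol"
proof -
  have s: "f \<in> smooth_torus" using assms by (auto simp: smooth_sol_def)
  have "pd j (\<lambda>x. c *\<^sub>R f x) = (\<lambda>x. c *\<^sub>R pd j f x)" for j
    by (intro pd_scaleR smooth_torusD s)
  moreover have "(\<lambda>x. c *\<^sub>R f x) \<in> smooth_torus"
    using s by (auto simp: smooth_torus_def periodic_def Ck_scaleR)
  ultimately show ?thesis using assms by (simp add: smooth_sol_def flip: sum_distrib_left)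
qed

lemma L2norm_triangle:
  assumes "f \<in> L2" "g \<in> L2"
  shows "L2norm (\<lambda>x. f x + g x) \<le> L2norm f + L2norm g"
proof (rule power2_le_imp_le)
  have "nsq (\<lambda>x. f x + g x) = ip f (\<lambda>x. f x + g x) + ip g (\<lambda>x. f x + g x)"
    unfolding ip_self[symmetric] by (intro ip_add_left L2_add assms)
  also have "\<dots> = nsq f + 2 * ip f g + nsq g"
    using assms by (simp add: ip_commute[of _ "\<lambda>x. f x + g x"] ip_add_left ip_self ip_commute[of g f])
  also have "\<dots> \<le> (L2norm f)\<^sup>2 + 2 * (L2norm f * L2norm g) + (L2norm g)\<^sup>2"
    using ip_CS[OF assms] by (simp add: L2norm_sq)
  finally show "(L2norm (\<lambda>x. f x + g x))\<^sup>2 \<le> (L2norm f + L2norm g)\<^sup>2"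
    by (simp add: L2norm_sq power2_sum)
  show "0 \<le> L2norm f + L2norm g" by (simp add: L2norm_nsq)
qed

lemma L2norm_scaleR: "L2norm (\<lambda>x. c *\<^sub>R f x) = \<bar>c\<bar> * L2norm f"
  by (simp add: L2norm_def ip_def real_sqrt_mult power2_eq_square[symmetric] mult.assoc[symmetric])

lemma smooth_sol_L2: "g \<in> smooth_sol \<Longrightarrow> g \<in> L2"
  by (intro H_space_L2 smooth_sol_H_space)

lemma H_space_approx: "f \<in> H_space \<Longrightarrow> e > 0 \<Longrightarrow> \<exists>g\<in>smooth_sol. L2norm (\<lambda>x. f x - g x) < e"
  by (simp add: H_space_def)

lemma H_space_closed:
  assumes f: "f \<in> L2" and ap: "\<And>e. e > 0 \<Longrightarrow> \<exists>g\<in>H_space. L2norm (\<lambda>x. f x - g x) < e"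
  shows "f \<in> H_space"
proof -
  have "\<exists>g\<in>smooth_sol. L2norm (\<lambda>x. f x - g x) < e" if e: "e > 0" for e
  proof -
    obtain h where h: "h \<in> H_space" "L2norm (\<lambda>x. f x - h x) < e / 2" using ap[of "e / 2"] e by auto
    have "\<exists>g\<in>smooth_sol. L2norm (\<lambda>x. h x - g x) < e / 2" using e by (intro H_space_approx h(1)) simp
    then obtain g where g: "g \<in> smooth_sol" "L2norm (\<lambda>x. h x - g x) < e / 2" by blast
    have "L2norm (\<lambda>x. (f x - h x) + (h x - g x)) < e"
      using L2norm_triangle[of "\<lambda>x. f x - h x" "\<lambda>x. h x - g x"] L2_diff[OF f H_space_L2[OF h(1)]] L2_diff[OF H_space_L2[OF h(1)] smooth_sol_L2[OF g(1)]] h(2) g(2) by simp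
    then show ?thesis using g(1) by (intro bexI[of _ g]) auto
  qed
  then show ?thesis using f by (simp add: H_space_def)
qed

lemma H_space_add:
  assumes f: "f \<in> H_space" and g: "g \<in> H_space"
  shows "(\<lambda>x. f x + g x) \<in> H_space"
proof (rule H_space_closed)
  note L = H_space_L2[OF f] H_space_L2[OF g]
  show "(\<lambda>x. f x + g x) \<in> L2" by (intro L2_add L)
  fix e :: real assume e: "e > 0"
  have "\<exists>a\<in>smooth_sol. L2norm (\<lambda>x. f x - a x) < e / 2" "\<exists>b\<in>smooth_sol. L2norm (\<lambda>x. g x - b x) < e / 2"
    using e by (auto intro!: H_space_approx f g simp del: less_divide_eq_numeral1)
  then obtain a b where ab: "a \<in> smooth_sol" "L2norm (\<lambda>x. f x - a x) < e / 2" "b \<in> smooth_sol" "L2norm (\<lambda>x. g x - b x) < e / 2"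
    by blast
  have "L2norm (\<lambda>x. (f x - a x) + (g x - b x)) < e"
    using L2norm_triangle[of "\<lambda>x. f x - a x" "\<lambda>x. g x - b x"] L2_diff[OF L(1) smooth_sol_L2[OF ab(1)]] L2_diff[OF L(2) smooth_sol_L2[OF ab(3)]] ab by simp
  moreover have "(\<lambda>x. (f x - a x) + (g x - b x)) = (\<lambda>x. (f x + g x) - (a x + b x))" by (simp add: fun_eq_iff)
  ultimately show "\<exists>h\<in>H_space. L2norm (\<lambda>x. (f x + g x) - h x) < e"
    by (intro bexI[of _ "\<lambda>x. a x + b x"]) (auto intro: smooth_sol_H_space smooth_sol_add ab)
qed

lemma H_space_scaleR:
  assumes f: "f \<in> H_space" shows "(\<lambda>x. c *\<^sub>R f x) \<in> H_space"
proof (rule H_space_closed)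
  show "(\<lambda>x. c *\<^sub>R f x) \<in> L2" by (intro L2_scaleR H_space_L2 f)
  fix e :: real assume e: "e > 0"
  have "\<exists>a\<in>smooth_sol. L2norm (\<lambda>x. f x - a x) < e / (\<bar>c\<bar> + 1)"
    using f e unfolding H_space_def by simp
  then obtain a where a: "a \<in> smooth_sol" "L2norm (\<lambda>x. f x - a x) < e / (\<bar>c\<bar> + 1)" by blast
  have "L2norm (\<lambda>x. c *\<^sub>R (f x - a x)) \<le> \<bar>c\<bar> * (e / (\<bar>c\<bar> + 1))"
    unfolding L2norm_scaleR using a by (intro mult_left_mono) auto
  also have "\<dots> < e" using e by (simp add: field_simps)
  finally show "\<exists>h\<in>H_space. L2norm (\<lambda>x. c *\<^sub>R f x - h x) < e"
    by (intro bexI[of _ "\<lambda>x. c *\<^sub>R a x"]) (auto simp: scaleR_diff_right intro: smooth_sol_H_space smooth_sol_scaleR a)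
qed

lemma H_space_zero [simp]: "(\<lambda>x. 0) \<in> H_space"
proof -
  have "trigf (axis 1 1) 0 0 \<in> smooth_sol" by (intro trigf_smooth_sol) (auto simp: axis_eq_0_iff)
  then show ?thesis using smooth_sol_H_space[of "trigf (axis 1 1) 0 0"] by (simp add: trigf_def[abs_def])
qed

lemma H_space_sum: "(\<And>i. i \<in> I \<Longrightarrow> f i \<in> H_space) \<Longrightarrow> (\<lambda>x. \<Sum>i\<in>I. f i x) \<in> H_space"
  by (induction I rule: infinite_finite_induct) (auto intro: H_space_add)

text \<open>Neither the order nor the sign of the eigenvalues is prescribed; what is needed about
  them follows from the frequencies of the eigenfunctions.\<close>

locale stokes_basis =
  fixes \<phi> :: "nat \<Rightarrow> field" and lam :: "nat \<Rightarrow> real"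
  assumes basis: "stokes_eigenbasis \<phi> lam"
begin

lemma phi_H: "\<phi> k \<in> H_space" and phi_sobolev: "\<phi> k \<in> sobolev 2"
  using basis by (auto simp: stokes_eigenbasis_def dom_A_def)

lemma phi_L2: "\<phi> k \<in> L2"
  by (rule H_space_L2[OF phi_H])

lemma ortho: "ip (\<phi> j) (\<phi> k) = (if j = k then 1 else 0)"
  using basis by (auto simp: stokes_eigenbasis_def)

definition psum :: "(nat \<Rightarrow> real) \<Rightarrow> nat \<Rightarrow> field" where
  "psum c n = (\<lambda>x. \<Sum>k<n. c k *\<^sub>R \<phi> k x)"

lemma psum_H: "psum c n \<in> H_space"
  unfolding psum_def by (intro H_space_sum H_space_scaleR phi_H)

lemma psum_L2: "psum c n \<in> L2"
  by (rule H_space_L2[OF psum_H])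

lemma ip_psum: "f \<in> L2 \<Longrightarrow> ip f (psum c n) = (\<Sum>k<n. c k * ip f (\<phi> k))"
  unfolding psum_def by (subst ip_commute, subst ip_sum_left)
    (auto intro!: L2_scaleR phi_L2 sum.cong simp: ip_scaleR_left ip_commute[of f])

lemma ip_psum_phi: "ip (psum c n) (\<phi> k) = (if k < n then c k else 0)"
  by (subst ip_commute, subst ip_psum) (simp_all add: phi_L2 ortho if_distrib cong: if_cong)

lemma nsq_diff_psum:
  assumes f: "f \<in> L2"
  shows "nsq (\<lambda>x. f x - psum c n x) = nsq f - (\<Sum>k<n. (ip f (\<phi> k))\<^sup>2) + (\<Sum>k<n. (c k - ip f (\<phi> k))\<^sup>2)"
proof -
  note d = L2_diff[OF f psum_L2[of c n]]
  have pp: "ip (psum c n) (psum c n) = (\<Sum>k<n. (c k)\<^sup>2)"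
    by (simp add: ip_psum psum_L2 ip_psum_phi power2_eq_square)
  have "nsq (\<lambda>x. f x - psum c n x) = ip f (\<lambda>x. f x - psum c n x) - ip (psum c n) (\<lambda>x. f x - psum c n x)"
    unfolding ip_self[symmetric] by (intro ip_diff_left d f psum_L2)
  also have "\<dots> = nsq f - 2 * ip f (psum c n) + ip (psum c n) (psum c n)"
    by (simp add: ip_commute[of _ "\<lambda>x. f x - psum c n x"] ip_diff_left f psum_L2 ip_self ip_commute[of "psum c n" f])
  also have "\<dots> = nsq f - (\<Sum>k<n. (ip f (\<phi> k))\<^sup>2) + (\<Sum>k<n. (c k - ip f (\<phi> k))\<^sup>2)"
    unfolding pp ip_psum[OF f] by (simp add: power2_diff sum.distrib sum_subtractf sum_distrib_left mult_ac)
  finally show ?thesis .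
qed

lemma bessel: "f \<in> L2 \<Longrightarrow> (\<Sum>k<n. (ip f (\<phi> k))\<^sup>2) \<le> nsq f"
  using nsq_diff_psum[of f "\<lambda>k. ip f (\<phi> k)" n] nsq_nonneg[of "\<lambda>x. f x - psum (\<lambda>k. ip f (\<phi> k)) n x"] by simp

lemma expand: "f \<in> H_space \<Longrightarrow> (\<lambda>n. L2norm (\<lambda>x. f x - psum (\<lambda>k. ip f (\<phi> k)) n x)) \<longlonglongrightarrow> 0"
  using basis by (simp add: stokes_eigenbasis_def psum_def)

lemma L2norm_nonneg [simp]: "0 \<le> L2norm f"
  by (simp add: L2norm_nsq)

text \<open>Only one factor has to lie in H. The other may be any L^2 field, such as an unprojected
  convective term.\<close>

lemma ip_sums:
  assumes g: "g \<in> L2" and f: "f \<in> H_space"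
  shows "(\<lambda>k. ip g (\<phi> k) * ip f (\<phi> k)) sums ip g f"
proof -
  let ?S = "\<lambda>n. psum (\<lambda>k. ip f (\<phi> k)) n"
  have fL: "f \<in> L2" by (rule H_space_L2[OF f])
  have "(\<lambda>n. ip g (\<lambda>x. f x - ?S n x)) \<longlonglongrightarrow> 0"
  proof (rule Lim_null_comparison)
    show "\<forall>\<^sub>F n in sequentially. norm (ip g (\<lambda>x. f x - ?S n x)) \<le> L2norm g * L2norm (\<lambda>x. f x - ?S n x)"
      using ip_CS[OF g L2_diff[OF fL psum_L2]] by simp
    show "(\<lambda>n. L2norm g * L2norm (\<lambda>x. f x - ?S n x)) \<longlonglongrightarrow> 0"
      using tendsto_mult_right_zero[OF expand[OF f]] .
  qed
  moreover have "ip g (\<lambda>x. f x - ?S n x) = ip g f - (\<Sum>k<n. ip g (\<phi> k) * ip f (\<phi> k))" for n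
  proof -
    have "ip g (\<lambda>x. f x - ?S n x) = ip f g - ip (?S n) g"
      by (subst ip_commute) (intro ip_diff_left fL psum_L2 g)
    then show ?thesis by (simp add: ip_commute[of _ g] ip_psum[OF g] mult.commute)
  qed
  ultimately have "(\<lambda>n. ip g f - (ip g f - (\<Sum>k<n. ip g (\<phi> k) * ip f (\<phi> k)))) \<longlonglongrightarrow> ip g f - 0"
    by (intro tendsto_diff) auto
  then show ?thesis by (simp add: sums_def)
qed

lemma nsq_sums: "f \<in> H_space \<Longrightarrow> (\<lambda>k. (ip f (\<phi> k))\<^sup>2) sums nsq f"
  using ip_sums[OF H_space_L2, of f f] by (simp add: ip_self power2_eq_square)

text \<open>The argument of \<open>riesz_fischer\<close> for the eigenbasis; the limit stays in H
  because the partial sums lie there and H is closed.\<close>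

lemma psum_converges:
  assumes c: "summable (\<lambda>k. (c k)\<^sup>2)"
  obtains g where "g \<in> H_space" "(\<lambda>n. L2norm (\<lambda>x. g x - psum c n x)) \<longlonglongrightarrow> 0"
proof -
  define S where "S n = (\<Sum>k<n. (c k)\<^sup>2)" for n
  have d: "nsq (\<lambda>x. psum c m x - psum c n x) = \<bar>S m - S n\<bar>" for m n
  proof -
    have le: "nsq (\<lambda>x. psum c m x - psum c n x) = \<bar>S m - S n\<bar>" if "n \<le> m" for m n
    proof -
      have "nsq (psum c m) = S m"
        by (simp add: ip_self[symmetric] ip_psum psum_L2 ip_psum_phi power2_eq_square S_def)
      then have "nsq (\<lambda>x. psum c m x - psum c n x) = S m - S n"
        using that by (subst nsq_diff_psum[OF psum_L2]) (simp add: ip_psum_phi S_def)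
      moreover have "S n \<le> S m" unfolding S_def using that by (intro sum_mono2) auto
      ultimately show ?thesis by simp
    qed
    show ?thesis
    proof (cases "n \<le> m")
      case False
      then have "nsq (\<lambda>x. psum c n x - psum c m x) = \<bar>S n - S m\<bar>" by (intro le) simp
      then show ?thesis by (simp add: nsq_def norm_minus_commute abs_minus_commute)
    qed (rule le)
  qed
  have "Cauchy S" unfolding S_def using c by (intro convergent_Cauchy) (simp add: summable_iff_convergent)
  then have C: "\<exists>N. \<forall>m\<ge>N. \<forall>n\<ge>N. nsq (\<lambda>x. psum c m x - psum c n x) < e" if "e > 0" for e
    using that unfolding d Cauchy_iff real_norm_def by blast
  have pL: "psum c n \<in> Lsq" for n using psum_L2 by (simp add: L2_Lsq)
  obtain g where g: "g \<in> Lsq" "(\<lambda>n. nsq (\<lambda>x. psum c n x - g x)) \<longlonglongrightarrow> 0"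
    using Lsq_complete[of "psum c", OF pL C] by blast
  have l: "(\<lambda>n. L2norm (\<lambda>x. g x - psum c n x)) \<longlonglongrightarrow> 0"
    using tendsto_real_sqrt[OF g(2)] by (simp add: L2norm_nsq nsq_def norm_minus_commute)
  have "g \<in> H_space"
  proof (rule H_space_closed)
    show "g \<in> L2" using g(1) by (simp add: L2_Lsq)
    fix e :: real assume "e > 0"
    then obtain n where "L2norm (\<lambda>x. g x - psum c n x) < e"
      using order_tendstoD(2)[OF l] unfolding eventually_sequentially by blast
    then show "\<exists>h\<in>H_space. L2norm (\<lambda>x. g x - h x) < e" using psum_H by blast
  qed
  then show thesis using l that by blast
qed

lemma ip_limit_psum:
  assumes g: "g \<in> L2" "(\<lambda>n. L2norm (\<lambda>x. g x - psum c n x)) \<longlonglongrightarrow> 0"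
  shows "ip g (\<phi> k) = c k"
proof -
  have "(\<lambda>n. ip (\<lambda>x. g x - psum c n x) (\<phi> k)) \<longlonglongrightarrow> 0"
  proof (rule Lim_null_comparison[OF _ g(2)])
    have "L2norm (\<phi> k) = 1" by (simp add: L2norm_def ortho)
    then show "\<forall>\<^sub>F n in sequentially. norm (ip (\<lambda>x. g x - psum c n x) (\<phi> k)) \<le> L2norm (\<lambda>x. g x - psum c n x)"
      using ip_CS[OF L2_diff[OF g(1) psum_L2] phi_L2, of c _ k] by simp
  qed
  moreover have "\<forall>\<^sub>F n in sequentially. ip (\<lambda>x. g x - psum c n x) (\<phi> k) = ip g (\<phi> k) - c k"
    using eventually_gt_at_top[of k]
    by eventually_elim (simp add: ip_diff_left g psum_L2 phi_L2 ip_psum_phi)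
  ultimately have "(\<lambda>n::nat. ip g (\<phi> k) - c k) \<longlonglongrightarrow> 0" by (rule Lim_transform_eventually)
  then show ?thesis by (simp add: LIMSEQ_const_iff)
qed

lemma bessel_summable: "f \<in> L2 \<Longrightarrow> summable (\<lambda>k. (ip f (\<phi> k))\<^sup>2)"
  by (rule bounded_imp_summable[of _ "nsq f"]) (auto intro: order_trans[OF _ bessel[of f "Suc _"]] simp: lessThan_Suc_atMost)

text \<open>The projection is exhibited as the sum of its eigenfunction expansion, which converges
  by Bessel's inequality. The field picked by Hilbert choice is then used only through its pairings
  with H.\<close>

lemma leray:
  assumes f: "f \<in> L2"
  shows "leray f \<in> H_space" "h \<in> H_space \<Longrightarrow> ip (leray f) h = ip f h"
proof -
  obtain g where g: "g \<in> H_space" "(\<lambda>n. L2norm (\<lambda>x. g x - psum (\<lambda>k. ip f (\<phi> k)) n x)) \<longlonglongrightarrow> 0"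
    using psum_converges[OF bessel_summable[OF f]] by blast
  have gL: "g \<in> L2" by (rule H_space_L2[OF g(1)])
  have "ip (\<lambda>x. f x - g x) h = 0" if h: "h \<in> H_space" for h
  proof -
    have "ip (\<lambda>x. f x - g x) (\<phi> k) = 0" for k
      by (simp add: ip_diff_left f gL phi_L2 ip_limit_psum[OF gL g(2)])
    then have "(\<lambda>k. 0) sums ip (\<lambda>x. f x - g x) h" using ip_sums[OF L2_diff[OF f gL] h] by simp
    then show ?thesis using sums_unique2 sums_zero by blast
  qed
  then have "\<exists>g. g \<in> H_space \<and> (\<forall>h\<in>H_space. ip (\<lambda>x. f x - g x) h = 0)" using g(1) by blast
  then have L: "leray f \<in> H_space \<and> (\<forall>h\<in>H_space. ip (\<lambda>x. f x - leray f x) h = 0)"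
    unfolding leray_def by (rule someI_ex)
  then show "leray f \<in> H_space" by blast
  then show "ip (leray f) h = ip f h" if "h \<in> H_space"
    using L that ip_diff_left[OF f, of "leray f" h] H_space_L2 by force
qed

lemma ip_leray_phi: "f \<in> L2 \<Longrightarrow> ip (leray f) (\<phi> k) = ip f (\<phi> k)"
  by (intro leray phi_H)

text \<open>\<open>-\<Delta> \<phi>\<^sub>k - \<lambda>\<^sub>k \<phi>\<^sub>k\<close> is orthogonal to \<open>H\<close>; testing it with the single mode built from its own \<open>m\<close>-th
  coefficient, which is perpendicular to \<open>m\<close>, makes that coefficient vanish.\<close>

lemma phi_support: "(4 * pi\<^sup>2 * (norm (lattice m))\<^sup>2) *\<^sub>R fourier (\<phi> k) m = lam k *\<^sub>R fourier (\<phi> k) m"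
\<comment> \<open>The constant mode cannot serve as a test field, but there the coefficient of a
  mean-free field is zero anyway.\<close>
proof (cases "m = 0")
  case True
  then show ?thesis using H_space_solenoidal[OF phi_H[of k]] by (simp add: solenoidal_def)
next
  case False
  note lp = lap[OF phi_sobolev[of k]]
  define F where "F = (\<lambda>x. lap (\<phi> k) x - lam k *\<^sub>R \<phi> k x)"
  have FL: "F \<in> L2" unfolding F_def by (intro L2_diff lp(1) L2_scaleR phi_L2)
  have Ff: "fourier F m = (4 * pi\<^sup>2 * (norm (lattice m))\<^sup>2 - lam k) *\<^sub>R fourier (\<phi> k) m"
    unfolding F_def by (simp add: fourier_diff lp L2_scaleR phi_L2 fourier_scaleR scaleR_diff_left)
  have z: "ip F h = 0" if h: "h \<in> H_space" for h
  proof -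
    have st: "stokes (\<phi> k) = leray (lap (\<phi> k))" by (simp add: stokes_def lap_def)
    have "AE x in torus. leray (lap (\<phi> k)) x = lam k *\<^sub>R \<phi> k x"
      using basis unfolding st[symmetric] by (simp add: stokes_eigenbasis_def)
    then have "ip (leray (lap (\<phi> k))) h = ip (\<lambda>x. lam k *\<^sub>R \<phi> k x) h"
      by (rule ip_cong_AE) (intro H_space_L2 leray lp L2_scaleR phi_L2 h)+
    then have "ip (lap (\<phi> k)) h = ip (\<lambda>x. lam k *\<^sub>R \<phi> k x) h"
      using leray(2)[OF lp(1) h] by simp
    then show ?thesis unfolding F_def by (simp add: ip_diff_left lp L2_scaleR phi_L2 H_space_L2[OF h])
  qed
  let ?v = "\<chi> i. Re (fourier F m $ i)" and ?w = "\<chi> i. - Im (fourier F m $ i)"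
  have "(\<Sum>j\<in>UNIV. dk j m * fourier (\<phi> k) m $ j) = 0"
    using H_space_solenoidal[OF phi_H[of k]] by (simp add: solenoidal_def)
  moreover have "dk j m * (c *\<^sub>R v) $ j = complex_of_real c * (dk j m * v $ j)" for c and v :: "complex^3" and j
    by (simp add: vector_scaleR_component) (simp add: scaleR_conv_of_real)
  ultimately have "(\<Sum>j\<in>UNIV. dk j m * fourier F m $ j) = 0"
    unfolding Ff by (simp only: flip: sum_distrib_left) simp
  then have dv: "(\<i> * complex_of_real (2 * pi)) * (\<Sum>j\<in>UNIV. of_int (m $ j) * fourier F m $ j) = 0"
    by (simp add: dk_def sum_distrib_left mult_ac)
  then have "(\<Sum>j\<in>UNIV. of_int (m $ j) * fourier F m $ j) = 0" by simp
  then have "Re (\<Sum>j\<in>UNIV. of_int (m $ j) * fourier F m $ j) = 0" "Im (\<Sum>j\<in>UNIV. of_int (m $ j) * fourier F m $ j) = 0" by simp_all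
  then have "lattice m \<bullet> ?v = 0" "lattice m \<bullet> ?w = 0"
    by (simp_all add: inner_vec_def sum_negf)
  then have "trigf m ?v ?w \<in> H_space" using False by (intro smooth_sol_H_space trigf_smooth_sol)
  from z[OF this] have "(\<Sum>i\<in>UNIV. (norm (fourier F m $ i))\<^sup>2) = 0"
    unfolding ip_trigf[OF FL] cmod_power2 by (simp add: power2_eq_square)
  then have "(norm (fourier F m))\<^sup>2 = 0" by (simp only: norm_vec_sq)
  then have "fourier F m = 0" by simp
  then show ?thesis unfolding Ff scaleR_diff_left by simp
qed

lemma lam_support: "fourier (\<phi> k) m \<noteq> 0 \<Longrightarrow> lam k = 4 * pi\<^sup>2 * (norm (lattice m))\<^sup>2"
  using phi_support[of m k] by simp

text \<open>A normalised eigenfunction has a nonzero Fourier coefficient somewhere, and at that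
  frequency the eigenvalue is the symbol of minus the Laplacian.\<close>

lemma lam_nonneg: "0 \<le> lam k"
proof -
  have "\<exists>m. fourier (\<phi> k) m \<noteq> 0"
  proof (rule ccontr)
    assume "\<not> ?thesis"
    then have "((\<lambda>m::int^3. 0) has_sum nsq (\<phi> k)) UNIV"
      using nsq_has_sum[OF phi_L2[of k]] by simp
    then have "nsq (\<phi> k) = 0" using has_sum_unique has_sum_0_simp by blast
    then show False using ortho[of k k] by (simp add: ip_self)
  qed
  then show ?thesis using lam_support by fastforce
qed

text \<open>Symmetry of the Laplacian, frequency by frequency: wherever \<open>\<phi> k\<close> has
  a nonzero coefficient, the symbol equals \<open>lam k\<close>.\<close>

lemma coeff_lap:
  assumes "f \<in> sobolev 2"
  shows "ip (lap f) (\<phi> k) = lam k * ip f (\<phi> k)"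
proof -
  have fL: "f \<in> L2" by (rule sobolev_L2[OF assms])
  have "((\<lambda>m. lam k * (fourier f m \<bullet> fourier (\<phi> k) m)) has_sum lam k * ip f (\<phi> k)) UNIV"
    by (intro has_sum_cmult_right ip_has_sum fL phi_L2)
  moreover have "lam k * (fourier f m \<bullet> fourier (\<phi> k) m) = fourier (lap f) m \<bullet> fourier (\<phi> k) m" for m
    using lam_support[of k m] by (cases "fourier (\<phi> k) m = 0") (simp_all add: lap[OF assms])
  ultimately show ?thesis using ip_has_sum[OF lap(1)[OF assms] phi_L2[of k]] has_sum_unique by fastforce
qed

lemma stokes_coeff:
  assumes "f \<in> sobolev 2"
  shows "stokes f \<in> L2" "ip (stokes f) (\<phi> k) = lam k * ip f (\<phi> k)"
proof -
  have st: "stokes f = leray (lap f)" by (simp add: stokes_def lap_def)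
  show "stokes f \<in> L2" unfolding st by (intro H_space_L2 leray lap assms)
  show "ip (stokes f) (\<phi> k) = lam k * ip f (\<phi> k)"
    unfolding st by (simp add: ip_leray_phi lap(1)[OF assms] coeff_lap[OF assms])
qed

lemma gsq_sums:
  assumes f: "f \<in> sobolev 2" "f \<in> H_space"
  shows "(\<lambda>k. lam k * (ip f (\<phi> k))\<^sup>2) sums gsq f"
proof -
  have f1: "f \<in> sobolev 1" by (rule sobolev_mono[OF f(1)]) simp
  have "((\<lambda>m. fourier (lap f) m \<bullet> fourier f m) has_sum ip (lap f) f) UNIV"
    by (intro ip_has_sum lap f sobolev_L2[OF f1])
  then have "((\<lambda>m. 4 * pi\<^sup>2 * (norm (lattice m))\<^sup>2 * (norm (fourier f m))\<^sup>2) has_sum ip (lap f) f) UNIV"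
    by (simp add: lap[OF f(1)] power2_norm_eq_inner)
  then have "ip (lap f) f = gsq f" using gsq_has_sum[OF f1] has_sum_unique by blast
  then show ?thesis using ip_sums[OF lap(1)[OF f(1)] f(2)] by (simp add: coeff_lap f power2_eq_square mult_ac)
qed

text \<open>A duality argument. On the frequencies of \<open>\<phi> k\<close> the multiplier
  \<open>t m\<close> equals \<open>l k\<close>, so weighting the coefficients in the eigenbasis and
  weighting the Fourier coefficients give the same field \<open>?h\<close>. The multiplier can then
  be moved onto \<open>f\<close>, where it is bounded by the Sobolev weight.\<close>

lemma sobolev_bessel:
  assumes f: "f \<in> sobolev \<sigma>" and \<sigma>: "0 \<le> \<sigma>"
  shows "(\<Sum>k<n. lam k powr \<sigma> * (ip f (\<phi> k))\<^sup>2) \<le> (hnorm \<sigma> f)\<^sup>2"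
proof -
  have fL: "f \<in> L2" by (rule sobolev_L2[OF f])
  define l where "l k = lam k powr (\<sigma> / 2)" for k
  define c where "c k = l k * ip f (\<phi> k)" for k
  define t where "t m = (4 * pi\<^sup>2 * (norm (lattice m))\<^sup>2) powr (\<sigma> / 2)" for m
  let ?y = "psum c n" and ?h = "psum (\<lambda>k. c k * l k) n"
  have c2: "(c k)\<^sup>2 = lam k powr \<sigma> * (ip f (\<phi> k))\<^sup>2" for k
    by (simp add: c_def l_def power_mult_distrib power2_eq_square[of "lam k powr _"] flip: powr_add)
  have fh: "ip f ?h = (\<Sum>k<n. (c k)\<^sup>2)"
    by (simp add: ip_psum fL c_def power2_eq_square mult_ac)
  have yy: "nsq ?y = (\<Sum>k<n. (c k)\<^sup>2)"
    by (simp add: ip_self[symmetric] ip_psum psum_L2 ip_psum_phi power2_eq_square)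
  have hy: "fourier ?h m = t m *\<^sub>R fourier ?y m" for m
  proof -
    have "fourier (psum b n) m = (\<Sum>k<n. b k *\<^sub>R fourier (\<phi> k) m)" for b
      unfolding psum_def by (simp add: fourier_sum L2_scaleR phi_L2 fourier_scaleR)
    moreover have "(c k * l k) *\<^sub>R fourier (\<phi> k) m = t m *\<^sub>R (c k *\<^sub>R fourier (\<phi> k) m)" for k
      using lam_support[of k m] by (cases "fourier (\<phi> k) m = 0") (simp_all add: l_def t_def mult.commute)
    ultimately show ?thesis by (simp add: scaleR_sum_right del: scaleR_scaleR)
  qed
  have t: "(t m)\<^sup>2 \<le> sobolev_weight \<sigma> m" for m
  proof -
    have "(t m)\<^sup>2 = (4 * pi\<^sup>2 * (norm (lattice m))\<^sup>2) powr \<sigma>"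
      by (simp add: t_def power2_eq_square[of "_ powr _"] flip: powr_add)
    also have "\<dots> \<le> sobolev_weight \<sigma> m" unfolding sobolev_weight_def by (intro powr_mono2 \<sigma>) auto
    finally show ?thesis .
  qed
  \<comment> \<open>The left side equals \<open>nsq ?y\<close>, both being the sum of the squares of
    \<open>c\<close>, so half of it can be absorbed.\<close>
  have "ip f ?h \<le> (1/2) * (hnorm \<sigma> f)\<^sup>2 + (1/2) * nsq ?y"
  proof (rule has_sum_mono[OF ip_has_sum[OF fL psum_L2] has_sum_add[OF has_sum_cmult_right[OF hnorm_has_sum[OF f]] has_sum_cmult_right[OF nsq_has_sum[OF psum_L2]]]])
    fix m
    have "fourier f m \<bullet> fourier ?h m \<le> norm (fourier f m) * (t m * norm (fourier ?y m))"
      unfolding hy using norm_cauchy_schwarz[of "fourier f m" "t m *\<^sub>R fourier ?y m"] by (simp add: t_def)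
    also have "\<dots> = (t m * norm (fourier f m)) * norm (fourier ?y m)" by simp
    also have "\<dots> \<le> (1/2) * (t m * norm (fourier f m))\<^sup>2 + (1/2) * (norm (fourier ?y m))\<^sup>2"
      using sum_squares_bound[of "t m * norm (fourier f m)" "norm (fourier ?y m)"] by simp
    also have "(t m * norm (fourier f m))\<^sup>2 \<le> sobolev_weight \<sigma> m * (norm (fourier f m))\<^sup>2"
      unfolding power_mult_distrib by (intro mult_right_mono t) simp
    finally show "fourier f m \<bullet> fourier ?h m \<le> (1/2) * (sobolev_weight \<sigma> m * (norm (fourier f m))\<^sup>2) + (1/2) * (norm (fourier ?y m))\<^sup>2" by simp
  qed
  then show ?thesis unfolding fh yy c2 by simp
qed

lemma sobolev_bessel_summable:
  assumes f: "f \<in> sobolev \<sigma>" and \<sigma>: "0 \<le> \<sigma>"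
  shows "summable (\<lambda>k. lam k powr \<sigma> * (ip f (\<phi> k))\<^sup>2)" "(\<Sum>k. lam k powr \<sigma> * (ip f (\<phi> k))\<^sup>2) \<le> (hnorm \<sigma> f)\<^sup>2"
proof -
  show s: "summable (\<lambda>k. lam k powr \<sigma> * (ip f (\<phi> k))\<^sup>2)"
    by (rule bounded_imp_summable[of _ "(hnorm \<sigma> f)\<^sup>2"])
      (auto intro: order_trans[OF _ sobolev_bessel[OF f \<sigma>, of "Suc _"]] simp: lessThan_Suc_atMost)
  show "(\<Sum>k. lam k powr \<sigma> * (ip f (\<phi> k))\<^sup>2) \<le> (hnorm \<sigma> f)\<^sup>2"
    by (rule suminf_le_const[OF s sobolev_bessel[OF f \<sigma>]])
qed

text \<open>The summability hypothesis is what gives the Hilbert choice in \<open>stokes_pow\<close>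
  a genuine limit to pick; its coefficients and its norm are then determined.\<close>

lemma stokes_pow:
  assumes s: "summable (\<lambda>k. lam k powr (2 * s) * (ip f (\<phi> k))\<^sup>2)"
  shows "stokes_pow \<phi> lam s f \<in> H_space"
    and "ip (stokes_pow \<phi> lam s f) (\<phi> k) = lam k powr s * ip f (\<phi> k)"
    and "nsq (stokes_pow \<phi> lam s f) = (\<Sum>k. lam k powr (2 * s) * (ip f (\<phi> k))\<^sup>2)"
proof -
  let ?c = "\<lambda>k. lam k powr s * ip f (\<phi> k)"
  have "lam k powr (2 * s) = (lam k powr s)\<^sup>2" for k
    by (simp only: power2_eq_square powr_add[symmetric] mult_2)
  then have c2: "(?c k)\<^sup>2 = lam k powr (2 * s) * (ip f (\<phi> k))\<^sup>2" for k
    by (simp only: power_mult_distrib)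
  have "summable (\<lambda>k. (?c k)\<^sup>2)" unfolding c2 by (rule s)
  then have "\<exists>g. g \<in> H_space \<and> (\<lambda>n. L2norm (\<lambda>x. g x - psum ?c n x)) \<longlonglongrightarrow> 0"
    by (rule psum_converges) blast
  then have G: "stokes_pow \<phi> lam s f \<in> H_space \<and> (\<lambda>n. L2norm (\<lambda>x. stokes_pow \<phi> lam s f x - psum ?c n x)) \<longlonglongrightarrow> 0"
    unfolding stokes_pow_def psum_def by (rule someI_ex)
  then show H: "stokes_pow \<phi> lam s f \<in> H_space" by blast
  show co: "ip (stokes_pow \<phi> lam s f) (\<phi> k) = ?c k" for k
    using G by (intro ip_limit_psum H_space_L2) auto
  show "nsq (stokes_pow \<phi> lam s f) = (\<Sum>k. lam k powr (2 * s) * (ip f (\<phi> k))\<^sup>2)"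
    using nsq_sums[OF H] unfolding co c2 by (rule sums_unique)
qed

end

section \<open>Energy inequality in time\<close>

lemma lebesgue_on_subinterval_integral:
  fixes f :: "real \<Rightarrow> real"
  assumes "a \<le> x" "x \<le> b"
  shows "(LINT \<tau>|lebesgue_on {a..x}. f \<tau>) = (LINT \<tau>|lebesgue_on {a..b}. indicator {a..x} \<tau> * f \<tau>)"
proof -
  have eq: "indicator {a..b} \<tau> *\<^sub>R (indicator {a..x} \<tau> * f \<tau>) = indicator {a..x} \<tau> *\<^sub>R f \<tau>" for \<tau>
    using assms by (auto simp: indicator_def)
  have m: "{c..d::real} \<inter> space lebesgue \<in> sets lebesgue" for c d by simp
  show ?thesis unfolding integral_restrict_space[OF m] eq ..
qed

text \<open>The product rule for absolutely continuous functions in integrated form. The product of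
  the two increments is a double integral over a square; Fubini on the two triangles cut by the
  diagonal gives the two terms of the rule.\<close>

lemma ac_product:
  fixes f g f' g' :: "real \<Rightarrow> real"
  assumes f': "integrable (lebesgue_on {0..t}) f'" and g': "integrable (lebesgue_on {0..t}) g'" and t: "0 \<le> t"
    and f: "\<And>x. x \<in> {0..t} \<Longrightarrow> f x = f 0 + (LINT \<tau>|lebesgue_on {0..x}. f' \<tau>)"
    and g: "\<And>x. x \<in> {0..t} \<Longrightarrow> g x = g 0 + (LINT \<tau>|lebesgue_on {0..x}. g' \<tau>)"
  shows "integrable (lebesgue_on {0..t}) (\<lambda>\<tau>. f' \<tau> * g \<tau> + f \<tau> * g' \<tau>)"
    and "f t * g t = f 0 * g 0 + (LINT \<tau>|lebesgue_on {0..t}. f' \<tau> * g \<tau> + f \<tau> * g' \<tau>)"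
proof -
  let ?M = "lebesgue_on {0..t}"
  interpret finite_measure ?M by (rule finite_measure_lebesgue_on) auto
  interpret P: pair_sigma_finite ?M ?M ..
  have [measurable]: "f' \<in> borel_measurable ?M" "g' \<in> borel_measurable ?M" using f' g' by auto
  have idm [measurable]: "(\<lambda>x. x) \<in> borel_measurable ?M"
    by (intro measurable_restrict_space1 measurable_completion) simp
  have fm: "fst \<in> borel_measurable (?M \<Otimes>\<^sub>M ?M)" "snd \<in> borel_measurable (?M \<Otimes>\<^sub>M ?M)"
    using measurable_compose[OF measurable_fst idm] measurable_compose[OF measurable_snd idm] by simp_all
  define h where "h = (\<lambda>(x, y). f' x * g' y)"
  have hm [measurable]: "h \<in> borel_measurable (?M \<Otimes>\<^sub>M ?M)" unfolding h_def by measurable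
  have hI: "integrable (?M \<Otimes>\<^sub>M ?M) h"
    by (rule P.Fubini_integrable) (use f' g' in \<open>auto simp: h_def abs_mult\<close>)
  \<comment> \<open>The diagonal is assigned to \<open>h1\<close>; \<open>h2\<close> lives strictly
    on the other side.\<close>
  define h1 where "h1 = (\<lambda>z. (if fst z \<le> snd z then 1 else 0) * h z)"
  define h2 where "h2 = (\<lambda>z. (if fst z \<le> snd z then 0 else 1) * h z)"
  have Sm: "{z \<in> space (?M \<Otimes>\<^sub>M ?M). fst z \<le> snd z} \<in> sets (?M \<Otimes>\<^sub>M ?M)"
    by (rule borel_measurable_le[OF fm])
  have hm12: "h1 \<in> borel_measurable (?M \<Otimes>\<^sub>M ?M)" "h2 \<in> borel_measurable (?M \<Otimes>\<^sub>M ?M)"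
    unfolding h1_def h2_def using Sm hm by (auto intro!: borel_measurable_times measurable_If)
  have h1I: "integrable (?M \<Otimes>\<^sub>M ?M) h1" by (rule Bochner_Integration.integrable_bound[OF hI hm12(1)]) (auto simp: h1_def)
  have h2I: "integrable (?M \<Otimes>\<^sub>M ?M) h2" by (rule Bochner_Integration.integrable_bound[OF hI hm12(2)]) (auto simp: h2_def)
  have tot: "(LINT x|?M. f' x) * (LINT y|?M. g' y) = integral\<^sup>L (?M \<Otimes>\<^sub>M ?M) h1 + integral\<^sup>L (?M \<Otimes>\<^sub>M ?M) h2"
  proof -
    have "(LINT x|?M. f' x) * (LINT y|?M. g' y) = integral\<^sup>L (?M \<Otimes>\<^sub>M ?M) h"
      using P.integral_fst'[OF hI] by (simp add: h_def)
    also have "h = (\<lambda>z. h1 z + h2 z)" by (auto simp: h1_def h2_def)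
    finally show ?thesis using h1I h2I by simp
  qed
  define F where "F x = f x - f 0" for x
  define G where "G x = g x - g 0" for x
  have h1c: "case_prod (\<lambda>x y. h1 (x, y)) = h1" "case_prod (\<lambda>x y. h2 (x, y)) = h2" by auto
  have 1: "integrable ?M (\<lambda>y. F y * g' y)" "integral\<^sup>L (?M \<Otimes>\<^sub>M ?M) h1 = (LINT y|?M. F y * g' y)"
  proof -
    have e: "(LINT x|?M. h1 (x, y)) = F y * g' y" if "y \<in> space ?M" for y
    proof -
      have y: "0 \<le> y" "y \<le> t" using that by auto
      have "(LINT x|?M. h1 (x, y)) = (LINT x|?M. (indicator {0..y} x * f' x) * g' y)"
        by (intro Bochner_Integration.integral_cong refl) (auto simp: h1_def h_def indicator_def)
      also have "\<dots> = F y * g' y"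
        using f[of y] y by (simp add: F_def lebesgue_on_subinterval_integral[OF y])
      finally show ?thesis .
    qed
    have "integrable ?M (\<lambda>y. LINT x|?M. h1 (x, y))" using P.integrable_snd[of "\<lambda>x y. h1 (x, y)"] h1I h1c by simp
    then show "integrable ?M (\<lambda>y. F y * g' y)" by (rule iffD1[OF Bochner_Integration.integrable_cong[OF refl e], rotated])
    show "integral\<^sup>L (?M \<Otimes>\<^sub>M ?M) h1 = (LINT y|?M. F y * g' y)"
    proof -
      have "(LINT y|?M. LINT x|?M. h1 (x, y)) = (LINT y|?M. F y * g' y)"
        by (rule Bochner_Integration.integral_cong[OF refl e])
      then show ?thesis using P.integral_snd[of "\<lambda>x y. h1 (x, y)"] h1I unfolding h1c by simp
    qed
  qed
  have 2: "integrable ?M (\<lambda>x. f' x * G x)" "integral\<^sup>L (?M \<Otimes>\<^sub>M ?M) h2 = (LINT x|?M. f' x * G x)"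
  proof -
    have e: "(LINT y|?M. h2 (x, y)) = f' x * G x" if "x \<in> space ?M" for x
    proof -
      have x: "0 \<le> x" "x \<le> t" using that by auto
      \<comment> \<open>The indicator of \<open>{0..x}\<close> includes the diagonal point
        \<open>y = x\<close>, which \<open>h2\<close> omits, so the two integrands agree only almost
        everywhere.\<close>
      have "AE y in lebesgue. y \<noteq> x" by (intro AE_completion AE_lborel_singleton)
      then have ne: "AE y in ?M. y \<noteq> x" by (auto simp: AE_restrict_space_iff elim: eventually_mono)
      have "(LINT y|?M. h2 (x, y)) = (LINT y|?M. f' x * (indicator {0..x} y * g' y))"
      proof (rule integral_cong_AE)
        show "(\<lambda>y. h2 (x, y)) \<in> borel_measurable ?M"
          using hm12(2) that by measurable
        show "(\<lambda>y. f' x * (indicator {0..x} y * g' y)) \<in> borel_measurable ?M"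
          using x by (auto intro!: borel_measurable_times borel_measurable_indicator simp: sets_restrict_space_iff)
        show "AE y in ?M. h2 (x, y) = f' x * (indicator {0..x} y * g' y)"
          using ne AE_space by eventually_elim (auto simp: h2_def h_def indicator_def)
      qed
      also have "\<dots> = f' x * G x"
        using g[of x] x by (simp add: G_def lebesgue_on_subinterval_integral[OF x])
      finally show ?thesis .
    qed
    have "integrable ?M (\<lambda>x. LINT y|?M. h2 (x, y))" using P.integrable_fst'[OF h2I] .
    then show "integrable ?M (\<lambda>x. f' x * G x)" by (rule iffD1[OF Bochner_Integration.integrable_cong[OF refl e], rotated])
    show "integral\<^sup>L (?M \<Otimes>\<^sub>M ?M) h2 = (LINT x|?M. f' x * G x)"
    proof -
      have "(LINT x|?M. LINT y|?M. h2 (x, y)) = (LINT x|?M. f' x * G x)"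
        by (rule Bochner_Integration.integral_cong[OF refl e])
      then show ?thesis using P.integral_fst'[OF h2I] by simp
    qed
  qed
  have eq: "f' \<tau> * g \<tau> + f \<tau> * g' \<tau> = (f' \<tau> * G \<tau> + F \<tau> * g' \<tau>) + (g 0 * f' \<tau> + f 0 * g' \<tau>)" for \<tau>
    by (simp add: F_def G_def algebra_simps)
  show "integrable ?M (\<lambda>\<tau>. f' \<tau> * g \<tau> + f \<tau> * g' \<tau>)"
    unfolding eq using 1(1) 2(1) f' g' by simp
  have "(LINT \<tau>|?M. f' \<tau> * g \<tau> + f \<tau> * g' \<tau>) = (LINT x|?M. f' x) * (LINT y|?M. g' y) + (g 0 * (LINT x|?M. f' x) + f 0 * (LINT x|?M. g' x))"
    unfolding eq tot 1(2) 2(2) using 1(1) 2(1) f' g' by simp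
  moreover have "(LINT x|?M. f' x) = f t - f 0" "(LINT x|?M. g' x) = g t - g 0" using f[of t] g[of t] t by auto
  ultimately show "f t * g t = f 0 * g 0 + (LINT \<tau>|?M. f' \<tau> * g \<tau> + f \<tau> * g' \<tau>)"
    by (simp add: algebra_simps)
qed

lemma ac_exp: "(x::real) \<ge> 0 \<Longrightarrow> exp (- c * x) = exp (- c * 0) + (LINT \<tau>|lebesgue_on {0..x}. - c * exp (- c * \<tau>))"
proof -
  assume x: "x \<ge> 0"
  have hi: "((\<lambda>\<tau>. - c * exp (- c * \<tau>)) has_integral exp (- c * x) - exp (- c * 0)) {0..x}"
    using x by (intro fundamental_theorem_of_calculus[of 0 x "\<lambda>\<tau>. exp (- c * \<tau>)"])
      (auto intro!: derivative_eq_intros simp flip: has_real_derivative_iff_has_vector_derivative)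
  have I: "integrable (lebesgue_on {0..x}) (\<lambda>\<tau>. - c * exp (- c * \<tau>))"
    by (intro continuous_imp_integrable_real continuous_intros)
  have "(LINT \<tau>|lebesgue_on {0..x}. - c * exp (- c * \<tau>)) = integral {0..x} (\<lambda>\<tau>. - c * exp (- c * \<tau>))"
    by (rule lebesgue_integral_eq_integral[OF I]) simp
  then show ?thesis unfolding integral_unique[OF hi] by linarith
qed

lemma AE_lebesgue_on_mono:
  assumes "AE x in lebesgue_on {0..T::real}. P x" "t \<le> T"
  shows "AE x in lebesgue_on {0..t}. P x"
  using assms by (simp add: AE_restrict_space_iff) (auto elim!: eventually_mono)

lemma integrable_exp_mult:
  fixes D :: "real \<Rightarrow> real"
  assumes D: "integrable (lebesgue_on {0..t}) D" and c: "0 \<le> c"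
  shows "integrable (lebesgue_on {0..t}) (\<lambda>\<tau>. exp (- c * \<tau>) * D \<tau>)"
proof (rule Bochner_Integration.integrable_bound[OF D])
  have "continuous_on {0..t} (\<lambda>\<tau>. exp (- c * \<tau>))" by (intro continuous_intros)
  then have "(\<lambda>\<tau>. exp (- c * \<tau>)) \<in> borel_measurable (lebesgue_on {0..t})"
    by (intro continuous_imp_measurable_on_sets_lebesgue) auto
  then show "(\<lambda>\<tau>. exp (- c * \<tau>) * D \<tau>) \<in> borel_measurable (lebesgue_on {0..t})"
    using borel_measurable_integrable[OF D] by (rule borel_measurable_times)
  show "AE \<tau> in lebesgue_on {0..t}. norm (exp (- c * \<tau>) * D \<tau>) \<le> norm (D \<tau>)"
    using AE_space by eventually_elim (use c in \<open>auto simp: abs_mult intro!: mult_left_le_one_le\<close>)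
qed

text \<open>Gronwall's inequality with integrating factor. \<open>S n\<close> times exp(-c \<tau>)
  is the derivative of the n-th partial energy times that factor, which explains the term with
  \<open>c\<close>. The domination by \<open>G\<close> allows the limit under the time integral, and
  \<open>D\<close> is kept on the left because it carries the dissipation.\<close>

lemma energy_inequality:
  fixes w w' :: "nat \<Rightarrow> real \<Rightarrow> real"
  assumes t: "0 \<le> t" "t \<le> T" and c: "0 \<le> c" and a: "0 \<le> a"
    and w': "\<And>k. integrable (lebesgue_on {0..T}) (w' k)"
    and w: "\<And>k x. x \<in> {0..T} \<Longrightarrow> w k x = w k 0 + (LINT \<tau>|lebesgue_on {0..x}. w' k \<tau>)"
    and S: "\<And>n \<tau>. S n \<tau> = (\<Sum>k<n. \<mu> k * (2 * w k \<tau> * w' k \<tau> - c * (w k \<tau>)\<^sup>2))"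
    and AE: "AE \<tau> in lebesgue_on {0..T}. (\<forall>n. \<bar>S n \<tau>\<bar> \<le> G \<tau>) \<and> convergent (\<lambda>n. S n \<tau>) \<and> lim (\<lambda>n. S n \<tau>) \<le> a * g \<tau> - D \<tau>"
    and I: "integrable (lebesgue_on {0..T}) G" "integrable (lebesgue_on {0..T}) g" "integrable (lebesgue_on {0..T}) D"
    and g0: "\<And>\<tau>. 0 \<le> g \<tau>"
    and E: "\<And>x. x \<in> {0..T} \<Longrightarrow> (\<lambda>k. \<mu> k * (w k x)\<^sup>2) sums E x"
  shows "exp (- c * t) * E t + (LINT \<tau>|lebesgue_on {0..t}. exp (- c * \<tau>) * D \<tau>) \<le> E 0 + a * (LINT \<tau>|lebesgue_on {0..t}. g \<tau>)"
proof -
  let ?M = "lebesgue_on {0..t}" and ?e = "\<lambda>\<tau>. exp (- c * \<tau>)"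
  have sub: "integrable ?M h" if "integrable (lebesgue_on {0..T}) h" for h :: "real \<Rightarrow> real"
    using integrable_subinterval[OF that, of 0 t] t by simp
  note AE' = AE_lebesgue_on_mono[OF AE t(2)]
  have w'I: "integrable ?M (w' k)" for k by (rule sub[OF w'])
  have wt: "w k x = w k 0 + (LINT \<tau>|lebesgue_on {0..x}. w' k \<tau>)" if "x \<in> {0..t}" for k x
    using w[of x k] t that by auto
  have sq: "integrable (lebesgue_on {0..x}) (\<lambda>\<tau>. w' k \<tau> * w k \<tau> + w k \<tau> * w' k \<tau>)"
    "w k x * w k x = w k 0 * w k 0 + (LINT \<tau>|lebesgue_on {0..x}. w' k \<tau> * w k \<tau> + w k \<tau> * w' k \<tau>)" if x: "x \<in> {0..t}" for k x
  proof -
    have i: "integrable (lebesgue_on {0..x}) (w' k)" using integrable_subinterval[OF w', of 0 x] x t by simp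
    have ww: "w k y = w k 0 + (LINT \<tau>|lebesgue_on {0..y}. w' k \<tau>)" if "y \<in> {0..x}" for y
      using wt[of y k] x that by auto
    have x0: "0 \<le> x" using x by simp
    show "integrable (lebesgue_on {0..x}) (\<lambda>\<tau>. w' k \<tau> * w k \<tau> + w k \<tau> * w' k \<tau>)"
      by (rule ac_product(1)[OF i i x0 ww ww])
    show "w k x * w k x = w k 0 * w k 0 + (LINT \<tau>|lebesgue_on {0..x}. w' k \<tau> * w k \<tau> + w k \<tau> * w' k \<tau>)"
      by (rule ac_product(2)[OF i i x0 ww ww])
  qed
  have tt: "t \<in> {0..t}" using t by simp
  have eI: "integrable ?M (\<lambda>\<tau>. - c * ?e \<tau>)" by (intro continuous_imp_integrable_real continuous_intros)
  have ee: "?e x = ?e 0 + (LINT \<tau>|lebesgue_on {0..x}. - c * ?e \<tau>)" if "x \<in> {0..t}" for x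
    using ac_exp[of x c] that by simp
  \<comment> \<open>Second use of the product rule, now for the exponential and the square of
    \<open>w k\<close>, whose own integrated derivative is \<open>sq\<close>.\<close>
  have P: "integrable ?M (\<lambda>\<tau>. (- c * ?e \<tau>) * (w k \<tau> * w k \<tau>) + ?e \<tau> * (w' k \<tau> * w k \<tau> + w k \<tau> * w' k \<tau>))"
    "?e t * (w k t * w k t) = ?e 0 * (w k 0 * w k 0) + (LINT \<tau>|?M. (- c * ?e \<tau>) * (w k \<tau> * w k \<tau>) + ?e \<tau> * (w' k \<tau> * w k \<tau> + w k \<tau> * w' k \<tau>))" for k
    by (rule ac_product[where f="?e" and g="\<lambda>x. w k x * w k x", OF eI sq(1)[OF tt] t(1) ee sq(2)], assumption+)+
  have form: "(- c * ?e \<tau>) * (w k \<tau> * w k \<tau>) + ?e \<tau> * (w' k \<tau> * w k \<tau> + w k \<tau> * w' k \<tau>) = ?e \<tau> * (2 * w k \<tau> * w' k \<tau> - c * (w k \<tau>)\<^sup>2)" for k \<tau>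
    by (simp add: algebra_simps power2_eq_square)
  note P = P[unfolded form]
  have SI: "integrable ?M (\<lambda>\<tau>. ?e \<tau> * S n \<tau>)"
    and SE: "(\<Sum>k<n. \<mu> k * (?e t * (w k t)\<^sup>2)) = (\<Sum>k<n. \<mu> k * (w k 0)\<^sup>2) + (LINT \<tau>|?M. ?e \<tau> * S n \<tau>)" for n
  proof -
    have eq: "?e \<tau> * S n \<tau> = (\<Sum>k<n. \<mu> k * (?e \<tau> * (2 * w k \<tau> * w' k \<tau> - c * (w k \<tau>)\<^sup>2)))" for \<tau>
      unfolding S sum_distrib_left by (intro sum.cong refl) (simp only: mult.left_commute)
    show "integrable ?M (\<lambda>\<tau>. ?e \<tau> * S n \<tau>)"
      unfolding eq by (intro Bochner_Integration.integrable_sum integrable_mult_right P(1))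
    have "(LINT \<tau>|?M. ?e \<tau> * S n \<tau>) = (\<Sum>k<n. \<mu> k * (LINT \<tau>|?M. ?e \<tau> * (2 * w k \<tau> * w' k \<tau> - c * (w k \<tau>)\<^sup>2)))"
      unfolding eq using P(1) by (subst Bochner_Integration.integral_sum) auto
    moreover have "?e t * (w k t)\<^sup>2 = (w k 0)\<^sup>2 + (LINT \<tau>|?M. ?e \<tau> * (2 * w k \<tau> * w' k \<tau> - c * (w k \<tau>)\<^sup>2))" for k
      using P(2)[of k] by (simp add: power2_eq_square)
    ultimately show "(\<Sum>k<n. \<mu> k * (?e t * (w k t)\<^sup>2)) = (\<Sum>k<n. \<mu> k * (w k 0)\<^sup>2) + (LINT \<tau>|?M. ?e \<tau> * S n \<tau>)"
      by (simp only: distrib_left sum.distrib)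
  qed
  define L where "L \<tau> = lim (\<lambda>n. ?e \<tau> * S n \<tau>)" for \<tau>
  have Lm: "L \<in> borel_measurable ?M" unfolding L_def by (intro borel_measurable_lim_metric borel_measurable_integrable SI)
  have el: "?e \<tau> \<le> 1" if "\<tau> \<in> {0..t}" for \<tau> using that c by simp
  have LT: "AE \<tau> in ?M. (\<lambda>n. ?e \<tau> * S n \<tau>) \<longlonglongrightarrow> L \<tau>"
    and LE: "AE \<tau> in ?M. L \<tau> \<le> a * g \<tau> - ?e \<tau> * D \<tau>"
    and dom: "AE \<tau> in ?M. norm (?e \<tau> * S n \<tau>) \<le> G \<tau>" for n
  proof -
    have conv: "(\<lambda>n. ?e \<tau> * S n \<tau>) \<longlonglongrightarrow> ?e \<tau> * lim (\<lambda>n. S n \<tau>)" if "convergent (\<lambda>n. S n \<tau>)" for \<tau>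
      using that by (intro tendsto_mult_left) (simp add: convergent_LIMSEQ_iff)
    then have Lc: "L \<tau> = ?e \<tau> * lim (\<lambda>n. S n \<tau>)" if "convergent (\<lambda>n. S n \<tau>)" for \<tau>
      unfolding L_def using that by (intro limI)
    show "AE \<tau> in ?M. (\<lambda>n. ?e \<tau> * S n \<tau>) \<longlonglongrightarrow> L \<tau>"
      using AE' by eventually_elim (use Lc conv in simp)
    show "AE \<tau> in ?M. L \<tau> \<le> a * g \<tau> - ?e \<tau> * D \<tau>"
      using AE' AE_space
    proof eventually_elim
      case (elim \<tau>)
      have "L \<tau> \<le> ?e \<tau> * (a * g \<tau> - D \<tau>)" using elim Lc[of \<tau>] by simp
      \<comment> \<open>The factor is dropped from the nonnegative forcing only; on \<open>D\<close>
        it has to stay, as no sign of \<open>D\<close> is assumed.\<close>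
      moreover have "?e \<tau> * (a * g \<tau>) \<le> 1 * (a * g \<tau>)"
        using elim el[of \<tau>] a g0[of \<tau>] by (intro mult_right_mono) auto
      ultimately show ?case by (simp add: right_diff_distrib)
    qed
    show "AE \<tau> in ?M. norm (?e \<tau> * S n \<tau>) \<le> G \<tau>"
      using AE' AE_space
    proof eventually_elim
      case (elim \<tau>)
      have "?e \<tau> * \<bar>S n \<tau>\<bar> \<le> 1 * G \<tau>"
        using elim el[of \<tau>] by (intro mult_mono) auto
      then show ?case by (simp add: abs_mult)
    qed
  qed
  note dc = Lm borel_measurable_integrable[OF SI] sub[OF I(1)] LT dom
  have lim: "(\<lambda>n. LINT \<tau>|?M. ?e \<tau> * S n \<tau>) \<longlonglongrightarrow> (LINT \<tau>|?M. L \<tau>)" by (rule integral_dominated_convergence[OF dc])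
  have LI: "integrable ?M L" by (rule integrable_dominated_convergence[OF dc])
  have "(\<lambda>n. \<Sum>k<n. \<mu> k * (?e t * (w k t)\<^sup>2)) \<longlonglongrightarrow> ?e t * E t"
    using sums_mult[OF E[of t], of "?e t"] t by (simp add: sums_def mult.left_commute)
  moreover have "(\<lambda>n. (\<Sum>k<n. \<mu> k * (w k 0)\<^sup>2) + (LINT \<tau>|?M. ?e \<tau> * S n \<tau>)) \<longlonglongrightarrow> E 0 + (LINT \<tau>|?M. L \<tau>)"
    using E[of 0] t lim by (intro tendsto_add) (auto simp: sums_def)
  ultimately have id: "?e t * E t = E 0 + (LINT \<tau>|?M. L \<tau>)"
    unfolding SE using LIMSEQ_unique by blast
  have DI: "integrable ?M (\<lambda>\<tau>. ?e \<tau> * D \<tau>)"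
    by (rule integrable_exp_mult[OF sub[OF I(3)] c])
  have gI: "integrable ?M (\<lambda>\<tau>. a * g \<tau>)" using sub[OF I(2)] by simp
  have "(LINT \<tau>|?M. L \<tau>) \<le> (LINT \<tau>|?M. a * g \<tau> - ?e \<tau> * D \<tau>)"
    by (rule integral_mono_AE[OF LI _ LE]) (intro Bochner_Integration.integrable_diff gI DI)
  also have "\<dots> = a * (LINT \<tau>|?M. g \<tau>) - (LINT \<tau>|?M. ?e \<tau> * D \<tau>)"
    using Bochner_Integration.integral_diff[OF gI DI] by simp
  finally show ?thesis using id by simp
qed

text \<open>Compactness of [0, T] by bisection: continuity bounds the norm near each point, and
  bounds on adjacent intervals combine.\<close>

lemma hnorm_bounded:
  assumes u: "u \<in> C_time T (sobolev \<sigma>) (hnorm \<sigma>)" and T: "0 \<le> T"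
  obtains M where "\<And>t. t \<in> {0..T} \<Longrightarrow> u t \<in> sobolev \<sigma>" "\<And>t. t \<in> {0..T} \<Longrightarrow> hnorm \<sigma> (u t) \<le> M"
proof -
  have us: "u t \<in> sobolev \<sigma>" if "t \<in> {0..T}" for t using u that by (simp add: C_time_def)
  \<comment> \<open>The name keeps this copy of the interval fixed while the bisection varies the
    endpoints of the other one, which near 0 and T may leave [0, T].\<close>
  define J where "J = {0..T}"
  have "\<exists>M. \<forall>t\<in>{0..T} \<inter> J. hnorm \<sigma> (u t) \<le> M"
    using T
  proof (induction rule: Bolzano)
    case (trans a b c)
    then obtain M N where "\<forall>t\<in>{a..b} \<inter> J. hnorm \<sigma> (u t) \<le> M" "\<forall>t\<in>{b..c} \<inter> J. hnorm \<sigma> (u t) \<le> N" by blast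
    then show ?case by (intro exI[of _ "max M N"]) (force simp: le_max_iff_disj)
  next
    case (local x)
    then have x: "x \<in> {0..T}" by simp
    have "((\<lambda>\<tau>. hnorm \<sigma> (\<lambda>y. u \<tau> y - u x y)) \<longlongrightarrow> 0) (at x within {0..T})"
      using u x by (simp add: C_time_def)
    then have "\<forall>\<^sub>F \<tau> in at x within {0..T}. hnorm \<sigma> (\<lambda>y. u \<tau> y - u x y) < 1"
      by (rule order_tendstoD) simp
    then obtain d where d: "d > 0" "\<And>\<tau>. \<tau> \<in> {0..T} \<Longrightarrow> \<tau> \<noteq> x \<Longrightarrow> dist \<tau> x < d \<Longrightarrow> hnorm \<sigma> (\<lambda>y. u \<tau> y - u x y) < 1"
      unfolding eventually_at by auto
    \<comment> \<open>From \<open>sobolev_diff\<close>, applied to the increment, of norm below 1,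
      and the negative of \<open>u x\<close>.\<close>
    have b: "hnorm \<sigma> (u \<tau>) \<le> sqrt (2 + 2 * (hnorm \<sigma> (u x))\<^sup>2)" if \<tau>: "\<tau> \<in> {0..T}" "dist \<tau> x < d" for \<tau>
    proof (cases "\<tau> = x")
      case True
      have "(hnorm \<sigma> (u x))\<^sup>2 \<le> 2 + 2 * (hnorm \<sigma> (u x))\<^sup>2" using zero_le_power2[of "hnorm \<sigma> (u x)"] by linarith
      then show ?thesis unfolding True by (rule real_le_rsqrt)
    next
      case False
      have neg: "fourier (\<lambda>y. - u x y) k = - fourier (u x) k" for k using fourier_scaleR[of "- 1" "u x" k] by simp
      have m: "(\<lambda>y. - u x y) \<in> sobolev \<sigma>" "hnorm \<sigma> (\<lambda>y. - u x y) = hnorm \<sigma> (u x)"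
        using us[OF x] by (simp_all add: sobolev_def hnorm_def neg L2_uminus)
      have "(hnorm \<sigma> (\<lambda>y. (u \<tau> y - u x y) - (- u x y)))\<^sup>2 \<le> 2 * (hnorm \<sigma> (\<lambda>y. u \<tau> y - u x y))\<^sup>2 + 2 * (hnorm \<sigma> (\<lambda>y. - u x y))\<^sup>2"
        by (intro sobolev_diff(2) sobolev_diff(1) us x \<tau> m)
      moreover have "(hnorm \<sigma> (\<lambda>y. u \<tau> y - u x y))\<^sup>2 \<le> 1"
        using d(2)[OF \<tau>(1) False \<tau>(2)] by (intro power_le_one) auto
      ultimately show ?thesis by (intro real_le_rsqrt) (simp add: m)
    qed
    then show ?case using d(1)
      by (intro exI[of _ d] conjI allI impI exI[of _ "sqrt (2 + 2 * (hnorm \<sigma> (u x))\<^sup>2)"] ballI b) (auto simp: dist_real_def J_def)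
  qed
  then show thesis using that[OF us] unfolding J_def by blast
qed

section \<open>The error of the Voigt regularisation\<close>

lemma H_space_diff: "f \<in> H_space \<Longrightarrow> g \<in> H_space \<Longrightarrow> (\<lambda>x. f x - g x) \<in> H_space"
  using H_space_add[of f "\<lambda>x. (- 1) *\<^sub>R g x"] H_space_scaleR[of g "- 1"] by simp

text \<open>\<open>u\<close> is estimated pointwise, so its derivatives do not enter; the two
  remaining factors are separated by Young's inequality.\<close>

lemma trilinear_bound:
  assumes a: "a \<in> L2" and b: "b \<in> sobolev 1" and u: "u \<in> L2" and adv: "advection a b \<in> L2"
    and B: "\<And>j. AE x in torus. \<bar>u x $ j\<bar> \<le> B" and \<nu>: "\<nu> > 0"
  shows "\<bar>ip (advection a b) u\<bar> \<le> \<nu> / 2 * gsq b + 9 * B\<^sup>2 / (2 * \<nu>) * nsq a"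
proof -
  have wL: "weak_pd j b \<in> L2" for j by (rule weak_pd(1)[OF b])
  have sqI: "integrable torus (\<lambda>x. (norm (a x))\<^sup>2)" "integrable torus (\<lambda>x. (norm (weak_pd j b x))\<^sup>2)" for j
    using a wL by (auto simp: L2_def)
  let ?R = "\<lambda>x. \<nu> / 2 * (\<Sum>j\<in>UNIV. (norm (weak_pd j b x))\<^sup>2) + 9 * B\<^sup>2 / (2 * \<nu>) * (norm (a x))\<^sup>2"
  have RI: "integrable torus ?R" using sqI by auto
  have "AE x in torus. \<forall>j. \<bar>u x $ j\<bar> \<le> B" using B by (simp add: AE_all_countable)
  then have "AE x in torus. norm (advection a b x \<bullet> u x) \<le> ?R x"
  proof eventually_elim
    case (elim x)
    have "norm (u x) \<le> (\<Sum>i\<in>UNIV. \<bar>u x $ i\<bar>)" by (rule norm_le_l1_cart)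
    also have "\<dots> \<le> (\<Sum>i\<in>(UNIV::3 set). B)" using elim by (intro sum_mono) auto
    finally have ub: "norm (u x) \<le> 3 * B" by simp
    \<comment> \<open>The square of \<nu> q - 3 B p is nonnegative. Only \<nu>/2 is spent on the
      gradient, so that after doubling half of the dissipation survives; the bound
      \<open>3 * B\<close> for |u| adds three components.\<close>
    have yg: "p * q * v \<le> \<nu> / 2 * q\<^sup>2 + 9 * B\<^sup>2 / (2 * \<nu>) * p\<^sup>2" if "0 \<le> p" "0 \<le> q" "v \<le> 3 * B" for p q v :: real
    proof -
      have "p * q * v \<le> p * q * (3 * B)" using that by (intro mult_left_mono) auto
      also have "\<dots> \<le> \<nu> / 2 * q\<^sup>2 + 9 * B\<^sup>2 / (2 * \<nu>) * p\<^sup>2"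
      proof -
        have "0 \<le> (\<nu> * q - 3 * B * p)\<^sup>2 / (2 * \<nu>)" using \<nu> by simp
        also have "\<dots> = \<nu> / 2 * q\<^sup>2 + 9 * B\<^sup>2 / (2 * \<nu>) * p\<^sup>2 - p * q * (3 * B)"
          using \<nu> by (simp add: power2_eq_square field_simps)
        finally show ?thesis by simp
      qed
      finally show ?thesis .
    qed
    have "norm (advection a b x \<bullet> u x) \<le> (\<Sum>j\<in>UNIV. \<bar>a x $ j\<bar> * norm (weak_pd j b x) * norm (u x))"
      unfolding advection_def inner_sum_left
      by (rule order_trans[OF norm_sum]) (auto intro!: sum_mono simp: abs_mult mult.assoc Cauchy_Schwarz_ineq2 mult_left_mono)
    also have "\<dots> \<le> (\<Sum>j\<in>UNIV. \<nu> / 2 * (norm (weak_pd j b x))\<^sup>2 + 9 * B\<^sup>2 / (2 * \<nu>) * \<bar>a x $ j\<bar>\<^sup>2)"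
      by (intro sum_mono yg ub) auto
    also have "\<dots> = ?R x"
      by (simp add: sum.distrib sum_distrib_left norm_vec_sq[of "a x"])
    finally show ?case .
  qed
  moreover have "integrable torus (\<lambda>x. advection a b x \<bullet> u x)" by (rule ip_integrable[OF adv u])
  ultimately have "norm (ip (advection a b) u) \<le> integral\<^sup>L torus ?R"
    unfolding ip_def using RI by (intro order_trans[OF integral_norm_bound integral_mono_AE]) auto
  also have "\<dots> = \<nu> / 2 * gsq b + 9 * B\<^sup>2 / (2 * \<nu>) * nsq a"
    unfolding gsq_def nsq_def using sqI by simp
  finally show ?thesis by simp
qed

lemma advection_diff_left: "advection (\<lambda>x. u x - v x) b = (\<lambda>x. advection u b x - advection v b x)"
  by (simp add: advection_def fun_eq_iff scaleR_diff_left sum_subtractf)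

text \<open>With \<open>w = u - v\<close>, antisymmetry turns the difference of the two convective terms tested
  against \<open>w\<close> into \<open>- \<langle>(w \<cdot> \<nabla>) w, u\<rangle>\<close>, so that only a bound of \<open>u\<close> itself is needed, not of its gradient.\<close>

lemma convective_difference:
  assumes u: "u \<in> sobolev \<sigma>" "u \<in> H_space" and v: "v \<in> sobolev \<sigma>" "v \<in> H_space" and \<sigma>: "\<sigma> > 3/2"
    and \<nu>: "\<nu> > 0" and M: "hnorm \<sigma> u \<le> M"
  defines "w \<equiv> (\<lambda>x. u x - v x)"
  shows "\<bar>ip (\<lambda>x. advection u u x - advection v v x) w\<bar> \<le> \<nu> / 2 * gsq w + 9 * (Wsum \<sigma> * M\<^sup>2) / (2 * \<nu>) * nsq w"
proof -
  have s1: "f \<in> sobolev 1" if "f \<in> sobolev \<sigma>" for f using sobolev_mono[OF that, of 1] \<sigma> by simp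
  have w: "w \<in> sobolev \<sigma>" "w \<in> H_space" unfolding w_def by (intro sobolev_diff u v H_space_diff)+
  have L: "u \<in> L2" "v \<in> L2" "w \<in> L2" using u v w H_space_L2 by auto
  have adv: "advection a b \<in> L2" if "a \<in> sobolev \<sigma>" "b \<in> sobolev \<sigma>" for a b
    by (rule advection_sobolev(1)[OF that(1) s1[OF that(2)] \<sigma>])
  have anti: "ip (advection a b) c = - ip (advection a c) b"
    if "a \<in> sobolev \<sigma>" "a \<in> H_space" "b \<in> sobolev \<sigma>" "c \<in> sobolev \<sigma>" for a b c
    by (rule advection_antisym[OF that(1) H_space_solenoidal[OF that(2)] \<sigma> s1[OF that(3)] s1[OF that(4)]])
  have diff_right: "ip f w = ip f u - ip f v" if "f \<in> L2" for f
    unfolding w_def using ip_diff_left[OF L(1,2) that] by (simp add: ip_commute[of f])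
  have wu: "ip (advection w u) c = ip (advection u u) c - ip (advection v u) c" if "c \<in> L2" for c
    unfolding w_def advection_diff_left by (intro ip_diff_left adv u v that)
  have "ip (\<lambda>x. advection u u x - advection v v x) w = ip (advection u u) w - ip (advection v v) w"
    by (intro ip_diff_left adv u v L)
  also have "\<dots> = - ip (advection u u) v - ip (advection v v) u"
    using anti[OF u u(1) u(1)] anti[OF v v(1) v(1)] by (simp add: diff_right adv u v)
  also have "\<dots> = - ip (advection w u) v"
    using anti[OF v v(1) u(1)] by (simp add: wu L)
  also have "\<dots> = ip (advection w u) w"
    using anti[OF w u(1) u(1)] by (simp add: diff_right adv w u)
  also have "\<dots> = - ip (advection w w) u" by (rule anti[OF w u(1) w(1)])
  finally have "\<bar>ip (\<lambda>x. advection u u x - advection v v x) w\<bar> = \<bar>ip (advection w w) u\<bar>" by simp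
  also have "\<dots> \<le> \<nu> / 2 * gsq w + 9 * (sqrt (Wsum \<sigma>) * M)\<^sup>2 / (2 * \<nu>) * nsq w"
  proof (rule trilinear_bound[OF L(3) s1[OF w(1)] L(1) adv[OF w(1) w(1)] _ \<nu>])
    have W: "0 \<le> Wsum \<sigma>" unfolding Wsum_def by (intro infsum_nonneg less_imp_le sobolev_weight_pos)
    show "AE x in torus. \<bar>u x $ j\<bar> \<le> sqrt (Wsum \<sigma>) * M" for j
      using sobolev_sup(2)[OF u(1) \<sigma>, of j]
      by eventually_elim (use mult_left_mono[OF M, of "sqrt (Wsum \<sigma>)"] W in simp)
  qed
  also have "(sqrt (Wsum \<sigma>) * M)\<^sup>2 = Wsum \<sigma> * M\<^sup>2"
    using infsum_nonneg[of UNIV "sobolev_weight (- \<sigma>)"] less_imp_le[OF sobolev_weight_pos]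
    by (simp add: power_mult_distrib Wsum_def)
  finally show ?thesis .
qed

context stokes_basis
begin

text \<open>The weights are the factors that multiply the coefficients of the time derivative in
  \<open>nsv_coeff\<close>, which is why this energy is the quantity to differentiate.\<close>

lemma voigt_energy_sums:
  assumes f: "f \<in> H_space" "f \<in> sobolev r" and r: "0 \<le> r"
  shows "(\<lambda>k. (1 + \<alpha> powr (2 * r) * lam k powr r) * (ip f (\<phi> k))\<^sup>2) sums voigt_energy \<phi> lam r \<alpha> f"
proof -
  have s: "summable (\<lambda>k. lam k powr r * (ip f (\<phi> k))\<^sup>2)" by (rule sobolev_bessel_summable[OF f(2) r])
  have "(\<lambda>k. lam k powr r * (ip f (\<phi> k))\<^sup>2) sums (L2norm (stokes_pow \<phi> lam (r / 2) f))\<^sup>2"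
    using stokes_pow(3)[of "r / 2" f] s by (simp add: L2norm_sq summable_sums)
  then have "(\<lambda>k. (ip f (\<phi> k))\<^sup>2 + \<alpha> powr (2 * r) * (lam k powr r * (ip f (\<phi> k))\<^sup>2)) sums voigt_energy \<phi> lam r \<alpha> f"
    unfolding voigt_energy_def by (intro sums_add sums_mult nsq_sums[OF f(1), folded L2norm_sq])
  then show ?thesis by (simp add: algebra_simps)
qed

text \<open>Since \<open>\<phi> k\<close> lies in H, the pairing removes the projections from
  \<open>B_op\<close> and \<open>stokes\<close>.\<close>

lemma nse_coeff:
  assumes eq: "AE x in torus. u' x + B_op u u x + \<nu> *\<^sub>R stokes u x = 0"
    and u': "u' \<in> L2" and u: "u \<in> sobolev 2" and adv: "advection u u \<in> L2"
  shows "ip u' (\<phi> k) + ip (advection u u) (\<phi> k) + \<nu> * (lam k * ip u (\<phi> k)) = 0"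
proof -
  have BL: "B_op u u \<in> L2" unfolding B_op_def by (intro H_space_L2 leray adv)
  note SL = stokes_coeff(1)[OF u]
  have "ip (\<lambda>x. u' x + B_op u u x + \<nu> *\<^sub>R stokes u x) (\<phi> k) = ip (\<lambda>x. 0) (\<phi> k)"
    by (rule ip_cong_AE[OF eq]) (intro L2_add L2_scaleR u' BL SL L2_zero phi_L2)+
  also have "\<dots> = 0" by (simp add: ip_def)
  also have "ip (\<lambda>x. u' x + B_op u u x + \<nu> *\<^sub>R stokes u x) (\<phi> k) = ip u' (\<phi> k) + ip (B_op u u) (\<phi> k) + \<nu> * ip (stokes u) (\<phi> k)"
    by (simp add: ip_add_left L2_add L2_scaleR u' BL SL phi_L2 ip_scaleR_left)
  finally show ?thesis by (simp add: B_op_def ip_leray_phi adv stokes_coeff(2)[OF u])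
qed

text \<open>The Voigt term joins the time derivative, so \<open>nse_coeff\<close> applies with their
  sum in the place of \<open>u'\<close>.\<close>

lemma nsv_coeff:
  assumes eq: "AE x in torus. u' x + A *\<^sub>R stokes_pow \<phi> lam r u' x + B_op u u x + \<nu> *\<^sub>R stokes u x = 0"
    and u': "u' \<in> sobolev (2 * r)" and r: "0 \<le> r" and u: "u \<in> sobolev 2" and adv: "advection u u \<in> L2"
  shows "(1 + A * lam k powr r) * ip u' (\<phi> k) + ip (advection u u) (\<phi> k) + \<nu> * (lam k * ip u (\<phi> k)) = 0"
proof -
  note u'L = sobolev_L2[OF u']
  have "summable (\<lambda>k. lam k powr (2 * r) * (ip u' (\<phi> k))\<^sup>2)" using r by (intro sobolev_bessel_summable u') simp
  note P = stokes_pow[OF this]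
  have PL: "(\<lambda>x. A *\<^sub>R stokes_pow \<phi> lam r u' x) \<in> L2" by (intro L2_scaleR H_space_L2 P)
  have "AE x in torus. (u' x + A *\<^sub>R stokes_pow \<phi> lam r u' x) + B_op u u x + \<nu> *\<^sub>R stokes u x = 0"
    using eq by simp
  from nse_coeff[OF this L2_add[OF u'L PL] u adv, of k]
  show ?thesis by (simp add: ip_add_left u'L PL phi_L2 ip_scaleR_left P(2) algebra_simps)
qed

text \<open>The equation trades the time derivative for \<open>B(u, u)\<close> and \<open>A u\<close>, both of which lie in \<open>H\<^sup>r\<close>
  for almost every time because \<open>s > 1\<close>.\<close>

lemma time_derivative_Hr:
  assumes eq: "\<And>k. ip u' (\<phi> k) + ip (advection u u) (\<phi> k) + \<nu> * (lam k * ip u (\<phi> k)) = 0"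
    and u: "u \<in> sobolev (r + s + 1)" and r: "0 \<le> r" "r \<le> 1" and s: "s > 1" and M: "hnorm (r + s) u \<le> M"
  shows "summable (\<lambda>k. lam k powr r * (ip u' (\<phi> k))\<^sup>2)"
    and "(\<Sum>k. lam k powr r * (ip u' (\<phi> k))\<^sup>2) \<le> (12 * Wsum (s + 1) * M\<^sup>2 + 2 * \<nu>\<^sup>2) * (hnorm (r + s + 1) u)\<^sup>2"
proof -
  have W: "0 \<le> Wsum (s + 1)" unfolding Wsum_def by (intro infsum_nonneg less_imp_le sobolev_weight_pos)
  have us: "u \<in> sobolev (r + 1)" "u \<in> sobolev (r + s)" "u \<in> sobolev (r + 2)"
    using s by (auto intro!: sobolev_mono[OF u])
  \<comment> \<open>The transporting \<open>u\<close> takes the top norm, which is only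
    square-integrable in time, and the differentiated \<open>u\<close> is measured in H^(r+1), where
    \<open>M\<close> bounds it because s > 1. The estimate remains quadratic in the top norm and
    hence integrable in time.\<close>
  have \<tau>: "(r + s + 1) - r > 3/2" using s by simp
  note adv = advection_Hr[OF r \<tau> u us(1)]
  have "hnorm (r + 1) u \<le> M" using hnorm_mono[OF us(2), of "r + 1"] s M by simp
  then have "(hnorm (r + 1) u)\<^sup>2 \<le> M\<^sup>2" by (intro power_mono) auto
  then have "6 * Wsum (s + 1) * (hnorm (r + s + 1) u)\<^sup>2 * (hnorm (r + 1) u)\<^sup>2 \<le> 6 * Wsum (s + 1) * (hnorm (r + s + 1) u)\<^sup>2 * M\<^sup>2"
    using W by (intro mult_left_mono) auto
  then have a: "(hnorm r (advection u u))\<^sup>2 \<le> 6 * Wsum (s + 1) * M\<^sup>2 * (hnorm (r + s + 1) u)\<^sup>2"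
    using adv(2) by (simp add: mult_ac)
  have h2: "(hnorm (r + 2) u)\<^sup>2 \<le> (hnorm (r + s + 1) u)\<^sup>2"
    using s by (intro power_mono hnorm_mono[OF u]) auto
  have term_le: "lam k powr r * (ip u' (\<phi> k))\<^sup>2 \<le> 2 * (lam k powr r * (ip (advection u u) (\<phi> k))\<^sup>2) + 2 * \<nu>\<^sup>2 * (lam k powr (r + 2) * (ip u (\<phi> k))\<^sup>2)" for k
  proof -
    have l: "lam k powr (r + 2) = lam k powr r * (lam k)\<^sup>2" using lam_nonneg[of k] by (simp add: powr_add)
    have e: "ip u' (\<phi> k) = - (ip (advection u u) (\<phi> k) + \<nu> * (lam k * ip u (\<phi> k)))" using eq[of k] by simp
    have "(ip u' (\<phi> k))\<^sup>2 \<le> 2 * (ip (advection u u) (\<phi> k))\<^sup>2 + 2 * (\<nu> * (lam k * ip u (\<phi> k)))\<^sup>2"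
      unfolding e power2_minus power2_sum
      using sum_squares_bound[of "ip (advection u u) (\<phi> k)" "\<nu> * (lam k * ip u (\<phi> k))"] by linarith
    then have "lam k powr r * (ip u' (\<phi> k))\<^sup>2 \<le> lam k powr r * (2 * (ip (advection u u) (\<phi> k))\<^sup>2 + 2 * (\<nu> * (lam k * ip u (\<phi> k)))\<^sup>2)"
      by (intro mult_left_mono) auto
    then show ?thesis unfolding l by (simp add: power_mult_distrib algebra_simps)
  qed
  have B: "(\<Sum>k<n. lam k powr r * (ip u' (\<phi> k))\<^sup>2) \<le> (12 * Wsum (s + 1) * M\<^sup>2 + 2 * \<nu>\<^sup>2) * (hnorm (r + s + 1) u)\<^sup>2" for n
  proof -
    have "(\<Sum>k<n. lam k powr r * (ip u' (\<phi> k))\<^sup>2) \<le> 2 * (\<Sum>k<n. lam k powr r * (ip (advection u u) (\<phi> k))\<^sup>2) + 2 * \<nu>\<^sup>2 * (\<Sum>k<n. lam k powr (r + 2) * (ip u (\<phi> k))\<^sup>2)"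
      unfolding sum_distrib_left sum.distrib[symmetric] by (intro sum_mono term_le)
    also have "\<dots> \<le> 2 * (6 * Wsum (s + 1) * M\<^sup>2 * (hnorm (r + s + 1) u)\<^sup>2) + 2 * \<nu>\<^sup>2 * (hnorm (r + s + 1) u)\<^sup>2"
      using order_trans[OF sobolev_bessel[OF adv(1) r(1), of n] a] order_trans[OF sobolev_bessel[OF us(3), of n] h2] r
      by (intro add_mono mult_left_mono) auto
    finally show ?thesis by (simp add: algebra_simps)
  qed
  show sm: "summable (\<lambda>k. lam k powr r * (ip u' (\<phi> k))\<^sup>2)"
    by (rule bounded_imp_summable[of _ "(12 * Wsum (s + 1) * M\<^sup>2 + 2 * \<nu>\<^sup>2) * (hnorm (r + s + 1) u)\<^sup>2"])
      (use B[of "Suc _"] in \<open>simp_all add: lessThan_Suc_atMost\<close>)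
  show "(\<Sum>k. lam k powr r * (ip u' (\<phi> k))\<^sup>2) \<le> (12 * Wsum (s + 1) * M\<^sup>2 + 2 * \<nu>\<^sup>2) * (hnorm (r + s + 1) u)\<^sup>2"
    by (rule suminf_le_const[OF sm B])
qed

end

text \<open>The energy identity at one time, in coefficients: \<open>l\<close> is lam^r,
  \<open>lm\<close> is lam, \<open>p\<close> belongs to \<partial>_t u, \<open>w\<close> and
  \<open>d\<close> to the error and its time derivative, \<open>N\<close> to the difference of the
  convective terms. \<open>d\<close> occurs only in the product with \<open>\<mu>\<close> that
  \<open>rel\<close> evaluates, so no bound on \<open>d\<close> is involved.\<close>

lemma galerkin_limit:
  fixes l lm p d w N \<mu> :: "nat \<Rightarrow> real"
  assumes l: "\<And>k. 0 \<le> l k" and lm: "\<And>k. 0 \<le> lm k"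
    and X: "(\<lambda>k. l k * (p k)\<^sup>2) sums X" and Y: "(\<lambda>k. l k * (w k)\<^sup>2) sums Y"
    and Z: "(\<lambda>k. (w k)\<^sup>2) sums Z" and Q: "(\<lambda>k. lm k * (w k)\<^sup>2) sums Q" and V: "(\<lambda>k. N k * w k) sums V"
    and NB: "\<And>n. (\<Sum>k<n. (N k)\<^sup>2) \<le> NN" and VB: "2 * \<bar>V\<bar> \<le> \<nu> * Q + \<kappa> * Z"
    and A: "0 \<le> A" and T: "0 < T" and \<nu>: "0 < \<nu>" and \<kappa>: "0 \<le> \<kappa>"
    and \<mu>: "\<And>k. \<mu> k = 1 + A * l k" and rel: "\<And>k. \<mu> k * d k = A * l k * p k - N k - \<nu> * lm k * w k"
    and c: "c = \<kappa> + 1 / T"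
    and S: "\<And>n. S n = (\<Sum>k<n. \<mu> k * (2 * w k * d k - c * (w k)\<^sup>2))"
  shows "\<bar>S n\<bar> \<le> A * (X + Y) + (NN + Z) + 2 * \<nu> * Q + c * (Z + A * Y)"
    and "convergent S" and "lim S \<le> A * T * X - \<nu> * Q"
proof -
  have c0: "0 \<le> c" using \<kappa> T by (simp add: c)
  have lpw: "2 * \<bar>l k * p k * w k\<bar> \<le> l k * (p k)\<^sup>2 + l k * (w k)\<^sup>2" for k
  proof -
    have "l k * (2 * \<bar>p k\<bar> * \<bar>w k\<bar>) \<le> l k * (\<bar>p k\<bar>\<^sup>2 + \<bar>w k\<bar>\<^sup>2)"
      by (intro mult_left_mono sum_squares_bound l)
    then show ?thesis using l[of k] by (simp add: abs_mult algebra_simps)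
  qed
  have Ps: "summable (\<lambda>k. l k * p k * w k)"
  proof (rule summable_comparison_test')
    show "summable (\<lambda>k. l k * (p k)\<^sup>2 + l k * (w k)\<^sup>2)" using X Y by (intro summable_add) (auto simp: sums_iff)
    show "norm (l k * p k * w k) \<le> l k * (p k)\<^sup>2 + l k * (w k)\<^sup>2" if "0 \<le> k" for k
      using lpw[of k] by simp
  qed
  define P where "P = (\<Sum>k. l k * p k * w k)"
  have Psum: "(\<lambda>k. l k * p k * w k) sums P" using Ps by (simp add: P_def summable_sums)
  \<comment> \<open>Young's inequality with weight \<open>T\<close>: the term in \<open>Y\<close> is
    absorbed by the summand \<open>1 / T\<close> of \<open>c\<close>, and the term in
    \<open>X\<close> produces the factor \<open>T\<close> of the forcing.\<close>
  have P2: "2 * P \<le> T * X + (1 / T) * Y"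
  proof -
    have le: "2 * (l k * p k * w k) \<le> T * (l k * (p k)\<^sup>2) + (1 / T) * (l k * (w k)\<^sup>2)" for k
    proof -
      have "0 \<le> l k * ((T * p k - w k)\<^sup>2 / T)" using T l by simp
      also have "\<dots> = T * (l k * (p k)\<^sup>2) + (1 / T) * (l k * (w k)\<^sup>2) - 2 * (l k * p k * w k)"
        using T by (simp add: power2_eq_square field_simps)
      finally show ?thesis by simp
    qed
    show ?thesis
      by (rule sums_le[OF le sums_mult[OF Psum] sums_add[OF sums_mult[OF X] sums_mult[OF Y]]])
  qed
  have term_eq: "\<mu> k * (2 * w k * d k - c * (w k)\<^sup>2) = 2 * A * (l k * p k * w k) - 2 * (N k * w k) - 2 * \<nu> * (lm k * (w k)\<^sup>2) - c * ((w k)\<^sup>2 + A * (l k * (w k)\<^sup>2))" for k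
  proof -
    have "\<mu> k * (2 * w k * d k - c * (w k)\<^sup>2) = 2 * w k * (\<mu> k * d k) - c * (\<mu> k * (w k)\<^sup>2)" by (simp add: algebra_simps)
    then show ?thesis unfolding rel unfolding \<mu> by (simp add: algebra_simps power2_eq_square)
  qed
  have sm: "(\<lambda>k. \<mu> k * (2 * w k * d k - c * (w k)\<^sup>2)) sums (2 * A * P - 2 * V - 2 * \<nu> * Q - c * (Z + A * Y))"
    unfolding term_eq by (intro sums_diff sums_mult sums_add Psum V Q Z Y)
  then have lims: "S \<longlonglongrightarrow> 2 * A * P - 2 * V - 2 * \<nu> * Q - c * (Z + A * Y)"
    unfolding S[abs_def] by (simp add: sums_def)
  then show "convergent S" by (rule convergentI)
  have Y0: "0 \<le> Y" and Z0: "0 \<le> Z" and Q0: "0 \<le> Q"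
    using sums_le[OF _ sums_zero Y] sums_le[OF _ sums_zero Z] sums_le[OF _ sums_zero Q] l lm by auto
  have "lim S = 2 * A * P - 2 * V - 2 * \<nu> * Q - c * (Z + A * Y)" using lims by (rule limI)
  moreover have "A * (2 * P) \<le> A * (T * X + (1 / T) * Y)" by (intro mult_left_mono P2 A)
  moreover have "c * Z = \<kappa> * Z + (1 / T) * Z" "c * (A * Y) = \<kappa> * (A * Y) + A * ((1 / T) * Y)"
    by (simp_all add: c algebra_simps)
  \<comment> \<open>\<open>c\<close> multiplies all of Z + A Y, while \<kappa> is spent against
    \<open>Z\<close> and \<open>1 / T\<close> against \<open>A * Y\<close>; the two surplus products
    are dropped by their sign.\<close>
  moreover have "0 \<le> (1 / T) * Z" "0 \<le> \<kappa> * (A * Y)" using T Z0 Y0 A \<kappa> by simp_all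
  moreover have "- V \<le> \<bar>V\<bar>" by simp
  ultimately show "lim S \<le> A * T * X - \<nu> * Q"
    using VB by (simp only: distrib_left mult.assoc)
  have part: "(\<Sum>k<n. f k) \<le> F" if "f sums F" "\<And>k. 0 \<le> f k" for f and F :: real
    using sum_le_suminf[of f "{..<n}"] that by (simp add: sums_iff)
  have b1: "\<bar>\<Sum>k<n. 2 * A * (l k * p k * w k)\<bar> \<le> A * (X + Y)"
  proof -
    have "\<bar>\<Sum>k<n. 2 * A * (l k * p k * w k)\<bar> \<le> (\<Sum>k<n. A * (l k * (p k)\<^sup>2 + l k * (w k)\<^sup>2))"
    proof (rule order_trans[OF sum_abs sum_mono])
      fix k
      show "\<bar>2 * A * (l k * p k * w k)\<bar> \<le> A * (l k * (p k)\<^sup>2 + l k * (w k)\<^sup>2)"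
        using mult_left_mono[OF lpw[of k] A] A by (simp add: abs_mult mult_ac)
    qed
    also have "\<dots> \<le> A * (X + Y)"
      unfolding sum_distrib_left[symmetric] sum.distrib using l by (intro mult_left_mono add_mono part X Y A) auto
    finally show ?thesis .
  qed
  have b2: "\<bar>\<Sum>k<n. 2 * (N k * w k)\<bar> \<le> NN + Z"
  proof -
    have "\<bar>\<Sum>k<n. 2 * (N k * w k)\<bar> \<le> (\<Sum>k<n. (N k)\<^sup>2 + (w k)\<^sup>2)"
    proof (rule order_trans[OF sum_abs sum_mono])
      fix k
      show "\<bar>2 * (N k * w k)\<bar> \<le> (N k)\<^sup>2 + (w k)\<^sup>2"
        using sum_squares_bound[of "\<bar>N k\<bar>" "\<bar>w k\<bar>"] by (simp add: abs_mult)
    qed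
    also have "\<dots> \<le> NN + Z" unfolding sum.distrib by (intro add_mono NB part Z) auto
    finally show ?thesis .
  qed
  have b3: "(\<Sum>k<n. 2 * \<nu> * (lm k * (w k)\<^sup>2)) \<le> 2 * \<nu> * Q" "0 \<le> (\<Sum>k<n. 2 * \<nu> * (lm k * (w k)\<^sup>2))"
    unfolding sum_distrib_left[symmetric] using \<nu> lm part[OF Q] by (auto intro!: mult_left_mono mult_nonneg_nonneg sum_nonneg)
  have b4: "(\<Sum>k<n. c * ((w k)\<^sup>2 + A * (l k * (w k)\<^sup>2))) \<le> c * (Z + A * Y)" "0 \<le> (\<Sum>k<n. c * ((w k)\<^sup>2 + A * (l k * (w k)\<^sup>2)))"
    using c0 A l part[OF sums_add[OF Z sums_mult[OF Y, of A]]]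
    by (auto simp flip: sum_distrib_left intro!: mult_left_mono mult_nonneg_nonneg sum_nonneg add_nonneg_nonneg)
  have "S n = (\<Sum>k<n. 2 * A * (l k * p k * w k)) - (\<Sum>k<n. 2 * (N k * w k)) - (\<Sum>k<n. 2 * \<nu> * (lm k * (w k)\<^sup>2)) - (\<Sum>k<n. c * ((w k)\<^sup>2 + A * (l k * (w k)\<^sup>2)))"
    unfolding S term_eq sum_subtractf ..
  then show "\<bar>S n\<bar> \<le> A * (X + Y) + (NN + Z) + 2 * \<nu> * Q + c * (Z + A * Y)"
    using b1 b2 b3 b4 by linarith
qed

text \<open>Completeness of Lebesgue measure. Norms at time t coincide with series of measurable
  coefficients only for almost every t, and this carries measurability over to them.\<close>

lemma borel_measurable_lebesgue_on_AE:
  fixes f g :: "real \<Rightarrow> real"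
  assumes f: "f \<in> borel_measurable (lebesgue_on {a..b})" and e: "AE x in lebesgue_on {a..b}. f x = g x"
  shows "g \<in> borel_measurable (lebesgue_on {a..b})"
proof -
  have m: "{a..b} \<inter> space lebesgue \<in> sets lebesgue" by simp
  have "(\<lambda>x. f x * indicator {a..b} x) \<in> borel_measurable lebesgue"
    using f borel_measurable_restrict_space_iff[OF m, of f] by (simp add: mult.commute)
  moreover have "AE x in lebesgue. f x * indicator {a..b} x = g x * indicator {a..b} x"
    using e unfolding AE_restrict_space_iff[OF m] by eventually_elim (auto simp: indicator_def)
  ultimately have "(\<lambda>x. g x * indicator {a..b} x) \<in> borel_measurable lebesgue" by (rule borel_measurable_AE)
  then show ?thesis using borel_measurable_restrict_space_iff[OF m, of g] by (simp add: mult.commute)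
qed

lemma nsq_diff_le:
  assumes "f \<in> L2" "g \<in> L2" shows "nsq (\<lambda>x. f x - g x) \<le> 2 * nsq f + 2 * nsq g"
  using sobolev_diff(2)[of f 0 g] assms L2_diff[OF assms]
  by (simp add: L2_sobolev_0[symmetric] hnorm_0 L2norm_sq)

lemma L2_time_H_coeff:
  assumes u: "u' \<in> L2_time T H_space L2norm" and v: "v \<in> L2"
  shows "integrable (lebesgue_on {0..T}) (\<lambda>t. ip (u' t) v)"
proof -
  interpret finite_measure "lebesgue_on {0..T}" by (rule finite_measure_lebesgue_on) auto
  have m: "(\<lambda>t. ip (u' t) v) \<in> borel_measurable (lebesgue_on {0..T})" and H: "AE t in lebesgue_on {0..T}. u' t \<in> H_space"
    and I: "integrable (lebesgue_on {0..T}) (\<lambda>t. (L2norm (u' t))\<^sup>2)"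
    using u v by (auto simp: L2_time_def)
  show ?thesis
  proof (rule Bochner_Integration.integrable_bound[OF _ m])
    show "integrable (lebesgue_on {0..T}) (\<lambda>t. (L2norm (u' t))\<^sup>2 + nsq v)" using I by simp
    show "AE t in lebesgue_on {0..T}. norm (ip (u' t) v) \<le> norm ((L2norm (u' t))\<^sup>2 + nsq v)"
      using H
    proof eventually_elim
      case (elim t)
      have "0 \<le> L2norm (u' t) * L2norm v" by (simp add: L2norm_nsq)
      then have "\<bar>ip (u' t) v\<bar> \<le> (L2norm (u' t))\<^sup>2 + (L2norm v)\<^sup>2"
        using ip_CS[OF H_space_L2[OF elim] v] sum_squares_bound[of "L2norm (u' t)" "L2norm v"] by linarith
      then show ?case by (simp add: L2norm_sq)
    qed
  qed
qed

text \<open>Only the Navier-Stokes solution is fixed here; \<alpha> and the Voigt solution vary over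
  the lemmas, so constants defined in this context are independent of \<alpha>.\<close>

locale nse_nsv = stokes_basis +
  fixes s \<nu> r T :: real and u0 :: field and u u' :: "real \<Rightarrow> field" and M :: real
  assumes s: "s > 1" and \<nu>: "\<nu> > 0" and r: "1 / 2 \<le> r" "r \<le> 1" and T: "0 < T"
    and nse: "nse_strong \<nu> T u0 u u'"
    and uC: "\<And>t. t \<in> {0..T} \<Longrightarrow> u t \<in> sobolev (r + s)"
    and uM: "\<And>t. t \<in> {0..T} \<Longrightarrow> hnorm (r + s) (u t) \<le> M"
    and uL: "u \<in> L2_time T (sobolev (r + s + 1)) (hnorm (r + s + 1))"
begin

definition g :: "real \<Rightarrow> real" where
  "g \<tau> = (L2norm (stokes_pow \<phi> lam (r / 2) (u' \<tau>)))\<^sup>2"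

text \<open>Twice the coefficient of \<open>nsq w\<close> in \<open>convective_difference\<close>,
  plus the \<open>1 / T\<close> that \<open>galerkin_limit\<close> spends on the Voigt term.\<close>

definition growth :: real where
  "growth = 9 * (Wsum (r + s) * M\<^sup>2) / \<nu> + 1 / T"

lemma Wsum_nonneg: "0 \<le> Wsum \<sigma>"
  unfolding Wsum_def by (intro infsum_nonneg less_imp_le sobolev_weight_pos)

lemma growth_nonneg: "0 \<le> growth"
  using \<nu> T Wsum_nonneg by (simp add: growth_def)

lemma sigma: "r + s > 3/2"
  using r s by simp

lemma uH: "t \<in> {0..T} \<Longrightarrow> u t \<in> H_space"
  using nse by (intro V_space_H_space) (auto simp: nse_strong_def C_time_def)

lemma u_deriv: "time_deriv T u u'" and u_eq: "AE t in lebesgue_on {0..T}. AE x in torus.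
        u' t x + B_op (u t) (u t) x + \<nu> *\<^sub>R stokes (u t) x = 0"
  and u_init: "AE x in torus. u 0 x = u0 x"
  using nse by (auto simp: nse_strong_def)

lemma u'_L2_time: "u' \<in> L2_time T H_space L2norm"
  using u_deriv by (simp add: time_deriv_def)

lemma sobolev_sigma: "f \<in> sobolev (r + s + 1) \<Longrightarrow> f \<in> sobolev 2"
  using r s by (auto intro: sobolev_mono)

lemma sobolev_1: "f \<in> sobolev (r + s) \<Longrightarrow> f \<in> sobolev 1"
  using r s by (auto intro: sobolev_mono)

lemma sobolev_r: "f \<in> sobolev (r + s) \<Longrightarrow> f \<in> sobolev r"
  using s by (auto intro: sobolev_mono)

lemma advection_L2: "f \<in> sobolev (r + s) \<Longrightarrow> advection f f \<in> L2"
  by (rule advection_sobolev(1)[OF _ sobolev_1 sigma])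

lemma u_AE: "AE t in lebesgue_on {0..T}. t \<in> {0..T} \<and> u t \<in> sobolev (r + s + 1) \<and> u' t \<in> L2 \<and>
    (\<forall>k. ip (u' t) (\<phi> k) + ip (advection (u t) (u t)) (\<phi> k) + \<nu> * (lam k * ip (u t) (\<phi> k)) = 0)"
proof -
  have 1: "AE t in lebesgue_on {0..T}. u t \<in> sobolev (r + s + 1)" using uL by (simp add: L2_time_def)
  have 2: "AE t in lebesgue_on {0..T}. u' t \<in> H_space" using u'_L2_time by (simp add: L2_time_def)
  have 3: "AE t in lebesgue_on {0..T}. t \<in> {0..T}" using AE_space[of "lebesgue_on {0..T}"] by simp
  from 1 2 3 u_eq show ?thesis
  proof eventually_elim
    case (elim t)
    then show ?case
      using nse_coeff[OF elim(4) H_space_L2[OF elim(2)] sobolev_sigma[OF elim(1)] advection_L2[OF uC[OF elim(3)]]] H_space_L2 by blast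
  qed
qed

lemma g_AE: "AE t in lebesgue_on {0..T}. (\<lambda>k. lam k powr r * (ip (u' t) (\<phi> k))\<^sup>2) sums g t \<and>
    g t \<le> (12 * Wsum (s + 1) * M\<^sup>2 + 2 * \<nu>\<^sup>2) * (hnorm (r + s + 1) (u t))\<^sup>2"
  using u_AE
proof eventually_elim
  case (elim t)
  have r0: "0 \<le> r" using r by simp
  note D = time_derivative_Hr[OF _ _ r0 r(2) s uM, of "u' t" t]
  have sm: "summable (\<lambda>k. lam k powr r * (ip (u' t) (\<phi> k))\<^sup>2)"
    and b: "(\<Sum>k. lam k powr r * (ip (u' t) (\<phi> k))\<^sup>2) \<le> (12 * Wsum (s + 1) * M\<^sup>2 + 2 * \<nu>\<^sup>2) * (hnorm (r + s + 1) (u t))\<^sup>2"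
    using D elim by blast+
  have "g t = (\<Sum>k. lam k powr r * (ip (u' t) (\<phi> k))\<^sup>2)"
    using stokes_pow(3)[of "r / 2" "u' t"] sm by (simp add: g_def L2norm_sq)
  then show ?case using sm b by (simp add: sums_iff)
qed

lemma u'_coeff_integrable: "integrable (lebesgue_on {0..T}) (\<lambda>t. ip (u' t) (\<phi> k))"
  by (rule L2_time_H_coeff[OF u'_L2_time phi_L2])

text \<open>Since a divergent integral would be 0 by convention, this lemma is what makes the
  integral of \<open>g\<close> measure the size of \<partial>_t u. The dominating function is a
  multiple of the squared top Sobolev norm of \<open>u\<close>.\<close>

lemma g_integrable: "integrable (lebesgue_on {0..T}) g"
proof (rule Bochner_Integration.integrable_bound)
  show "integrable (lebesgue_on {0..T}) (\<lambda>t. (12 * Wsum (s + 1) * M\<^sup>2 + 2 * \<nu>\<^sup>2) * (hnorm (r + s + 1) (u t))\<^sup>2)"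
    using uL by (auto simp: L2_time_def)
  show "g \<in> borel_measurable (lebesgue_on {0..T})"
  proof (rule borel_measurable_lebesgue_on_AE)
    show "(\<lambda>t. \<Sum>k. lam k powr r * (ip (u' t) (\<phi> k))\<^sup>2) \<in> borel_measurable (lebesgue_on {0..T})"
      by (intro borel_measurable_suminf borel_measurable_times borel_measurable_power borel_measurable_const
          borel_measurable_integrable u'_coeff_integrable)
    show "AE t in lebesgue_on {0..T}. (\<Sum>k. lam k powr r * (ip (u' t) (\<phi> k))\<^sup>2) = g t"
      using g_AE by eventually_elim (simp add: sums_iff)
  qed
  show "AE t in lebesgue_on {0..T}. norm (g t) \<le> norm ((12 * Wsum (s + 1) * M\<^sup>2 + 2 * \<nu>\<^sup>2) * (hnorm (r + s + 1) (u t))\<^sup>2)"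
    using g_AE
  proof eventually_elim
    case (elim t)
    have "norm (g t) = g t" by (simp add: g_def)
    then show ?case using conjunct2[OF elim] unfolding real_norm_def by linarith
  qed
qed

lemma g_nonneg: "0 \<le> g t"
  by (simp add: g_def)

lemma energy_estimate:
  assumes \<alpha>: "\<alpha> > 0" and nsv: "nsv_solution \<phi> lam r \<nu> \<alpha> T v0 v v'"
    and vC: "v \<in> C_time T (sobolev (r + s)) (hnorm (r + s))"
    and vL: "v \<in> L2_time T (sobolev (r + s + 1)) (hnorm (r + s + 1))"
  shows "integrable (lebesgue_on {0..T}) (\<lambda>t. gsq (\<lambda>x. u t x - v t x))"
    and "t \<in> {0..T} \<Longrightarrow> exp (- growth * t) * voigt_energy \<phi> lam r \<alpha> (\<lambda>x. u t x - v t x)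
        + (LINT \<tau>|lebesgue_on {0..t}. exp (- growth * \<tau>) * (\<nu> * gsq (\<lambda>x. u \<tau> x - v \<tau> x)))
      \<le> voigt_energy \<phi> lam r \<alpha> (\<lambda>x. u 0 x - v 0 x) + \<alpha> powr (2 * r) * T * (LINT \<tau>|lebesgue_on {0..t}. g \<tau>)"
proof -
  let ?M = "lebesgue_on {0..T}"
  interpret fm: finite_measure ?M by (rule finite_measure_lebesgue_on) auto
  define A where "A = \<alpha> powr (2 * r)"
  have A: "0 \<le> A" by (simp add: A_def)
  have T0: "0 \<le> T" using T by simp
  \<comment> \<open>\<open>N\<close> bounds the Voigt solution and may depend on \<alpha>. It enters
    \<open>m\<close>, \<open>NN\<close> and through them the dominating function \<open>G\<close>,
    but neither \<open>growth\<close> nor the resulting inequality.\<close>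
  obtain N where vs: "\<And>t. t \<in> {0..T} \<Longrightarrow> v t \<in> sobolev (r + s)" and vN: "\<And>t. t \<in> {0..T} \<Longrightarrow> hnorm (r + s) (v t) \<le> N"
    by (rule hnorm_bounded[OF vC T0]) blast
  have vH: "v t \<in> H_space" if "t \<in> {0..T}" for t
    using nsv that by (intro V_space_H_space) (auto simp: nsv_solution_def)
  have v_deriv: "time_deriv T v v'" using nsv by (simp add: nsv_solution_def)
  then have v'L: "v' \<in> L2_time T H_space L2norm" by (simp add: time_deriv_def)
  define W where "W t = (\<lambda>x. u t x - v t x)" for t
  define w where "w k t = ip (u t) (\<phi> k) - ip (v t) (\<phi> k)" for k t
  define w' where "w' k t = ip (u' t) (\<phi> k) - ip (v' t) (\<phi> k)" for k t
  have Ws: "W t \<in> sobolev (r + s)" "W t \<in> H_space" and Wn: "(hnorm (r + s) (W t))\<^sup>2 \<le> 2 * M\<^sup>2 + 2 * N\<^sup>2"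
    and wW: "w k t = ip (W t) (\<phi> k)" if t: "t \<in> {0..T}" for t k
  proof -
    show "W t \<in> sobolev (r + s)" "W t \<in> H_space" unfolding W_def by (intro sobolev_diff H_space_diff uC vs uH vH t)+
    have "(hnorm (r + s) (u t))\<^sup>2 \<le> M\<^sup>2" "(hnorm (r + s) (v t))\<^sup>2 \<le> N\<^sup>2"
      using uM[OF t] vN[OF t] by (auto intro!: power_mono)
    then show "(hnorm (r + s) (W t))\<^sup>2 \<le> 2 * M\<^sup>2 + 2 * N\<^sup>2"
      using sobolev_diff(2)[OF uC[OF t] vs[OF t]] by (simp add: W_def)
    show "w k t = ip (W t) (\<phi> k)"
      unfolding w_def W_def by (intro ip_diff_left[symmetric] H_space_L2 uH vH t phi_L2)
  qed
  have v_AE: "AE t in ?M. t \<in> {0..T} \<and> v t \<in> sobolev (r + s + 1) \<and>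
    (\<forall>k. (1 + A * lam k powr r) * ip (v' t) (\<phi> k) + ip (advection (v t) (v t)) (\<phi> k) + \<nu> * (lam k * ip (v t) (\<phi> k)) = 0)"
  proof -
    have 1: "AE t in ?M. v t \<in> sobolev (r + s + 1)" using vL by (simp add: L2_time_def)
    have 2: "AE t in ?M. v' t \<in> sobolev (2 * r)" using nsv by (simp add: nsv_solution_def)
    have 3: "AE t in ?M. t \<in> {0..T}" using AE_space[of ?M] by simp
    have 4: "AE t in ?M. AE x in torus. v' t x + A *\<^sub>R stokes_pow \<phi> lam r (v' t) x
          + B_op (v t) (v t) x + \<nu> *\<^sub>R stokes (v t) x = 0"
      using nsv by (simp add: nsv_solution_def A_def)
    from 1 2 3 4 show ?thesis
    proof eventually_elim
      case (elim t)
      have r0: "0 \<le> r" using r by simp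
      show ?case
        using nsv_coeff[OF elim(4) elim(2) r0 sobolev_sigma[OF elim(1)] advection_L2[OF vs[OF elim(3)]]] elim by blast
    qed
  qed
  have wm: "w k \<in> borel_measurable ?M" for k
  proof -
    have "(\<lambda>t. ip (u t) (\<phi> k)) \<in> borel_measurable ?M" "(\<lambda>t. ip (v t) (\<phi> k)) \<in> borel_measurable ?M"
      using uL vL phi_L2 by (auto simp: L2_time_def)
    then show ?thesis unfolding w_def[abs_def] by measurable
  qed
  have w'I: "integrable ?M (w' k)" for k
    unfolding w'_def[abs_def] by (intro Bochner_Integration.integrable_diff u'_coeff_integrable L2_time_H_coeff[OF v'L phi_L2])
  have wt: "w k x = w k 0 + (LINT \<tau>|lebesgue_on {0..x}. w' k \<tau>)" if x: "x \<in> {0..T}" for k x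
  proof -
    have I: "integrable (lebesgue_on {0..x}) (\<lambda>\<tau>. ip (u' \<tau>) (\<phi> k))" "integrable (lebesgue_on {0..x}) (\<lambda>\<tau>. ip (v' \<tau>) (\<phi> k))"
      using x by (auto intro!: integrable_subinterval[OF u'_coeff_integrable] integrable_subinterval[OF L2_time_H_coeff[OF v'L phi_L2]])
    have "ip (u x) (\<phi> k) = ip (u 0) (\<phi> k) + (LINT \<tau>|lebesgue_on {0..x}. ip (u' \<tau>) (\<phi> k))"
      "ip (v x) (\<phi> k) = ip (v 0) (\<phi> k) + (LINT \<tau>|lebesgue_on {0..x}. ip (v' \<tau>) (\<phi> k))"
      using u_deriv v_deriv phi_L2[of k] x unfolding time_deriv_def by blast+
    then show ?thesis unfolding w_def w'_def Bochner_Integration.integral_diff[OF I] by simp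
  qed
  \<comment> \<open>This holds for almost every time only: \<open>gsq_sums\<close> needs H^2,
    whereas at every single time just H^(r+s) is known.\<close>
  have gW: "AE t in ?M. (\<lambda>k. lam k * (w k t)\<^sup>2) sums gsq (W t)"
    using u_AE v_AE
  proof eventually_elim
    case (elim t)
    have "W t \<in> sobolev 2" unfolding W_def using elim by (intro sobolev_diff sobolev_sigma) auto
    from gsq_sums[OF this Ws(2)] show ?case using elim wW by simp
  qed
  have gWb: "gsq (W t) \<le> 2 * M\<^sup>2 + 2 * N\<^sup>2" "nsq (W t) \<le> 2 * M\<^sup>2 + 2 * N\<^sup>2" if t: "t \<in> {0..T}" for t
  proof -
    have "(hnorm 1 (W t))\<^sup>2 \<le> (hnorm (r + s) (W t))\<^sup>2"
      using r s by (intro power_mono hnorm_mono Ws t) auto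
    then have "nsq (W t) + gsq (W t) \<le> 2 * M\<^sup>2 + 2 * N\<^sup>2"
      using Wn[OF t] hnorm_1_sq[OF sobolev_1[OF Ws(1)[OF t]]] by simp
    then show "gsq (W t) \<le> 2 * M\<^sup>2 + 2 * N\<^sup>2" "nsq (W t) \<le> 2 * M\<^sup>2 + 2 * N\<^sup>2"
      using nsq_nonneg[of "W t"] gsq_nonneg[of "W t"] by linarith+
  qed
  have gWI: "integrable ?M (\<lambda>t. gsq (W t))"
  proof (rule fm.integrable_const_bound)
    show "AE t in ?M. norm (gsq (W t)) \<le> 2 * M\<^sup>2 + 2 * N\<^sup>2"
      using AE_space by eventually_elim (use gWb in simp)
    show "(\<lambda>t. gsq (W t)) \<in> borel_measurable ?M"
    proof (rule borel_measurable_lebesgue_on_AE)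
      show "(\<lambda>t. \<Sum>k. lam k * (w k t)\<^sup>2) \<in> borel_measurable ?M"
        by (intro borel_measurable_suminf borel_measurable_times borel_measurable_power borel_measurable_const wm)
      show "AE t in ?M. (\<Sum>k. lam k * (w k t)\<^sup>2) = gsq (W t)" using gW by eventually_elim (simp add: sums_iff)
    qed
  qed
  then show "integrable ?M (\<lambda>t. gsq (\<lambda>x. u t x - v t x))" by (simp add: W_def)
  define S where "S n \<tau> = (\<Sum>k<n. (1 + A * lam k powr r) * (2 * w k \<tau> * w' k \<tau> - growth * (w k \<tau>)\<^sup>2))" for n \<tau>
  \<comment> \<open>\<open>m\<close> bounds \<open>nsq\<close>, \<open>gsq\<close> and the sum of
    order \<open>r\<close> of the error; \<open>NN\<close> bounds the difference of the convective
    terms, its 6 being the 2 of \<open>nsq_diff_le\<close> times the 3 of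
    \<open>advection_sobolev\<close>.\<close>
  define m where "m = 2 * M\<^sup>2 + 2 * N\<^sup>2"
  define NN where "NN = 6 * Wsum (r + s) * M\<^sup>2 * M\<^sup>2 + 6 * Wsum (r + s) * N\<^sup>2 * N\<^sup>2"
  define G where "G \<tau> = A * (g \<tau> + m) + (NN + m) + 2 * \<nu> * m + growth * (m + A * m)" for \<tau>
  have main: "AE \<tau> in ?M. (\<forall>n. \<bar>S n \<tau>\<bar> \<le> G \<tau>) \<and> convergent (\<lambda>n. S n \<tau>) \<and> lim (\<lambda>n. S n \<tau>) \<le> A * T * g \<tau> - \<nu> * gsq (W \<tau>)"
    using u_AE v_AE gW g_AE
  proof eventually_elim
    case (elim \<tau>)
    then have t: "\<tau> \<in> {0..T}" by simp
    let ?F = "\<lambda>x. advection (u \<tau>) (u \<tau>) x - advection (v \<tau>) (v \<tau>) x"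
    have aL: "advection (u \<tau>) (u \<tau>) \<in> L2" "advection (v \<tau>) (v \<tau>) \<in> L2" by (intro advection_L2 uC vs t)+
    have FL: "?F \<in> L2" by (intro L2_diff aL)
    have co: "ip ?F (\<phi> k) = ip (advection (u \<tau>) (u \<tau>)) (\<phi> k) - ip (advection (v \<tau>) (v \<tau>)) (\<phi> k)" for k
      by (intro ip_diff_left aL phi_L2)
    have r0: "0 \<le> r" using r by simp
    let ?Y = "\<Sum>k. lam k powr r * (w k \<tau>)\<^sup>2"
    have Y: "(\<lambda>k. lam k powr r * (w k \<tau>)\<^sup>2) sums ?Y" "?Y \<le> m"
    proof -
      note sb = sobolev_bessel_summable[OF sobolev_r[OF Ws(1)[OF t]] r0]
      show "(\<lambda>k. lam k powr r * (w k \<tau>)\<^sup>2) sums ?Y" unfolding wW[OF t] using sb(1) by (rule summable_sums)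
      have "(hnorm r (W \<tau>))\<^sup>2 \<le> (hnorm (r + s) (W \<tau>))\<^sup>2" using s by (intro power_mono hnorm_mono Ws t) auto
      then show "?Y \<le> m" unfolding wW[OF t] m_def using sb(2) Wn[OF t] by linarith
    qed
    have Z: "(\<lambda>k. (w k \<tau>)\<^sup>2) sums nsq (W \<tau>)" unfolding wW[OF t] by (rule nsq_sums[OF Ws(2)[OF t]])
    have V: "(\<lambda>k. ip ?F (\<phi> k) * w k \<tau>) sums ip ?F (W \<tau>)" unfolding wW[OF t] by (rule ip_sums[OF FL Ws(2)[OF t]])
    have adv4: "nsq (advection f f) \<le> 3 * Wsum (r + s) * B\<^sup>2 * B\<^sup>2" if f: "f \<in> sobolev (r + s)" "hnorm (r + s) f \<le> B" for f B
    proof -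
      have h: "(hnorm (r + s) f)\<^sup>2 \<le> B\<^sup>2" using f(2) by (intro power_mono) auto
      have "(hnorm 1 f)\<^sup>2 \<le> (hnorm (r + s) f)\<^sup>2" using r s by (intro power_mono hnorm_mono f) auto
      then have q: "gsq f \<le> B\<^sup>2" using h hnorm_1_sq[OF sobolev_1[OF f(1)]] nsq_nonneg[of f] by linarith
      have "nsq (advection f f) \<le> 3 * Wsum (r + s) * (hnorm (r + s) f)\<^sup>2 * gsq f"
        by (rule advection_sobolev(2)[OF f(1) sobolev_1[OF f(1)] sigma])
      also have "\<dots> \<le> 3 * Wsum (r + s) * B\<^sup>2 * B\<^sup>2"
        by (intro mult_mono mult_nonneg_nonneg h q Wsum_nonneg) auto
      finally show ?thesis .
    qed
    have NB: "(\<Sum>k<n. (ip ?F (\<phi> k))\<^sup>2) \<le> NN" for n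
      using bessel[OF FL, of n] nsq_diff_le[OF aL] adv4[OF uC[OF t] uM[OF t]] adv4[OF vs[OF t] vN[OF t]]
      unfolding NN_def by linarith
    have VB: "2 * \<bar>ip ?F (W \<tau>)\<bar> \<le> \<nu> * gsq (W \<tau>) + (9 * (Wsum (r + s) * M\<^sup>2) / \<nu>) * nsq (W \<tau>)"
    proof -
      have "\<bar>ip ?F (W \<tau>)\<bar> \<le> \<nu> / 2 * gsq (W \<tau>) + 9 * (Wsum (r + s) * M\<^sup>2) / (2 * \<nu>) * nsq (W \<tau>)"
        unfolding W_def by (rule convective_difference[OF uC[OF t] uH[OF t] vs[OF t] vH[OF t] sigma \<nu> uM[OF t]])
      then show ?thesis using \<nu> by (simp add: field_simps)
    qed
    \<comment> \<open>The Navier-Stokes equation has no Voigt term. Adding A lam^r times the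
      coefficient of \<open>u'\<close> to both of its sides allows the subtraction and leaves this
      product as the source.\<close>
    have rel: "(1 + A * lam k powr r) * w' k \<tau> = A * lam k powr r * ip (u' \<tau>) (\<phi> k) - ip ?F (\<phi> k) - \<nu> * lam k * w k \<tau>" for k
    proof -
      have "ip (u' \<tau>) (\<phi> k) + ip (advection (u \<tau>) (u \<tau>)) (\<phi> k) + \<nu> * (lam k * ip (u \<tau>) (\<phi> k)) = 0"
        "(1 + A * lam k powr r) * ip (v' \<tau>) (\<phi> k) + ip (advection (v \<tau>) (v \<tau>)) (\<phi> k) + \<nu> * (lam k * ip (v \<tau>) (\<phi> k)) = 0"
        using elim by auto
      then show ?thesis unfolding w_def w'_def co by (simp add: algebra_simps)
    qed
    have X: "(\<lambda>k. lam k powr r * (ip (u' \<tau>) (\<phi> k))\<^sup>2) sums g \<tau>" and Q: "(\<lambda>k. lam k * (w k \<tau>)\<^sup>2) sums gsq (W \<tau>)"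
      using elim by auto
    have \<kappa>: "0 \<le> 9 * (Wsum (r + s) * M\<^sup>2) / \<nu>" using \<nu> Wsum_nonneg by simp
    note GL = galerkin_limit[OF powr_ge_zero lam_nonneg X Y(1) Z Q V NB VB A T \<nu> \<kappa> refl rel growth_def S_def]
    have "\<bar>S n \<tau>\<bar> \<le> G \<tau>" for n
    proof -
      have "\<bar>S n \<tau>\<bar> \<le> A * (g \<tau> + ?Y) + (NN + nsq (W \<tau>)) + 2 * \<nu> * gsq (W \<tau>) + growth * (nsq (W \<tau>) + A * ?Y)"
        by (rule GL(1))
      also have "\<dots> \<le> G \<tau>"
        unfolding G_def using gWb[OF t] Y(2) A \<nu> growth_nonneg
        by (intro add_mono mult_left_mono order_refl) (auto simp: m_def)
      finally show ?thesis .
    qed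
    then show ?case using GL(2,3) by blast
  qed
  have Es: "(\<lambda>k. (1 + A * lam k powr r) * (w k x)\<^sup>2) sums voigt_energy \<phi> lam r \<alpha> (W x)" if x: "x \<in> {0..T}" for x
    unfolding wW[OF x] A_def using r by (intro voigt_energy_sums Ws sobolev_r x) auto
  show "exp (- growth * t) * voigt_energy \<phi> lam r \<alpha> (\<lambda>x. u t x - v t x)
        + (LINT \<tau>|lebesgue_on {0..t}. exp (- growth * \<tau>) * (\<nu> * gsq (\<lambda>x. u \<tau> x - v \<tau> x)))
      \<le> voigt_energy \<phi> lam r \<alpha> (\<lambda>x. u 0 x - v 0 x) + \<alpha> powr (2 * r) * T * (LINT \<tau>|lebesgue_on {0..t}. g \<tau>)" if t: "t \<in> {0..T}"
    unfolding W_def[symmetric] A_def[symmetric]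
  proof -
    have GI: "integrable ?M G" unfolding G_def[abs_def] using g_integrable by simp
    have DI: "integrable ?M (\<lambda>\<tau>. \<nu> * gsq (W \<tau>))" using gWI by simp
    have t': "0 \<le> t" "t \<le> T" using t by auto
    have AT: "0 \<le> A * T" using A T0 by simp
    show "exp (- growth * t) * voigt_energy \<phi> lam r \<alpha> (W t) + (LINT \<tau>|lebesgue_on {0..t}. exp (- growth * \<tau>) * (\<nu> * gsq (W \<tau>)))
      \<le> voigt_energy \<phi> lam r \<alpha> (W 0) + A * T * (LINT \<tau>|lebesgue_on {0..t}. g \<tau>)"
      by (rule energy_inequality[OF t' growth_nonneg AT w'I wt S_def main GI g_integrable DI g_nonneg Es])
  qed
qed

end

section \<open>From the energy estimate to the error bounds\<close>

lemma hnorm_diff_commute: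
  assumes "f \<in> L2" "g \<in> L2"
  shows "hnorm \<sigma> (\<lambda>x. f x - g x) = hnorm \<sigma> (\<lambda>x. g x - f x)"
  using assms by (simp add: hnorm_def fourier_diff norm_minus_commute)

context stokes_basis
begin

text \<open>Initial values are attained only almost everywhere, and \<open>stokes_pow\<close> is a
  choice; the energy is still well defined because it is a series in the coefficients.\<close>

lemma voigt_energy_cong_AE:
  assumes f: "f \<in> H_space" "f \<in> sobolev r" and g: "g \<in> H_space" "g \<in> sobolev r" and r: "0 \<le> r"
    and e: "AE x in torus. f x = g x"
  shows "voigt_energy \<phi> lam r \<alpha> f = voigt_energy \<phi> lam r \<alpha> g"
proof -
  have "ip f (\<phi> k) = ip g (\<phi> k)" for k
    by (rule ip_cong_AE[OF e H_space_L2[OF f(1)] H_space_L2[OF g(1)] phi_L2])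
  then show ?thesis
    using voigt_energy_sums[OF f r, of \<alpha>] voigt_energy_sums[OF g r, of \<alpha>] by (simp add: sums_iff)
qed

lemma voigt_energy_AE_zero:
  assumes f: "f \<in> H_space" "f \<in> sobolev r" and r: "0 \<le> r" and e: "AE x in torus. f x = 0"
  shows "voigt_energy \<phi> lam r \<alpha> f = 0"
proof -
  have "ip f (\<phi> k) = 0" for k
    using ip_cong_AE[OF e H_space_L2[OF f(1)] L2_zero phi_L2, of k] by (simp add: ip_def)
  then show ?thesis using voigt_energy_sums[OF f r, of \<alpha>] by (simp add: sums_iff)
qed

end

lemma voigt_energy_nonneg: "0 \<le> voigt_energy \<phi> lam r \<alpha> f"
  by (simp add: voigt_energy_def)

lemma nsq_le_voigt_energy: "nsq f \<le> voigt_energy \<phi> lam r \<alpha> f"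
  by (simp add: voigt_energy_def L2norm_sq)

context nse_nsv
begin

text \<open>Chosen so that C / T = \<open>growth\<close> + 1 / T is at least the growth rate, while
  the summand 1 gives C \<ge> 1 and lets \<open>C * T\<close> majorise the factor \<open>T\<close>
  of the forcing.\<close>

definition C where
  "C = growth * T + 1"

lemma C_ge_1: "1 \<le> C"
  using growth_nonneg T by (simp add: C_def)

lemma integral_g_mono: "t \<in> {0..T} \<Longrightarrow> (LINT \<tau>|lebesgue_on {0..t}. g \<tau>) \<le> (LINT \<tau>|lebesgue_on {0..T}. g \<tau>)"
proof -
  assume t: "t \<in> {0..T}"
  have "(LINT \<tau>|lebesgue_on {0..t}. g \<tau>) = (LINT \<tau>|lebesgue_on {0..T}. indicator {0..t} \<tau> * g \<tau>)"
    using t by (intro lebesgue_on_subinterval_integral) auto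
  also have "\<dots> \<le> (LINT \<tau>|lebesgue_on {0..T}. g \<tau>)"
    by (rule integral_mono_AE'[OF g_integrable]) (auto simp: indicator_def g_nonneg)
  finally show ?thesis .
qed

lemma integral_g_nonneg: "0 \<le> (LINT \<tau>|lebesgue_on {0..t}. g \<tau>)"
  by (intro integral_nonneg_AE) (simp add: g_nonneg)

text \<open>Both conclusions come from \<open>energy_estimate\<close>: \<open>voigt_error\<close>
  drops the dissipation integral, \<open>H1_error\<close> keeps it and evaluates at t = T.\<close>

lemma
  assumes u0: "u0 \<in> V_space \<inter> sobolev (r + s)" and v0: "v0 \<in> V_space \<inter> sobolev (r + s)"
    and \<alpha>: "\<alpha> > 0" and nsv: "nsv_solution \<phi> lam r \<nu> \<alpha> T v0 v v'"
    and vC: "v \<in> C_time T (sobolev (r + s)) (hnorm (r + s))"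
    and vL: "v \<in> L2_time T (sobolev (r + s + 1)) (hnorm (r + s + 1))"
  shows voigt_error: "t \<in> {0..T} \<Longrightarrow> voigt_energy \<phi> lam r \<alpha> (\<lambda>x. u t x - v t x)
      \<le> voigt_energy \<phi> lam r \<alpha> (\<lambda>x. u0 x - v0 x) * exp (C / T * t)
        + C * T * \<alpha> powr (2 * r) * (LINT \<tau>|lebesgue_on {0..t}. g \<tau>) * exp (C / T * t)"
    and H1_error: "(LINT t|lebesgue_on {0..T}. (hnorm 1 (\<lambda>x. v t x - u t x))\<^sup>2)
      \<le> exp (growth * T) * (T + 1 / \<nu>)
        * (voigt_energy \<phi> lam r \<alpha> (\<lambda>x. u0 x - v0 x) + \<alpha> powr (2 * r) * T * (LINT \<tau>|lebesgue_on {0..T}. g \<tau>))"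
proof -
  interpret fm: finite_measure "lebesgue_on {0..T}" by (rule finite_measure_lebesgue_on) auto
  define A where "A = \<alpha> powr (2 * r)"
  have A: "0 \<le> A" by (simp add: A_def)
  define W where "W t = (\<lambda>x. u t x - v t x)" for t
  define E where "E t = voigt_energy \<phi> lam r \<alpha> (W t)" for t
  define E0 where "E0 = voigt_energy \<phi> lam r \<alpha> (\<lambda>x. u0 x - v0 x)"
  define I where "I t = (LINT \<tau>|lebesgue_on {0..t}. g \<tau>)" for t
  note nn = voigt_energy_nonneg[of \<phi> lam r \<alpha>]
  have r0: "0 \<le> r" using r by simp
  have vs: "v t \<in> sobolev (r + s)" and vH: "v t \<in> H_space" if "t \<in> {0..T}" for t
    using that vC nsv by (auto simp: C_time_def nsv_solution_def intro: V_space_H_space)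
  have E_init: "E 0 = E0"
    unfolding E_def E0_def W_def
  proof (rule voigt_energy_cong_AE)
    have 0: "0 \<in> {0..T}" using T by simp
    show "(\<lambda>x. u 0 x - v 0 x) \<in> H_space" "(\<lambda>x. u 0 x - v 0 x) \<in> sobolev r"
      by (intro H_space_diff sobolev_diff sobolev_r uH vH uC vs 0)+
    show "(\<lambda>x. u0 x - v0 x) \<in> H_space" "(\<lambda>x. u0 x - v0 x) \<in> sobolev r"
      using u0 v0 by (auto intro!: H_space_diff[OF V_space_H_space V_space_H_space] sobolev_diff sobolev_r)
    have "AE x in torus. v 0 x = v0 x" using nsv by (simp add: nsv_solution_def)
    with u_init show "AE x in torus. u 0 x - v 0 x = u0 x - v0 x" by eventually_elim simp
  qed (rule r0)
  note est = energy_estimate[OF \<alpha> nsv vC vL, folded W_def A_def, folded E_def, unfolded E_init, folded I_def]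
  have Dn: "0 \<le> (LINT \<tau>|lebesgue_on {0..t}. exp (- growth * \<tau>) * (\<nu> * gsq (W \<tau>)))" for t
    using \<nu> by (intro integral_nonneg_AE) simp
  have I0: "0 \<le> I t" for t unfolding I_def by (rule integral_g_nonneg)
  have E00: "0 \<le> E0" unfolding E0_def by (rule nn)
  have main: "E t \<le> exp (growth * t) * (E0 + A * T * I t)" if t: "t \<in> {0..T}" for t
  proof -
    have "exp (- growth * t) * E t \<le> E0 + A * T * I t" using est(2)[OF t] Dn[of t] by linarith
    then have "exp (growth * t) * (exp (- growth * t) * E t) \<le> exp (growth * t) * (E0 + A * T * I t)"
      by (intro mult_left_mono) auto
    moreover have "exp (growth * t) * (exp (- growth * t) * E t) = E t"
      by (simp add: mult.assoc[symmetric] exp_add[symmetric])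
    ultimately show ?thesis by (simp only:)
  qed
  show "voigt_energy \<phi> lam r \<alpha> (\<lambda>x. u t x - v t x)
      \<le> voigt_energy \<phi> lam r \<alpha> (\<lambda>x. u0 x - v0 x) * exp (C / T * t)
        + C * T * \<alpha> powr (2 * r) * (LINT \<tau>|lebesgue_on {0..t}. g \<tau>) * exp (C / T * t)" if t: "t \<in> {0..T}"
    unfolding W_def[symmetric] A_def[symmetric] E0_def[symmetric] I_def[symmetric] E_def[symmetric]
  proof -
    have CT: "C / T = growth + 1 / T" using T by (simp add: C_def field_simps)
    have "E t \<le> exp (growth * t) * (E0 + A * T * I t)" by (rule main[OF t])
    also have "\<dots> \<le> exp (C / T * t) * (E0 + C * (A * T * I t))"
    proof (rule mult_mono)
      show "exp (growth * t) \<le> exp (C / T * t)" using t T unfolding CT by (simp add: distrib_right)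
      have "1 * (A * T * I t) \<le> C * (A * T * I t)" using A T I0 by (intro mult_right_mono C_ge_1) simp
      then show "E0 + A * T * I t \<le> E0 + C * (A * T * I t)" by simp
      show "0 \<le> E0 + A * T * I t" using E00 A T I0 by simp
    qed simp
    finally show "E t \<le> E0 * exp (C / T * t) + C * T * A * I t * exp (C / T * t)"
      by (simp add: algebra_simps)
  qed
  define K where "K = E0 + A * T * I T"
  have K0: "0 \<le> K" using E00 A T I0 by (simp add: K_def)
  have EK: "E t \<le> exp (growth * T) * K" if t: "t \<in> {0..T}" for t
  proof -
    have "I t \<le> I T" unfolding I_def by (rule integral_g_mono[OF t])
    then have "E0 + A * T * I t \<le> K" unfolding K_def using A T by (intro add_left_mono mult_left_mono) auto
    moreover have "exp (growth * t) \<le> exp (growth * T)" using t growth_nonneg by (simp add: mult_left_mono)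
    ultimately have "exp (growth * t) * (E0 + A * T * I t) \<le> exp (growth * T) * K"
      using E00 A T I0 by (intro mult_mono) auto
    then show ?thesis using main[OF t] by linarith
  qed
  have gI: "integrable (lebesgue_on {0..T}) (\<lambda>t. gsq (W t))" by (rule est(1))
  have h1: "(hnorm 1 (\<lambda>x. v t x - u t x))\<^sup>2 = nsq (W t) + gsq (W t)" if t: "t \<in> {0..T}" for t
    using hnorm_diff_commute[OF H_space_L2[OF vH[OF t]] H_space_L2[OF uH[OF t]], of 1]
      hnorm_1_sq[OF sobolev_1[OF sobolev_diff(1)[OF uC[OF t] vs[OF t]]]] by (simp add: W_def)
  have mT: "measure (lebesgue_on {0..T}) {0..T} = T"
    using T by (simp add: measure_restrict_space)
  have "(LINT t|lebesgue_on {0..T}. (hnorm 1 (\<lambda>x. v t x - u t x))\<^sup>2) \<le> (LINT t|lebesgue_on {0..T}. exp (growth * T) * K + gsq (W t))"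
  \<comment> \<open>The L^2 part of the H^1 norm is bounded by the energy at each time, and the
    gradient part is left to the dissipation integral. The rule asks for integrability of the
    majorant only.\<close>
  proof (rule integral_mono_AE')
    show "integrable (lebesgue_on {0..T}) (\<lambda>t. exp (growth * T) * K + gsq (W t))" using gI by simp
    show "AE t in lebesgue_on {0..T}. (hnorm 1 (\<lambda>x. v t x - u t x))\<^sup>2 \<le> exp (growth * T) * K + gsq (W t)"
    proof (intro AE_I2)
      fix t assume "t \<in> space (lebesgue_on {0..T})"
      then have t: "t \<in> {0..T}" by simp
      show "(hnorm 1 (\<lambda>x. v t x - u t x))\<^sup>2 \<le> exp (growth * T) * K + gsq (W t)"
        unfolding h1[OF t] using EK[OF t] nsq_le_voigt_energy[of "W t" \<phi> lam r \<alpha>] unfolding E_def by linarith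
    qed
    show "AE t in lebesgue_on {0..T}. 0 \<le> exp (growth * T) * K + gsq (W t)" using K0 by simp
  qed
  also have "\<dots> = exp (growth * T) * K * T + (LINT t|lebesgue_on {0..T}. gsq (W t))"
    using gI mT by simp
  also have "(LINT t|lebesgue_on {0..T}. gsq (W t)) \<le> exp (growth * T) * K / \<nu>"
  proof -
    have TT: "T \<in> {0..T}" using T by simp
    \<comment> \<open>On [0, T] the exponential weight is at least its value at T, a constant that
      can be taken out of the integral.\<close>
    have "(LINT \<tau>|lebesgue_on {0..T}. exp (- growth * T) * (\<nu> * gsq (W \<tau>))) \<le> (LINT \<tau>|lebesgue_on {0..T}. exp (- growth * \<tau>) * (\<nu> * gsq (W \<tau>)))"
    proof (rule integral_mono_AE')
      show "integrable (lebesgue_on {0..T}) (\<lambda>\<tau>. exp (- growth * \<tau>) * (\<nu> * gsq (W \<tau>)))"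
        using gI by (intro integrable_exp_mult growth_nonneg) simp
      show "AE \<tau> in lebesgue_on {0..T}. exp (- growth * T) * (\<nu> * gsq (W \<tau>)) \<le> exp (- growth * \<tau>) * (\<nu> * gsq (W \<tau>))"
        using \<nu> growth_nonneg by (intro AE_I2 mult_right_mono) (auto simp: mult_left_mono)
    qed (use \<nu> in simp)
    also have "\<dots> \<le> K"
      using est(2)[OF TT] mult_nonneg_nonneg[OF exp_ge_zero[of "- growth * T"] nn[of "W T"]] unfolding K_def E_def by linarith
    finally have "exp (- growth * T) * (\<nu> * (LINT \<tau>|lebesgue_on {0..T}. gsq (W \<tau>))) \<le> K" by simp
    then have "exp (growth * T) * (exp (- growth * T) * (\<nu> * (LINT \<tau>|lebesgue_on {0..T}. gsq (W \<tau>)))) \<le> exp (growth * T) * K"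
      by (intro mult_left_mono) auto
    then have "\<nu> * (LINT \<tau>|lebesgue_on {0..T}. gsq (W \<tau>)) \<le> exp (growth * T) * K"
      by (simp add: mult.assoc[symmetric] exp_add[symmetric])
    then show ?thesis using \<nu> by (simp add: field_simps)
  qed
  finally show "(LINT t|lebesgue_on {0..T}. (hnorm 1 (\<lambda>x. v t x - u t x))\<^sup>2)
      \<le> exp (growth * T) * (T + 1 / \<nu>)
        * (voigt_energy \<phi> lam r \<alpha> (\<lambda>x. u0 x - v0 x) + \<alpha> powr (2 * r) * T * (LINT \<tau>|lebesgue_on {0..T}. g \<tau>))"
    unfolding E0_def[symmetric] A_def[symmetric] I_def[symmetric] K_def[symmetric]
    by (simp add: algebra_simps)
qed

end

theorem theorem5p6:
  fixes s \<nu> r T :: real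
    and \<phi> :: "nat \<Rightarrow> field" and lam :: "nat \<Rightarrow> real"
    and u0 :: field and u0a :: "real \<Rightarrow> field"
    and u u' :: "real \<Rightarrow> field" and ua ua' :: "real \<Rightarrow> real \<Rightarrow> field"
  assumes "stokes_eigenbasis \<phi> lam"
    and "s > 1" and "\<nu> > 0" and "1 / 2 \<le> r" and "r \<le> 1"
    and "u0 \<in> V_space \<inter> sobolev (r + s)"
    and "\<And>\<alpha>. \<alpha> > 0 \<Longrightarrow> u0a \<alpha> \<in> V_space \<inter> sobolev (r + s)"
    and "0 < T" and "ereal T < T_max \<nu> u0"
    and "nse_strong \<nu> T u0 u u'"
    and "u \<in> C_time T (sobolev (r + s)) (hnorm (r + s))"
    and "u \<in> L2_time T (sobolev (r + s + 1)) (hnorm (r + s + 1))"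
    and "\<And>\<alpha>. \<alpha> > 0 \<Longrightarrow> nsv_solution \<phi> lam r \<nu> \<alpha> T (u0a \<alpha>) (ua \<alpha>) (ua' \<alpha>)"
    and "\<And>\<alpha>. \<alpha> > 0 \<Longrightarrow> ua \<alpha> \<in> C_time T (sobolev (r + s)) (hnorm (r + s))"
    and "\<And>\<alpha>. \<alpha> > 0 \<Longrightarrow> ua \<alpha> \<in> L2_time T (sobolev (r + s + 1)) (hnorm (r + s + 1))"
  shows "(\<exists>C>0. \<forall>\<alpha>>0. \<forall>t\<in>{0..T}.
            voigt_energy \<phi> lam r \<alpha> (\<lambda>x. u t x - ua \<alpha> t x)
              \<le> voigt_energy \<phi> lam r \<alpha> (\<lambda>x. u0 x - u0a \<alpha> x) * exp (C / T * t)
                + C * T * \<alpha> powr (2 * r)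
                  * (LINT \<tau>|lebesgue_on {0..t}. (L2norm (stokes_pow \<phi> lam (r / 2) (u' \<tau>)))\<^sup>2)
                  * exp (C / T * t))
       \<and> (((\<lambda>\<alpha>. voigt_energy \<phi> lam r \<alpha> (\<lambda>x. u0 x - u0a \<alpha> x)) \<longlongrightarrow> 0) (at_right 0)
            \<longrightarrow> ((\<lambda>\<alpha>. LINT t|lebesgue_on {0..T}. (hnorm 1 (\<lambda>x. ua \<alpha> t x - u t x))\<^sup>2) \<longlongrightarrow> 0) (at_right 0))
       \<and> ((\<forall>\<alpha>>0. AE x in torus. u0a \<alpha> x = u0 x)
            \<longrightarrow> ((\<lambda>\<alpha>. LINT t|lebesgue_on {0..T}. (hnorm 1 (\<lambda>x. ua \<alpha> t x - u t x))\<^sup>2) \<longlongrightarrow> 0) (at_right 0))"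
proof -
  interpret stokes_basis \<phi> lam by unfold_locales (rule assms(1))
  have T0: "0 \<le> T" using assms(8) by simp
  obtain M where uC: "\<And>t. t \<in> {0..T} \<Longrightarrow> u t \<in> sobolev (r + s)"
    and uM: "\<And>t. t \<in> {0..T} \<Longrightarrow> hnorm (r + s) (u t) \<le> M"
    by (rule hnorm_bounded[OF assms(11) T0]) blast
  interpret nse_nsv \<phi> lam s \<nu> r T u0 u u' M
    by unfold_locales (fact assms(2-5,8,10,12) uC uM)+
  let ?V = "\<lambda>\<alpha>. voigt_energy \<phi> lam r \<alpha> (\<lambda>x. u0 x - u0a \<alpha> x)"
  let ?I = "LINT \<tau>|lebesgue_on {0..T}. g \<tau>"
  let ?J = "\<lambda>\<alpha>. LINT t|lebesgue_on {0..T}. (hnorm 1 (\<lambda>x. ua \<alpha> t x - u t x))\<^sup>2"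
  have i: "\<exists>C>0. \<forall>\<alpha>>0. \<forall>t\<in>{0..T}.
            voigt_energy \<phi> lam r \<alpha> (\<lambda>x. u t x - ua \<alpha> t x)
              \<le> ?V \<alpha> * exp (C / T * t)
                + C * T * \<alpha> powr (2 * r)
                  * (LINT \<tau>|lebesgue_on {0..t}. (L2norm (stokes_pow \<phi> lam (r / 2) (u' \<tau>)))\<^sup>2)
                  * exp (C / T * t)"
  proof (intro exI[of _ C] conjI allI impI ballI)
    show "0 < C" using C_ge_1 by linarith
  qed (rule voigt_error[unfolded g_def, OF assms(6) assms(7) _ assms(13-15)])
  \<comment> \<open>In \<open>H1_error\<close> everything except the initial energy and the power of
    \<alpha> is independent of \<alpha>.\<close>
  have ii: "(?J \<longlongrightarrow> 0) (at_right 0)" if V: "(?V \<longlongrightarrow> 0) (at_right 0)"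
  proof (rule tendsto_sandwich[OF _ _ tendsto_const])
    show "\<forall>\<^sub>F \<alpha> in at_right 0. 0 \<le> ?J \<alpha>"
      by (intro always_eventually allI integral_nonneg_AE) simp
    show "\<forall>\<^sub>F \<alpha> in at_right 0. ?J \<alpha> \<le> exp (growth * T) * (T + 1 / \<nu>) * (?V \<alpha> + \<alpha> powr (2 * r) * T * ?I)"
      using eventually_at_right_less[of "0::real"]
      by eventually_elim (rule H1_error[OF assms(6) assms(7) _ assms(13-15)])
    have "((\<lambda>\<alpha>. \<alpha> powr (2 * r)) \<longlongrightarrow> 0) (at_right 0)"
      using assms(4) by (intro tendsto_zero_powrI[where b = "2 * r"] tendsto_ident_at tendsto_const)
        (auto simp: eventually_at_right_less intro: eventually_mono[OF eventually_at_right_less])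
    then have "((\<lambda>\<alpha>. exp (growth * T) * (T + 1 / \<nu>) * (?V \<alpha> + \<alpha> powr (2 * r) * T * ?I)) \<longlongrightarrow>
        exp (growth * T) * (T + 1 / \<nu>) * (0 + 0 * T * ?I)) (at_right 0)"
      by (intro tendsto_intros V)
    then show "((\<lambda>\<alpha>. exp (growth * T) * (T + 1 / \<nu>) * (?V \<alpha> + \<alpha> powr (2 * r) * T * ?I)) \<longlongrightarrow> 0) (at_right 0)"
      by simp
  qed
  have iii: "(?J \<longlongrightarrow> 0) (at_right 0)" if e: "\<forall>\<alpha>>0. AE x in torus. u0a \<alpha> x = u0 x"
  proof (rule ii)
    have "?V \<alpha> = 0" if \<alpha>: "\<alpha> > 0" for \<alpha>
    proof (rule voigt_energy_AE_zero)
      show "(\<lambda>x. u0 x - u0a \<alpha> x) \<in> H_space" "(\<lambda>x. u0 x - u0a \<alpha> x) \<in> sobolev r"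
        using assms(6) assms(7)[OF \<alpha>] by (auto intro!: H_space_diff[OF V_space_H_space V_space_H_space] sobolev_diff sobolev_r)
      have "AE x in torus. u0a \<alpha> x = u0 x" using e \<alpha> by blast
      then show "AE x in torus. u0 x - u0a \<alpha> x = 0" by eventually_elim simp
    qed (use assms(4) in simp)
    then have "\<forall>\<^sub>F \<alpha> in at_right 0. ?V \<alpha> = 0"
      by (intro eventually_mono[OF eventually_at_right_less[of "0::real"]])
    then show "(?V \<longlongrightarrow> 0) (at_right 0)" by (rule tendsto_eventually)
  qed
  show ?thesis using i ii iii by blast
qed

end
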